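(* Let $E^\omega$ be the nonautonomous affine set with random translations in $\mathbb R^d$, generated by nonsingular matrices $T_{k,i}$ ($1\le i\le n_k$, $k\ge1$) with $0<\alpha_-\le\alpha_+<1$, where $\alpha_+=\sup_{k,i}\alpha_1(T_{k,i})$ and $\alpha_-=\inf_{k,i}\alpha_d(T_{k,i})$. Let $\mu$ be a positive finite Borel measure on $\Sigma^\infty$, and let $\mu^\omega$ be its image measure under the projection $\Pi^\omega$. Then for $q>1$, for almost all $\omega$ (with respect to $\mathbf P$), $$\underline D_q(\mu^\omega)=\min\{d_q^-,d\},$$ where $$d_q^-=\sup\Big\{s:\sum_{k=1}^\infty\sum_{\mathbf u\in\Sigma^k}\psi^s(T_{\mathbf u})^{1-q}\mu(\mathcal C_{\mathbf u})^q<\infty\Big\}.$$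
   Context: **Words.** Let $\{n_k\}_{k\ge1}$ be integers $\ge2$; $\Sigma^k=\{u_1\cdots u_k:1\le u_j\le n_j\}$, $\Sigma^0=\{\emptyset\}$, $\Sigma^*=\bigcup_{k\ge0}\Sigma^k$, $\Sigma^\infty=\{u_1u_2\cdots:1\le u_k\le n_k\}$. $\mathcal C_{\mathbf u}\subset\Sigma^\infty$ is the cylinder of infinite words with prefix $\mathbf u$. **Nonautonomous affine set with random translations.** Let $J\subset\mathbb R^d$ be compact with non-empty interior and let $\Xi_k=\{T_{k,1},\dots,T_{k,n_k}\}$ be collections of $d\times d$ matrices with $\|T_{k,j}\|<1$. Let $\mathcal D\subset\mathbb R^d$ be a bounded region. For each $\mathbf u\in\Sigma^*$ let $\omega_{\mathbf u}\in\mathcal D$ be a random vector distributed according to a Borel probability measure $P_{\mathbf u}=P$ that is absolutely continuous with respect to $d$-dimensional Lebesgue measure; the $\omega_{\mathbf u}$ are independent and identically distributed, and $\mathbf P=\prod_{\mathbf u\in\Sigma^*}P_{\mathbf u}$ is the product probability measure on the family $\omega=\{\omega_{\mathbf u}:\mathbf u\in\Sigma^*\}$. For $\mathbf u=u_1\cdots u_k$ put $\Psi_{u_j}(x)=T_{j,u_j}x+\omega_{u_1\cdots u_j}$ and $J_{\mathbf u}=\Psi_{u_1}\circ\cdots\circ\Psi_{u_k}(J)$, $J_\emptyset=J$. It is assumed that these sets fulfil the nonautonomous structure: $J_{\mathbf u i}\subset J_{\mathbf u}\subset J$ for all $\mathbf u\in\Sigma^{k-1}$, $1\le i\le n_k$,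 and $\max_{\mathbf u\in\Sigma^k}|J_{\mathbf u}|\to0$ as $k\to\infty$ ($|\cdot|$ is diameter). Then $E^\omega=\bigcap_{k\ge1}\bigcup_{\mathbf u\in\Sigma^k}J_{\mathbf u}$. The projection $\Pi^\omega:\Sigma^\infty\to E^\omega$ sends $\mathbf u=u_1u_2\cdots$ to the unique point of $\bigcap_kJ_{u_1\cdots u_k}$, and $\mu^\omega(A)=\mu\{\mathbf u:\Pi^\omega(\mathbf u)\in A\}$. **Generalized $q$-dimension.** Let $\mathcal M_r$ be the family of $r$-mesh cubes $[j_1r,(j_1+1)r)\times\cdots\times[j_dr,(j_d+1)r)$, $j_i\in\mathbb Z$. For a finite Borel measure $\nu$ on $\mathbb R^d$ and $q\ne1$, $\underline D_q(\nu)=\liminf_{r\to0}\frac{\log\sum_{Q\in\mathcal M_r}\nu(Q)^q}{(q-1)\log r}$. **Singular value function.** For a contracting nonsingular linear $T$ with singular values $1>\alpha_1(T)\ge\cdots\ge\alpha_d(T)>0$: $\psi^s(T)=\alpha_1(T)\cdots\alpha_{m-1}(T)\alpha_m(T)^{s-m+1}$ for $0<s\le d$, where $m$ is the integer with $m-1<s\le m$; $\psi^0(T)=1$; and $\psi^s(T)=(\alpha_1(T)\cdots\alpha_d(T))^{s/d}$ for $s>d$. For $\mathbf u=u_1\cdots u_k$, $T_{\mathbf u}=T_{1,u_1}\cdots T_{k,u_k}$. In the supremum defining $d_q^-$, $s$ ranges over $s>0$, with $\sup\emptyset=0$. *)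

theory Defs
  imports
    "HOL-Probability.Probability"
    "HOL-Computational_Algebra.Computational_Algebra"
begin

text \<open>
  The level-indexed data \<open>n k\<close> and \<open>T k j\<close> are used for \<open>k \<ge> 1\<close> only. A finite word is the list of its
  letters, so that letter number \<open>j\<close> of \<open>u\<close> is \<open>u ! (j - 1)\<close>. An infinite word is a function whose value
  at \<open>k\<close> is letter number \<open>k + 1\<close>.
\<close>

definition words :: "(nat \<Rightarrow> nat) \<Rightarrow> nat \<Rightarrow> nat list set" where
  "words n k = {u. length u = k \<and> (\<forall>j\<in>{1..k}. u ! (j - 1) \<in> {1..n j})}"

definition fin_words :: "(nat \<Rightarrow> nat) \<Rightarrow> nat list set" where
  "fin_words n = (\<Union>k. words n k)"

definition inf_words :: "(nat \<Rightarrow> nat) \<Rightarrow> (nat \<Rightarrow> nat) set" where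
  "inf_words n = {w. \<forall>k\<ge>1. w (k - 1) \<in> {1..n k}}"

definition prefix_word :: "nat \<Rightarrow> (nat \<Rightarrow> nat) \<Rightarrow> nat list" where
  "prefix_word k w = map w [0..<k]"

definition cylinder :: "(nat \<Rightarrow> nat) \<Rightarrow> nat list \<Rightarrow> (nat \<Rightarrow> nat) set" where
  "cylinder n u = {w \<in> inf_words n. prefix_word (length u) w = u}"


definition charpoly :: "'a::idom ^'d^'d \<Rightarrow> 'a poly" where
  "charpoly A = det (mat [:0, 1:] - map_matrix (\<lambda>a. [:a:]) A)"

text \<open>
  The singular values are the square roots of the eigenvalues of \<open>transpose A ** A\<close>, counted with
  multiplicity. They are numbered from 1 in non-increasing order.
\<close>

definition sing_value :: "real^'d^'d \<Rightarrow> nat \<Rightarrow> real" where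
  "sing_value A i =
     rev (sorted_list_of_multiset (image_mset sqrt (proots (charpoly (transpose A ** A))))) ! (i - 1)"

definition sing_value_fun :: "real \<Rightarrow> real^'d^'d \<Rightarrow> real" where
  "sing_value_fun s A =
     (if s = 0 then 1
      else if s \<le> real CARD('d) then
        (let m = nat \<lceil>s\<rceil> in
          (\<Prod>i\<in>{1..m - 1}. sing_value A i) * sing_value A m powr (s - real m + 1))
      else (\<Prod>i\<in>{1..CARD('d)}. sing_value A i) powr (s / real CARD('d)))"


definition word_matrix :: "(nat \<Rightarrow> nat \<Rightarrow> real^'d^'d) \<Rightarrow> nat list \<Rightarrow> real^'d^'d" where
  "word_matrix T u = foldr (**) (map (\<lambda>j. T j (u ! (j - 1))) [1..<Suc (length u)]) (mat 1)"

definition level_map ::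
  "(nat \<Rightarrow> nat \<Rightarrow> real^'d^'d) \<Rightarrow> (nat list \<Rightarrow> real^'d) \<Rightarrow> nat list \<Rightarrow> nat \<Rightarrow> real^'d \<Rightarrow> real^'d" where
  "level_map T \<omega> u j = (\<lambda>x. T j (u ! (j - 1)) *v x + \<omega> (take j u))"

definition basic_set ::
  "(nat \<Rightarrow> nat \<Rightarrow> real^'d^'d) \<Rightarrow> (real^'d) set \<Rightarrow> (nat list \<Rightarrow> real^'d) \<Rightarrow> nat list \<Rightarrow> (real^'d) set" where
  "basic_set T J \<omega> u = foldr (\<circ>) (map (level_map T \<omega> u) [1..<Suc (length u)]) id ` J"

definition nonautonomous_structure ::
  "(nat \<Rightarrow> nat) \<Rightarrow> (nat \<Rightarrow> nat \<Rightarrow> real^'d^'d) \<Rightarrow> (real^'d) set \<Rightarrow> (nat list \<Rightarrow> real^'d) \<Rightarrow> bool" where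
  "nonautonomous_structure n T J \<omega> \<longleftrightarrow>
     (\<forall>k\<ge>1. \<forall>u\<in>words n (k - 1). \<forall>i\<in>{1..n k}.
        basic_set T J \<omega> (u @ [i]) \<subseteq> basic_set T J \<omega> u \<and> basic_set T J \<omega> u \<subseteq> J) \<and>
     (\<lambda>k. Max ((\<lambda>u. diameter (basic_set T J \<omega> u)) ` words n k)) \<longlonglongrightarrow> 0"

definition affine_set ::
  "(nat \<Rightarrow> nat) \<Rightarrow> (nat \<Rightarrow> nat \<Rightarrow> real^'d^'d) \<Rightarrow> (real^'d) set \<Rightarrow> (nat list \<Rightarrow> real^'d) \<Rightarrow> (real^'d) set" where
  "affine_set n T J \<omega> = (\<Inter>k\<in>{1..}. \<Union>u\<in>words n k. basic_set T J \<omega> u)"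

text \<open>
  For an infinite word \<open>w\<close> over the alphabets, the unique point below lies in \<open>affine_set n T J \<omega>\<close>.
\<close>

definition projection ::
  "(nat \<Rightarrow> nat \<Rightarrow> real^'d^'d) \<Rightarrow> (real^'d) set \<Rightarrow> (nat list \<Rightarrow> real^'d) \<Rightarrow> (nat \<Rightarrow> nat) \<Rightarrow> real^'d" where
  "projection T J \<omega> w = (THE x. x \<in> (\<Inter>k\<in>{1..}. basic_set T J \<omega> (prefix_word k w)))"

text \<open>
  The image measure is regarded as a Borel measure on the whole space.
\<close>

definition image_measure ::
  "(nat \<Rightarrow> nat \<Rightarrow> real^'d^'d) \<Rightarrow> (real^'d) set \<Rightarrow> (nat \<Rightarrow> nat) measure \<Rightarrow> (nat list \<Rightarrow> real^'d) \<Rightarrow>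
    (real^'d) measure" where
  "image_measure T J \<mu> \<omega> = distr \<mu> borel (projection T J \<omega>)"


definition mesh_cubes :: "real \<Rightarrow> (real^'d) set set" where
  "mesh_cubes r =
     range (\<lambda>j :: int^'d. {x. \<forall>i. of_int (j $ i) * r \<le> x $ i \<and> x $ i < (of_int (j $ i) + 1) * r})"

text \<open>
  For a finite measure and \<open>q > 1\<close> the sum over the mesh cubes converges. For \<open>q < 1\<close> it is meaningful
  for measures of bounded support: a divergent sum would count as 0.
\<close>

definition lower_gen_dim :: "real \<Rightarrow> (real^'d) measure \<Rightarrow> ereal" where
  "lower_gen_dim q \<nu> =
     Liminf (at_right 0) (\<lambda>r. ereal (ln (\<Sum>\<^sub>\<infinity>Q\<in>mesh_cubes r. measure \<nu> Q powr q) / ((q - 1) * ln r)))"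

text \<open>
  The supremum may be infinite, and over the empty set it is 0 by convention
  (in type \<^typ>\<open>ereal\<close> it would be \<open>-\<infinity>\<close>).
\<close>

definition d_minus ::
  "(nat \<Rightarrow> nat) \<Rightarrow> (nat \<Rightarrow> nat \<Rightarrow> real^'d^'d) \<Rightarrow> (nat \<Rightarrow> nat) measure \<Rightarrow> real \<Rightarrow> ereal" where
  "d_minus n T \<mu> q =
     (let S = {s. s > 0 \<and>
            summable (\<lambda>k. \<Sum>u\<in>words n (Suc k).
              sing_value_fun s (word_matrix T u) powr (1 - q) * measure \<mu> (cylinder n u) powr q)}
      in if S = {} then 0 else (SUP s\<in>S. ereal s))"

end

theory Submission
  imports Defs "HOL-Real_Asymp.Real_Asymp"
begin

text \<open>
  Upper bound, valid for every admissible \<open>\<omega>\<close>: if the lower dimension exceeds some \<open>t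
  > s\<close>, choose for each word \<open>u\<close> a mesh of size comparable to the singular value of
  \<open>T\<^sub>u\<close> with index \<open>\<lceil>s\<rceil>\<close>. The basic set of \<open>u\<close> meets
  at most a constant times \<open>\<psi>\<^sup>s(T\<^sub>u) r\<^sup>-\<^sup>s\<close> cubes of side
  \<open>r\<close>, so by the power mean inequality each summand of the series defining
  \<open>d\<^sub>q\<^sup>-\<close> is controlled by the mesh sum, and the level sums decay geometrically.

  Lower bound: the mesh sum at scale \<open>\<rho>\<close> is dominated by the \<open>(q - 1)\<close>-st moment
  of the mass of a \<open>\<rho>\<close>-ball, which for \<open>\<rho> = a\<^sup>k\<close> can be computed from
  the first \<open>2k\<close> levels of the tree, up to a constant factor in \<open>\<rho>\<close>. Although the
  density of \<open>P\<close> may be unbounded, the law of a long sum of independent translations, transported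
  by the matrices, is bounded up to an exponentially small mass. Hence two words separating after
  \<open>p\<close> have points within distance \<open>\<rho>\<close> with conditional probability at most a
  constant times \<open>\<rho>\<^sup>s / \<psi>\<^sup>s(T\<^sub>p)\<close>. Peeling off one factor of the moment
  at a time, always conditioning on the branch of the peeled word, gives a recursive bound; Young's and Jensen's
  inequalities reduce it to the series at the cost of a factor polynomial in \<open>k\<close>. This loss is
  harmless for \<open>\<rho> = a\<^sup>k\<close> because the exponent may be lowered slightly before summing the
  expectations over \<open>k\<close>.
\<close>

section \<open>Singular values\<close>

text \<open>The exponent \<open>q - 1\<close> need not be an integer. It is written as
  \<open>\<kappa> + real j\<close> with \<open>0 < \<kappa> \<le> 1\<close>: \<open>j\<close> whole
  factors are peeled off, and the remaining fractional power is compared with a first moment at the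
  cost of a factor 2. The obstacle is dependence: words with a common prefix share translations, so
  knowing one branch changes the law of the others. Expectations are taken only of
  \<open>correlation\<close>, a finite sum over words that dominates the mesh sum, so measurability
  of the dimension in \<omega> never arises. The exceptional null sets are merged over rational
  exponents. The cap at d has two sources: the volume estimates hold for \<open>s \<le> d\<close>,
  and counting cubes that meet \<open>J\<close> bounds the dimension by d. Values of the singular
  value function beyond d enter only through monotonicity in s.\<close>

lemma spectral_theorem_subspace:
  fixes f :: "'a::euclidean_space \<Rightarrow> 'a"
  assumes lin: "linear f" and sa: "\<And>x y. f x \<bullet> y = x \<bullet> f y"
    and V: "subspace V" "f ` V \<subseteq> V"
  shows "\<exists>B\<subseteq>V. pairwise orthogonal B \<and> (\<forall>b\<in>B. norm b = 1) \<and> span B = V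
    \<and> (\<forall>b\<in>B. \<exists>l. f b = l *\<^sub>R b)"
  using V
proof (induction "dim V" arbitrary: V rule: less_induct)
  case less
  note V = less.prems
  show ?case
  proof (cases "V = {0}")
    case True
    then show ?thesis by (intro exI[of _ "{}"]) auto
  next
    case False
    then obtain z where z: "z \<in> V" "z \<noteq> 0" using V(1) subspace_0 by blast
    have lz: "(1 / norm z) *\<^sub>R z \<in> V \<inter> sphere 0 1"
      using z V(1) by (auto simp: subspace_scale)
    have comp: "compact (V \<inter> sphere 0 1)"
      using V(1) by (intro closed_Int_compact closed_subspace) auto
    have cont: "continuous_on (V \<inter> sphere 0 1) (\<lambda>x. x \<bullet> f x)"
      by (intro continuous_intros linear_continuous_on) (use lin linear_conv_bounded_linear in blast)
    \<comment> \<open>A maximiser of the Rayleigh quotient on the unit sphere of \<open>V\<close> is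
      an eigenvector. Its orthogonal complement in \<open>V\<close> is again invariant and of
      smaller dimension, which is why the claim is made for all invariant subspaces.\<close>
    from continuous_attains_sup[OF comp _ cont] lz obtain x where
      "x \<in> V \<inter> sphere 0 1" "\<forall>y\<in>V \<inter> sphere 0 1. y \<bullet> f y \<le> x \<bullet> f x"
      by blast
    then have x: "x \<in> V" "norm x = 1" and max: "\<And>y. y \<in> V \<Longrightarrow> norm y = 1 \<Longrightarrow> y \<bullet> f y \<le> x \<bullet> f x"
      by auto
    define l where "l = x \<bullet> f x"
    have xx: "x \<bullet> x = 1" using x by (simp add: norm_eq_1)
    have bound: "y \<bullet> f y \<le> l * (y \<bullet> y)" if "y \<in> V" for y
    proof (cases "y = 0")
      case True then show ?thesis using lin by (simp add: linear_0)
    next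
      case False
      have "((1 / norm y) *\<^sub>R y) \<bullet> f ((1 / norm y) *\<^sub>R y) \<le> l"
        unfolding l_def using that False V(1) by (intro max) (auto simp: subspace_scale)
      then have "(y \<bullet> f y) / (norm y)^2 \<le> l"
        using lin by (simp add: linear_cmul power2_eq_square)
      then show ?thesis using False by (simp add: field_simps power2_norm_eq_inner)
    qed
    have orth: "f x \<bullet> y = 0" if y: "y \<in> V" "y \<bullet> x = 0" for y
    proof -
      define b c where "b = f x \<bullet> y" and "c = l * (y \<bullet> y) - y \<bullet> f y"
      \<comment> \<open>Maximality is tested at \<open>x + t y\<close>. The linear term in
        \<open>t\<close> must vanish, since for small \<open>t\<close> it would exceed the quadratic
        one; \<open>t = b / k\<close> with \<open>k > c\<close> is small enough.\<close>
      have key: "2 * t * b \<le> t^2 * c" for t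
      proof -
        have fxy: "f y \<bullet> x = b" "x \<bullet> f y = b" "y \<bullet> f x = b" "f x \<bullet> y = b"
          using sa[of x y] by (auto simp: b_def inner_commute)
        have "x + t *\<^sub>R y \<in> V" using x y V(1) by (simp add: subspace_add subspace_scale)
        from bound[OF this] have "l + 2 * t * b + t^2 * (y \<bullet> f y) \<le> l * (1 + t^2 * (y \<bullet> y))"
          using lin xx y(2) fxy
          by (simp add: linear_add linear_cmul inner_add_left inner_add_right l_def[symmetric]
              inner_commute[of x y] power2_eq_square algebra_simps)
        then show ?thesis by (simp add: c_def algebra_simps)
      qed
      have "b = 0"
      proof (rule ccontr)
        assume b: "b \<noteq> 0"
        define k where "k = 1 + \<bar>c\<bar>"
        have k: "k > 0" "c < k" by (auto simp: k_def)
        from key[of "b / k"] have "2 * (b / k) * b \<le> (b/k)^2 * c" .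
        then have "2 * k * b^2 \<le> b^2 * c"
          using k by (simp add: field_simps power2_eq_square)
        then have "2 * k \<le> c" using b
          by (metis mult.commute mult_le_cancel_left_pos zero_less_power2)
        then show False using k by simp
      qed
      then show ?thesis by (simp add: b_def)
    qed
    define W where "W = {y \<in> V. y \<bullet> x = 0}"
    have W: "subspace W" using V(1) by (auto simp: W_def subspace_def inner_add_left)
    have fx: "f x = l *\<^sub>R x"
    proof -
      define w where "w = f x - l *\<^sub>R x"
      have "w \<in> V" unfolding w_def using V x by (auto intro!: subspace_diff subspace_scale)
      moreover have wx: "w \<bullet> x = 0"
        using inner_commute[of x "f x"] by (simp add: w_def inner_diff_left l_def xx)
      ultimately have "f x \<bullet> w = 0" by (rule orth)
      moreover have "x \<bullet> w = 0" using wx inner_commute[of x w] by simp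
      moreover have "w \<bullet> w = f x \<bullet> w - l * (x \<bullet> w)"
        by (subst (1) w_def) (simp add: inner_diff_left)
      ultimately have "w \<bullet> w = 0" by simp
      then show ?thesis by (simp add: w_def)
    qed
    have fW: "f ` W \<subseteq> W" using V(2) by (auto simp: W_def sa fx)
    have "x \<notin> W" using xx by (simp add: W_def)
    moreover have "W \<subseteq> V" by (auto simp: W_def)
    ultimately have WV: "W \<subset> V" using x by blast
    then have "dim W < dim V" using W V(1) dim_psubset[of W V] by (simp only: span_eq_iff[THEN iffD2])
    from less.hyps[OF this W fW] obtain B where
      B: "B \<subseteq> W" "pairwise orthogonal B" "\<And>b. b\<in>B \<Longrightarrow> norm b = 1" "span B = W"
        "\<And>b. b\<in>B \<Longrightarrow> \<exists>l. f b = l *\<^sub>R b" by blast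
    have "span (insert x B) = V"
    proof
      show "span (insert x B) \<subseteq> V"
        using x B(1) V(1) by (intro span_minimal) (auto simp: W_def)
      show "V \<subseteq> span (insert x B)"
      proof
        fix v assume v: "v \<in> V"
        have "v - (v \<bullet> x) *\<^sub>R x \<in> W"
          using v x V(1) xx by (auto simp: W_def subspace_diff subspace_scale inner_diff_left)
        then show "v \<in> span (insert x B)" unfolding span_insert B(4) by blast
      qed
    qed
    moreover have "pairwise orthogonal (insert x B)"
      using B(1,2) by (auto simp: pairwise_insert W_def orthogonal_def inner_commute)
    ultimately show ?thesis
      using B x WV fx by (intro exI[of _ "insert x B"]) auto
  qed
qed

lemma symmetric_matrix_eigenbasis:
  fixes M :: "real^'d^'d"
  assumes "transpose M = M"
  obtains v l where "\<And>i j :: 'd. v i \<bullet> v j = (if i = j then 1 else 0)"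
    "\<And>i. M *v v i = l i *\<^sub>R v i"
proof -
  have "(M *v x) \<bullet> y = x \<bullet> (M *v y)" for x y
    by (metis assms dot_lmul_matrix vector_transpose_matrix)
  from spectral_theorem_subspace[OF matrix_vector_mul_linear this subspace_UNIV] obtain B where
    B: "pairwise orthogonal B" "\<And>b. b\<in>B \<Longrightarrow> norm b = 1" "span B = (UNIV :: (real^'d) set)"
      "\<And>b. b\<in>B \<Longrightarrow> \<exists>l. M *v b = l *\<^sub>R b" by blast
  have ind: "independent B" using B(1,2)
    by (intro pairwise_orthogonal_independent) (metis norm_zero zero_neq_one)+
  then have "card B = dim (UNIV :: (real^'d) set)"
    using B(3) by (metis dim_span_eq_card_independent)
  then have card: "card B = CARD('d)" by simp
  have "finite B" using ind by (rule independent_imp_finite)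
  then obtain v where v: "bij_betw v (UNIV :: 'd set) B"
    using card finite_same_card_bij[of "UNIV :: 'd set" B] by auto
  then have vB: "v i \<in> B" for i by (auto simp: bij_betw_def)
  from B(4) vB have "\<forall>i. \<exists>l. M *v v i = l *\<^sub>R v i" by blast
  then obtain l where l: "\<And>i. M *v v i = l i *\<^sub>R v i" by metis
  have "v i \<bullet> v j = (if i = j then 1 else 0)" for i j
  proof (cases "i = j")
    case True then show ?thesis using B(2) vB by (simp add: norm_eq_1)
  next
    case False
    then have "v i \<noteq> v j" using v by (auto simp: bij_betw_def inj_on_def)
    then show ?thesis using False B(1) vB by (auto simp: pairwise_def orthogonal_def)
  qed
  then show ?thesis using l by (rule that)
qed

section \<open>Characteristic polynomials of diagonalisable matrices and the numbering of
  eigenvalues\<close>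

lemma map_matrix_const_poly_mult:
  fixes A B :: "'a::idom^'d^'d"
  shows "map_matrix (\<lambda>a. [:a:]) (A ** B) = map_matrix (\<lambda>a. [:a:]) A ** map_matrix (\<lambda>a. [:a:]) B"
proof -
  have "(\<Sum>k\<in>S. [:f k:]) = [:\<Sum>k\<in>S. f k:]" if "finite S" for f :: "'d \<Rightarrow> 'a" and S
    using that by induction auto
  then show ?thesis by (simp add: vec_eq_iff matrix_matrix_mult_def mult.commute)
qed

lemma det_map_matrix_const_poly:
  fixes A :: "'a::idom^'d^'d"
  shows "det (map_matrix (\<lambda>a. [:a:]) A) = [:det A:]"
proof -
  have "(\<Sum>k\<in>S. [:f k:]) = [:\<Sum>k\<in>S. f k:]" if "finite S" for f :: "('d\<Rightarrow>'d) \<Rightarrow> 'a" and S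
    using that by induction auto
  moreover have "(\<Prod>k\<in>S. [:f k:]) = [:\<Prod>k\<in>S. f k:]" if "finite S" for f :: "'d \<Rightarrow> 'a" and S
    using that by induction (auto simp: one_pCons)
  ultimately show ?thesis
    by (simp add: det_def of_int_poly mult.commute)
qed

lemma matrix_diff_mult:
  fixes A B :: "'a::ring_1^'n^'m"
  shows "(A - B) ** C = A ** C - B ** C"
  by (simp add: matrix_matrix_mult_def vec_eq_iff sum_subtractf algebra_simps)

lemma matrix_mult_diff:
  fixes A :: "'a::ring_1^'n^'m"
  shows "A ** (B - C) = A ** B - A ** C"
  by (simp add: matrix_matrix_mult_def vec_eq_iff sum_subtractf algebra_simps)

text \<open>Read as a matrix of constant polynomials, \<open>Q\<close> intertwines the two
  characteristic matrices. Taking determinants and cancelling the nonzero constant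
  \<open>det Q\<close> in the domain of polynomials avoids inverting \<open>Q\<close>.\<close>

lemma charpoly_diagonalizable:
  fixes M :: "'a::{idom,field}^'d^'d"
  assumes Q: "det Q \<noteq> 0" and MQ: "M ** Q = Q ** (\<chi> i j. if i = j then l i else 0)"
  shows "charpoly M = (\<Prod>i\<in>UNIV. [:- l i, 1:])"
proof -
  let ?C = "map_matrix (\<lambda>a::'a. [:a:]) :: 'a^'d^'d \<Rightarrow> 'a poly^'d^'d"
  let ?L = "(\<chi> i j. if i = j then l i else 0) :: 'a^'d^'d"
  have comm: "mat [:0,1:] ** ?C Q = ?C Q ** mat [:0,1:]"
    by (auto simp: matrix_matrix_mult_def mat_def vec_eq_iff if_distrib if_distribR
        sum.delta sum.delta' cong: if_cong)
  have "(mat [:0,1:] - ?C M) ** ?C Q = ?C Q ** (mat [:0,1:] - ?C ?L)"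
    by (simp only: matrix_diff_mult matrix_mult_diff comm MQ flip: map_matrix_const_poly_mult)
  then have "det ((mat [:0,1:] - ?C M) ** ?C Q) = det (?C Q ** (mat [:0,1:] - ?C ?L))"
    by (rule arg_cong)
  then have "det (mat [:0,1:] - ?C M) * det (?C Q) = det (?C Q) * det (mat [:0,1:] - ?C ?L)"
    by (simp only: det_mul)
  moreover have "det (?C Q) \<noteq> 0" using Q by (simp add: det_map_matrix_const_poly)
  ultimately have "charpoly M = det (mat [:0,1:] - ?C ?L)"
    by (simp add: charpoly_def)
  also have "\<dots> = (\<Prod>i\<in>UNIV. (mat [:0,1:] - ?C ?L) $ i $ i)"
    by (intro det_diagonal) (auto simp: mat_def)
  also have "\<dots> = (\<Prod>i\<in>UNIV. [:- l i, 1:])"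
    by (simp add: mat_def)
  finally show ?thesis .
qed

text \<open>Sorting the indices instead of the values remembers which eigenvector belongs to which
  entry, also for repeated values.\<close>

lemma rev_sorted_list_of_image_mset:
  fixes g :: "'d::finite \<Rightarrow> real"
  obtains f where "bij_betw f {1..CARD('d)} UNIV"
    "\<And>k. k \<in> {1..CARD('d)} \<Longrightarrow>
       rev (sorted_list_of_multiset (image_mset g (mset_set UNIV))) ! (k - 1) = g (f k)"
    "\<And>k m. 1 \<le> k \<Longrightarrow> k \<le> m \<Longrightarrow> m \<le> CARD('d) \<Longrightarrow> g (f m) \<le> g (f k)"
proof -
  obtain xs :: "'d list" where xs: "set xs = UNIV" "distinct xs"
    using finite_distinct_list[OF finite] by blast
  define ys where "ys = sort_key g xs"
  have ys: "set ys = UNIV" "distinct ys" "mset ys = mset xs" "sorted (map g ys)"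
    using xs by (auto simp: ys_def)
  have len: "length ys = CARD('d)" using ys distinct_card by metis
  have "mset_set (UNIV :: 'd set) = mset ys" using ys by (metis mset_set_set)
  then have eq: "sorted_list_of_multiset (image_mset g (mset_set UNIV)) = map g ys"
    using ys(4) by (metis mset_map properties_for_sort sorted_list_of_multiset_mset)
  define zs where "zs = rev ys"
  have zs: "set zs = UNIV" "distinct zs" "length zs = CARD('d)" "sorted (rev (map g zs))"
    using ys len by (auto simp: zs_def rev_map)
  have b: "bij_betw (\<lambda>k. zs ! (k - 1)) {1..CARD('d)} UNIV"
  proof -
    have "bij_betw (\<lambda>k. k - 1) {1..CARD('d)} {..<length zs}"
      using zs by (intro bij_betwI[where g = Suc]) auto
    moreover have "bij_betw (\<lambda>k. zs ! k) {..<length zs} UNIV"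
      using zs by (intro bij_betw_nth) auto
    ultimately show ?thesis by (auto dest: bij_betw_trans simp: o_def)
  qed
  show ?thesis
  proof (rule that[OF b])
    fix k assume k: "k \<in> {1..CARD('d)}"
    show "rev (sorted_list_of_multiset (image_mset g (mset_set UNIV))) ! (k - 1) = g (zs ! (k - 1))"
      
    proof -
      have "k - 1 < length zs" using k zs(3) by auto
      then show ?thesis unfolding eq by (simp add: zs_def rev_map)
    qed
  next
    fix k m assume km: "1 \<le> k" "k \<le> m" "m \<le> CARD('d)"
    then have "map g zs ! (m - 1) \<le> map g zs ! (k - 1)"
      using zs by (intro sorted_rev_nth_mono) auto
    then show "g (zs ! (m - 1)) \<le> g (zs ! (k - 1))" using km zs by simp
  qed
qed

text \<open>The \<open>v i\<close> are eigenvectors of \<open>transpose A ** A\<close>, that is,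
  right singular vectors. Later facts on singular values start from here, so that the characteristic
  polynomial is not touched again.\<close>

lemma sing_value_basis:
  fixes A :: "real^'d^'d"
  obtains v where
    "\<And>i j. i \<in> {1..CARD('d)} \<Longrightarrow> j \<in> {1..CARD('d)} \<Longrightarrow> v i \<bullet> v j = (if i = j then 1 else 0)"
    "\<And>i j. i \<in> {1..CARD('d)} \<Longrightarrow> j \<in> {1..CARD('d)} \<Longrightarrow>
       (A *v v i) \<bullet> (A *v v j) = (if i = j then (sing_value A i)\<^sup>2 else 0)"
    "\<And>i. i \<in> {1..CARD('d)} \<Longrightarrow> 0 \<le> sing_value A i"
    "\<And>i j. 1 \<le> i \<Longrightarrow> i \<le> j \<Longrightarrow> j \<le> CARD('d) \<Longrightarrow> sing_value A j \<le> sing_value A i"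
proof -
  let ?M = "transpose A ** A"
  have "transpose ?M = ?M" by (simp add: matrix_transpose_mul)
  then obtain v l where v: "\<And>i j :: 'd. v i \<bullet> v j = (if i = j then 1 else 0)"
    and l: "\<And>i. ?M *v v i = l i *\<^sub>R v i"
    using symmetric_matrix_eigenbasis by blast
  have AA: "(A *v x) \<bullet> (A *v y) = (?M *v x) \<bullet> y" for x y
    by (metis dot_lmul_matrix inner_commute matrix_vector_mul_assoc vector_transpose_matrix transpose_transpose)
  have Av: "(A *v v i) \<bullet> (A *v v j) = (if i = j then l i else 0)" for i j
    by (simp add: AA l v)
  have lpos: "0 \<le> l i" for i using Av[of i i] by (metis inner_ge_zero)
  define Q where "Q = (\<chi> a i. v i $ a)"
  have QQ: "transpose Q ** Q = mat 1"
    using v by (simp add: vec_eq_iff Q_def transpose_def matrix_matrix_mult_def mat_def inner_vec_def)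
  then have "det Q \<noteq> 0" by (metis det_I det_mul mult_zero_right zero_neq_one)
  moreover have "?M ** Q = Q ** (\<chi> i j. if i = j then l i else 0)"
  proof -
    have "(?M ** Q) $ a $ i = (?M *v v i) $ a" for a i
      by (simp add: matrix_matrix_mult_def[of ?M] matrix_vector_mult_def Q_def)
    moreover have "(Q ** (\<chi> i j. if i = j then l i else 0)) $ a $ i = l i * v i $ a" for a i
      by (simp add: matrix_matrix_mult_def Q_def if_distrib sum.delta' cong: if_cong)
    ultimately show ?thesis by (simp add: vec_eq_iff l)
  qed
  ultimately have cp: "charpoly ?M = (\<Prod>i\<in>UNIV. [:- l i, 1:])"
    by (rule charpoly_diagonalizable)
  have "proots (charpoly ?M) = (\<Sum>i\<in>UNIV. {#l i#})"
    unfolding cp by (subst proots_prod) auto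
  also have "\<dots> = image_mset l (mset_set UNIV)"
  proof -
    have "(\<Sum>i\<in>S. {#l i#}) = image_mset l (mset_set S)" if "finite S" for S
      using that by induction auto
    then show ?thesis by simp
  qed
  finally have pr: "image_mset sqrt (proots (charpoly ?M)) = image_mset (\<lambda>i. sqrt (l i)) (mset_set UNIV)"
    by (simp add: image_mset.compositionality o_def)
  obtain f where f: "bij_betw f {1..CARD('d)} (UNIV :: 'd set)"
    "\<And>k. k \<in> {1..CARD('d)} \<Longrightarrow>
       rev (sorted_list_of_multiset (image_mset (\<lambda>i. sqrt (l i)) (mset_set UNIV))) ! (k - 1) = sqrt (l (f k))"
    "\<And>k m. 1 \<le> k \<Longrightarrow> k \<le> m \<Longrightarrow> m \<le> CARD('d) \<Longrightarrow> sqrt (l (f m)) \<le> sqrt (l (f k))"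
    by (rule rev_sorted_list_of_image_mset[of "\<lambda>i. sqrt (l i)"]) blast
  have sv: "sing_value A k = sqrt (l (f k))" if "k \<in> {1..CARD('d)}" for k
    unfolding sing_value_def pr by (rule f(2)[OF that])
  have inj: "f i = f j \<longleftrightarrow> i = j" if "i \<in> {1..CARD('d)}" "j \<in> {1..CARD('d)}" for i j
    using inj_on_eq_iff[OF bij_betw_imp_inj_on[OF f(1)] that] .
  show ?thesis
  proof (rule that[of "\<lambda>i. v (f i)"])
    fix i j assume ij: "i \<in> {1..CARD('d)}" "j \<in> {1..CARD('d)}"
    show "v (f i) \<bullet> v (f j) = (if i = j then 1 else 0)" using v inj[OF ij] by simp
    show "(A *v v (f i)) \<bullet> (A *v v (f j)) = (if i = j then (sing_value A i)\<^sup>2 else 0)"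
      unfolding Av inj[OF ij] sv[OF ij(1)] using lpos by simp
  qed (use sv lpos f(3) in auto)
qed

lemma orthonormal_expansion:
  fixes v :: "nat \<Rightarrow> real^'d"
  assumes v: "\<And>i j. i \<in> {1..CARD('d)} \<Longrightarrow> j \<in> {1..CARD('d)} \<Longrightarrow> v i \<bullet> v j = (if i = j then 1 else 0)"
  shows "x = (\<Sum>i\<in>{1..CARD('d)}. (x \<bullet> v i) *\<^sub>R v i)"
proof -
  let ?I = "{1..CARD('d)}"
  have inj: "inj_on v ?I"
    using v by (metis inj_onI zero_neq_one)
  have "pairwise orthogonal (v ` ?I)"
    using v by (auto simp: pairwise_def orthogonal_def)
  moreover have "0 \<notin> v ` ?I" using v by fastforce
  ultimately have ind: "independent (v ` ?I)" by (intro pairwise_orthogonal_independent)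
  then have "UNIV \<subseteq> span (v ` ?I)"
    by (intro card_ge_dim_independent) (use card_image[OF inj] in auto)
  then have "x \<in> span (v ` ?I)" by blast
  then obtain b where "x = (\<Sum>w\<in>v ` ?I. b w *\<^sub>R w)"
    by (auto simp: span_finite)
  then have "x = (\<Sum>i\<in>?I. b (v i) *\<^sub>R v i)" unfolding sum.reindex[OF inj] o_def .
  then obtain c where c: "x = (\<Sum>i\<in>?I. c i *\<^sub>R v i)" by fast
  moreover have "(\<Sum>i\<in>?I. c i *\<^sub>R v i) \<bullet> v j = c j" if "j \<in> ?I" for j
  proof -
    have "(\<Sum>i\<in>?I. c i *\<^sub>R v i) \<bullet> v j = (\<Sum>i\<in>?I. if i = j then c i else 0)"
      unfolding inner_sum_left using v that by (intro sum.cong) auto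
    then show ?thesis using that by simp
  qed
  ultimately have "x \<bullet> v j = c j" if "j \<in> ?I" for j using that by metis
  then have "(\<Sum>i\<in>?I. (x \<bullet> v i) *\<^sub>R v i) = (\<Sum>i\<in>?I. c i *\<^sub>R v i)"
    by (intro sum.cong) auto
  with c show ?thesis by metis
qed

section \<open>Volume under linear maps\<close>

text \<open>This is the uniqueness argument for Haar measure. The image \<nu> of Lebesgue measure
  under \<open>f\<close> is translation invariant, and the double integral of
  \<open>indicator A x * h (x - y)\<close> over Lebesgue measure and \<nu> is computed in both
  orders. The scaling constant stays expressed by the unit ball, without determinants.\<close>

lemma emeasure_lborel_linear_vimage:
  fixes f :: "'a::euclidean_space \<Rightarrow> 'a"
  assumes f: "linear f" "inj f" and A: "A \<in> sets borel"
  shows "emeasure lborel (f -` A) * emeasure lborel (ball 0 1 :: 'a set)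
    = emeasure lborel (f -` ball 0 1) * emeasure lborel A"
proof -
  define \<nu> where "\<nu> = distr lborel borel f"
  have cont: "continuous_on UNIV f" using f(1) by (simp add: linear_continuous_on linear_conv_bounded_linear)
  have fm[measurable]: "f \<in> borel_measurable borel" by (rule borel_measurable_continuous_onI[OF cont])
  have em: "emeasure \<nu> B = emeasure lborel (f -` B)" if "B \<in> sets borel" for B
    using that by (simp add: \<nu>_def emeasure_distr)
  have sets[measurable_cong, simp]: "sets \<nu> = sets borel" by (simp add: \<nu>_def)
  have surj: "surj f" using f by (simp add: linear_injective_imp_surjective)
  have transl: "emeasure \<nu> ((+) c -` B) = emeasure \<nu> B" if B[measurable]: "B \<in> sets borel" for c B
  proof -
    obtain z where z: "c = f z" using surj by (metis surjD)
    have eq: "(+) z -` (f -` B) = f -` ((+) c -` B)"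
      using f(1) z by (auto simp: linear_add)
    have "emeasure lborel (f -` B) = emeasure (distr lborel borel ((+) z)) (f -` B)"
      by (simp add: lborel_distr_plus)
    also have "\<dots> = emeasure lborel (f -` ((+) c -` B))"
      using measurable_sets_borel[OF fm B] by (simp add: emeasure_distr eq)
    also have "\<dots> = emeasure \<nu> ((+) c -` B)"
      by (rule em[symmetric]) (simp add: measurable_sets_borel[of "(+) c" borel, simplified])
    finally show ?thesis using em[OF B] by simp
  qed
  obtain a where a: "a > 0" "\<And>x. norm (f x) \<ge> a * norm x"
    using linear_inj_bounded_below_pos[OF f] by (metis mult.commute)
  \<comment> \<open>An injective linear map expands norms by at least a fixed factor, so preimages
    of balls are bounded; this makes \<nu> sigma-finite, as Fubini requires.\<close>
  have fin: "emeasure \<nu> (ball 0 (real k)) \<noteq> \<infinity>" for k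
  proof -
    have "norm x \<le> real k / a" if "norm (f x) < real k" for x
    proof -
      have "a * norm x \<le> real k" using a(2)[of x] that by linarith
      then show ?thesis using a(1) by (simp add: field_simps)
    qed
    then have "f -` ball 0 (real k) \<subseteq> cball 0 (real k / a)" by auto
    then have "emeasure lborel (f -` ball 0 (real k)) \<le> emeasure lborel (cball (0::'a) (real k / a))"
      by (intro emeasure_mono) auto
    also have "\<dots> < \<infinity>" by (intro emeasure_bounded_finite) auto
    finally show ?thesis by (subst em) auto
  qed
  interpret N: sigma_finite_measure \<nu>
  proof
    show "\<exists>A. countable A \<and> A \<subseteq> sets \<nu> \<and> \<Union>A = space \<nu> \<and> (\<forall>a\<in>A. emeasure \<nu> a \<noteq> \<infinity>)"
    proof (intro exI[of _ "range (\<lambda>k::nat. ball 0 (real k))"] conjI)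
      show "\<Union>(range (\<lambda>k::nat. ball 0 (real k))) = space \<nu>"
        by (auto simp: \<nu>_def) (metis reals_Archimedean2)
    qed (use fin in auto)
  qed
  interpret pair_sigma_finite lborel \<nu> ..
  let ?B = "ball 0 1 :: 'a set"
  note A[measurable]
  define h :: "'a \<Rightarrow> ennreal" where "h = indicator ?B"
  have [measurable]: "h \<in> borel_measurable borel"
    unfolding h_def by (rule borel_measurable_indicator) simp
  have "emeasure lborel A * emeasure \<nu> ?B = (\<integral>\<^sup>+x. indicator A x * emeasure \<nu> ?B \<partial>lborel)"
    by (simp add: nn_integral_multc)
  also have "\<dots> = (\<integral>\<^sup>+x. (\<integral>\<^sup>+y. indicator A x * h (x - y) \<partial>\<nu>) \<partial>lborel)"
  proof (rule nn_integral_cong)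
    fix x :: 'a
    have "(\<integral>\<^sup>+y. h (x - y) \<partial>\<nu>) = (\<integral>\<^sup>+y. indicator ((+) (- x) -` ?B) y \<partial>\<nu>)"
      by (intro nn_integral_cong) (auto simp: h_def indicator_def norm_minus_commute)
    also have "\<dots> = emeasure \<nu> ((+) (- x) -` ?B)"
      by (intro nn_integral_indicator) (simp add: measurable_sets_borel[of "(+) (-x)" borel, simplified])
    also have "\<dots> = emeasure \<nu> ?B" by (intro transl) simp
    finally have "(\<integral>\<^sup>+y. h (x - y) \<partial>\<nu>) = emeasure \<nu> ?B" .
    moreover have "(\<integral>\<^sup>+y. indicator A x * h (x - y) \<partial>\<nu>)
      = indicator A x * (\<integral>\<^sup>+y. h (x - y) \<partial>\<nu>)"
      by (rule nn_integral_cmult) measurable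
    ultimately show "indicator A x * emeasure \<nu> ?B = (\<integral>\<^sup>+y. indicator A x * h (x - y) \<partial>\<nu>)"
      by (simp only:)
  qed
  also have "\<dots> = (\<integral>\<^sup>+y. (\<integral>\<^sup>+x. indicator A x * h (x - y) \<partial>lborel) \<partial>\<nu>)"
    by (rule Fubini'[symmetric]) simp
  also have "\<dots> = (\<integral>\<^sup>+y. (\<integral>\<^sup>+x. indicator A (y + x) * h x \<partial>lborel) \<partial>\<nu>)"
  proof (rule nn_integral_cong)
    fix y :: 'a
    have "(\<integral>\<^sup>+x. indicator A x * h (x - y) \<partial>lborel)
      = (\<integral>\<^sup>+x. indicator A x * h (x - y) \<partial>distr lborel borel ((+) y))"
      by (simp add: lborel_distr_plus)
    also have "\<dots> = (\<integral>\<^sup>+x. indicator A (y + x) * h x \<partial>lborel)"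
      by (subst nn_integral_distr) auto
    finally show "(\<integral>\<^sup>+x. indicator A x * h (x - y) \<partial>lborel) = \<dots>" .
  qed
  also have "\<dots> = (\<integral>\<^sup>+x. (\<integral>\<^sup>+y. indicator A (y + x) * h x \<partial>\<nu>) \<partial>lborel)"
    by (rule Fubini') simp
  also have "\<dots> = (\<integral>\<^sup>+x. emeasure \<nu> A * h x \<partial>lborel)"
  proof (rule nn_integral_cong)
    fix x :: 'a
    have "(\<integral>\<^sup>+y. indicator A (y + x) \<partial>\<nu>) = (\<integral>\<^sup>+y. indicator ((+) x -` A) y \<partial>\<nu>)"
      by (intro nn_integral_cong) (auto simp: indicator_def add.commute)
    also have "\<dots> = emeasure \<nu> ((+) x -` A)"
      by (intro nn_integral_indicator) (use A in \<open>simp add: measurable_sets_borel[of "(+) x" borel, simplified]\<close>)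
    also have "\<dots> = emeasure \<nu> A" by (intro transl A)
    finally have "(\<integral>\<^sup>+y. indicator A (y + x) \<partial>\<nu>) = emeasure \<nu> A" .
    moreover have "(\<integral>\<^sup>+y. indicator A (y + x) * h x \<partial>\<nu>)
      = (\<integral>\<^sup>+y. indicator A (y + x) \<partial>\<nu>) * h x"
      by (rule nn_integral_multc) measurable
    ultimately show "(\<integral>\<^sup>+y. indicator A (y + x) * h x \<partial>\<nu>) = emeasure \<nu> A * h x"
      by (simp only:)
  qed
  also have "\<dots> = emeasure \<nu> A * emeasure lborel ?B"
    unfolding h_def by (rule nn_integral_cmult_indicator) simp
  finally show ?thesis using em[OF A] em[of ?B] by (simp add: mult.commute)
qed

lemma emeasure_lborel_unit_ball:
  "emeasure lborel (ball 0 1 :: 'a::euclidean_space set) \<noteq> 0"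
  "emeasure lborel (ball 0 1 :: 'a::euclidean_space set) \<noteq> \<infinity>"
  using unit_ball_vol_pos[of "real DIM('a)", OF of_nat_0_le_iff] by (auto simp: emeasure_ball simp del: unit_ball_vol_pos)

lemma emeasure_lborel_ball_scale:
  fixes r :: real
  assumes "r > 0"
  shows "emeasure lborel (ball 0 r :: 'a::euclidean_space set)
    = ennreal (r ^ DIM('a)) * emeasure lborel (ball 0 1 :: 'a set)"
  using assms by (simp add: emeasure_ball ennreal_mult[symmetric] unit_ball_vol_nonneg)

lemma emeasure_lborel_linear_vimage_le:
  fixes f :: "'a::euclidean_space \<Rightarrow> 'a"
  assumes f: "linear f" and a: "a > 0" "\<And>x. norm (f x) \<ge> a * norm x" and A: "A \<in> sets borel"
  shows "emeasure lborel (f -` A) \<le> ennreal ((1 / a) ^ DIM('a)) * emeasure lborel A"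
proof -
  have inj: "inj f"
  proof (rule linear_injective_0[OF f, THEN iffD2], intro allI impI)
    fix x assume "f x = 0"
    with a(2)[of x] have "a * norm x \<le> 0" by simp
    then show "x = 0" using a(1) by (simp add: mult_le_0_iff)
  qed
  let ?b = "emeasure lborel (ball 0 1 :: 'a set)"
  have "norm x < 1 / a" if "norm (f x) < 1" for x
  proof -
    have "a * norm x < 1" using a(2)[of x] that by linarith
    then show ?thesis using a(1) by (simp add: field_simps)
  qed
  then have "f -` ball 0 1 \<subseteq> ball 0 (1 / a)" by auto
  then have "emeasure lborel (f -` ball 0 1) \<le> emeasure lborel (ball 0 (1 / a) :: 'a set)"
    by (intro emeasure_mono) auto
  also have "\<dots> = ennreal ((1 / a) ^ DIM('a)) * ?b"
    using a(1) by (intro emeasure_lborel_ball_scale) auto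
  finally have "emeasure lborel (f -` A) * ?b \<le> (ennreal ((1 / a) ^ DIM('a)) * ?b) * emeasure lborel A"
    unfolding emeasure_lborel_linear_vimage[OF f inj A] by (intro mult_right_mono) auto
  then have "?b * emeasure lborel (f -` A) \<le> ?b * (ennreal ((1 / a) ^ DIM('a)) * emeasure lborel A)"
    by (simp add: ac_simps)
  then show ?thesis
    using emeasure_lborel_unit_ball[where 'a='a] by (subst (asm) ennreal_mult_le_mult_iff) auto
qed

text \<open>An isometry fixes the unit ball, so the scaling constant is 1.\<close>

lemma emeasure_lborel_orthogonal_vimage:
  fixes f :: "'a::euclidean_space \<Rightarrow> 'a"
  assumes f: "linear f" "\<And>x. norm (f x) = norm x" and A: "A \<in> sets borel"
  shows "emeasure lborel (f -` A) = emeasure lborel A"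
proof -
  have inj: "inj f"
    by (rule linear_injective_0[OF f(1), THEN iffD2]) (metis f(2) norm_eq_zero)
  have "f -` ball 0 1 = (ball 0 1 :: 'a set)" using f(2) by auto
  with emeasure_lborel_linear_vimage[OF f(1) inj A]
  have "emeasure lborel (ball 0 1 :: 'a set) * emeasure lborel (f -` A)
    = emeasure lborel (ball 0 1 :: 'a set) * emeasure lborel A"
    by (simp add: mult.commute)
  then show ?thesis using emeasure_lborel_unit_ball[where 'a='a]
    by (simp add: ennreal_mult_cancel_left)
qed

section \<open>Orthonormal coordinates and norm characterisations of singular values\<close>

definition orthonormal_family :: "(nat \<Rightarrow> real^'d) \<Rightarrow> bool" where
  "orthonormal_family w \<longleftrightarrow>
     (\<forall>i\<in>{1..CARD('d)}. \<forall>j\<in>{1..CARD('d)}. w i \<bullet> w j = (if i = j then 1 else 0))"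

lemma norm_orthonormal_family:
  fixes w :: "nat \<Rightarrow> real^'d"
  assumes "orthonormal_family w"
  shows "(norm x)\<^sup>2 = (\<Sum>i\<in>{1..CARD('d)}. (x \<bullet> w i)\<^sup>2)"
proof -
  have "x = (\<Sum>i\<in>{1..CARD('d)}. (x \<bullet> w i) *\<^sub>R w i)"
    using assms by (intro orthonormal_expansion) (auto simp: orthonormal_family_def)
  then have "x \<bullet> x = x \<bullet> (\<Sum>i\<in>{1..CARD('d)}. (x \<bullet> w i) *\<^sub>R w i)" by simp
  then show ?thesis unfolding power2_norm_eq_inner by (simp add: inner_sum_right power2_eq_square)
qed

text \<open>Taking coordinates with respect to \<open>w\<close> is a linear isometry under which
  \<open>S\<close> is the preimage of an axis-parallel box.\<close>

lemma emeasure_lborel_orthonormal_box: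
  fixes w :: "nat \<Rightarrow> real^'d"
  assumes w: "orthonormal_family w" and ab: "\<And>i. i \<in> {1..CARD('d)} \<Longrightarrow> a i \<le> b i"
  defines "S \<equiv> {x. \<forall>i\<in>{1..CARD('d)}. a i \<le> x \<bullet> w i \<and> x \<bullet> w i \<le> b i}"
  shows "S \<in> sets borel" "emeasure lborel S = ennreal (\<Prod>i\<in>{1..CARD('d)}. b i - a i)"
proof -
  obtain g :: "'d \<Rightarrow> nat" where g: "bij_betw g UNIV {1..CARD('d)}"
    using finite_same_card_bij[of "UNIV :: 'd set" "{1..CARD('d)}"] by auto
  define f where "f x = (\<chi> k. x \<bullet> w (g k))" for x :: "real^'d"
  have lin: "linear f"
    by (rule linearI) (auto simp: f_def vec_eq_iff inner_add_left)
  have nrm: "norm (f x) = norm x" for x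
  proof -
    have "(norm (f x))\<^sup>2 = (\<Sum>k\<in>UNIV. (x \<bullet> w (g k))\<^sup>2)"
      unfolding power2_norm_eq_inner inner_vec_def[of "f x"] by (simp add: f_def power2_eq_square)
    also have "\<dots> = (\<Sum>i\<in>{1..CARD('d)}. (x \<bullet> w i)\<^sup>2)"
      by (rule sum.reindex_bij_betw[OF g])
    finally show ?thesis using norm_orthonormal_family[OF w, of x] by (metis norm_ge_zero power2_eq_imp_eq)
  qed
  let ?a = "(\<chi> k. a (g k)) :: real^'d" and ?b = "(\<chi> k. b (g k)) :: real^'d"
  have gk: "g k \<in> {1..CARD('d)}" for k using g by (auto simp: bij_betw_def)
  have S: "S = f -` cbox ?a ?b"
  proof -
    have "(\<forall>i\<in>g ` UNIV. a i \<le> x \<bullet> w i \<and> x \<bullet> w i \<le> b i) \<longleftrightarrow> f x \<in> cbox ?a ?b" for x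
      by (auto simp: mem_box_cart f_def)
    moreover have "g ` UNIV = {1..CARD('d)}" using g by (simp add: bij_betw_def)
    ultimately show ?thesis unfolding S_def by auto
  qed
  have "emeasure lborel S = emeasure lborel (cbox ?a ?b)"
    unfolding S by (rule emeasure_lborel_orthogonal_vimage[OF lin nrm]) auto
  also have "\<dots> = ennreal (measure lborel (cbox ?a ?b))"
    by (rule emeasure_eq_measure2[OF fmeasurable_cbox])
  also have "measure lborel (cbox ?a ?b) = (\<Prod>k\<in>UNIV. b (g k) - a (g k))"
  proof (subst content_cbox_cart)
    have "?a \<in> cbox ?a ?b" using ab gk by (simp add: mem_box_cart)
    then show "cbox ?a ?b \<noteq> {}" by blast
  qed simp
  also have "\<dots> = (\<Prod>i\<in>{1..CARD('d)}. b i - a i)"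
    by (rule prod.reindex_bij_betw[OF g])
  finally show "emeasure lborel S = ennreal (\<Prod>i\<in>{1..CARD('d)}. b i - a i)" .
  have "closed S" unfolding S
    using lin by (intro closed_vimage closed_cbox) (simp add: linear_continuous_on linear_conv_bounded_linear)
  then show "S \<in> sets borel" by auto
qed

lemma sing_value_basis_orthonormal:
  fixes A :: "real^'d^'d"
  obtains v where "orthonormal_family v"
    "\<And>i j. i \<in> {1..CARD('d)} \<Longrightarrow> j \<in> {1..CARD('d)} \<Longrightarrow>
       (A *v v i) \<bullet> (A *v v j) = (if i = j then (sing_value A i)\<^sup>2 else 0)"
  using sing_value_basis[of A] unfolding orthonormal_family_def by metis

lemma sing_value_nonneg:
  fixes A :: "real^'d^'d"
  assumes "i \<in> {1..CARD('d)}"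
  shows "0 \<le> sing_value A i"
  using sing_value_basis[of A] assms by metis

lemma sing_value_antimono:
  fixes A :: "real^'d^'d"
  assumes "1 \<le> i" "i \<le> j" "j \<le> CARD('d)"
  shows "sing_value A j \<le> sing_value A i"
  using sing_value_basis[of A] assms by metis

lemma norm_mult_vec_sing_value:
  fixes A :: "real^'d^'d"
  assumes v: "orthonormal_family v"
    and Av: "\<And>i j. i \<in> {1..CARD('d)} \<Longrightarrow> j \<in> {1..CARD('d)} \<Longrightarrow>
       (A *v v i) \<bullet> (A *v v j) = (if i = j then (sing_value A i)\<^sup>2 else 0)"
  shows "(norm (A *v x))\<^sup>2 = (\<Sum>i\<in>{1..CARD('d)}. (sing_value A i * (x \<bullet> v i))\<^sup>2)"
    and "i \<in> {1..CARD('d)} \<Longrightarrow> (A *v x) \<bullet> (A *v v i) = (sing_value A i)\<^sup>2 * (x \<bullet> v i)"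
proof -
  let ?I = "{1..CARD('d)}"
  have "x = (\<Sum>i\<in>?I. (x \<bullet> v i) *\<^sub>R v i)"
    using v by (intro orthonormal_expansion) (auto simp: orthonormal_family_def)
  then have "A *v x = A *v (\<Sum>i\<in>?I. (x \<bullet> v i) *\<^sub>R v i)" by (rule arg_cong)
  also have "\<dots> = (\<Sum>i\<in>?I. (x \<bullet> v i) *\<^sub>R (A *v v i))"
    by (simp add: linear_sum[OF matrix_vector_mul_linear] linear_cmul[OF matrix_vector_mul_linear] o_def)
  finally have Ax: "A *v x = (\<Sum>i\<in>?I. (x \<bullet> v i) *\<^sub>R (A *v v i))" .
  show in2: "(A *v x) \<bullet> (A *v v i) = (sing_value A i)\<^sup>2 * (x \<bullet> v i)" if i: "i \<in> ?I" for i
  proof -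
    have "(A *v x) \<bullet> (A *v v i) = (\<Sum>j\<in>?I. (x \<bullet> v j) * ((A *v v j) \<bullet> (A *v v i)))"
      unfolding Ax by (simp add: inner_sum_left)
    also have "\<dots> = (\<Sum>j\<in>?I. if j = i then (x \<bullet> v i) * (sing_value A i)\<^sup>2 else 0)"
      using i by (intro sum.cong) (auto simp: Av)
    also have "\<dots> = (x \<bullet> v i) * (sing_value A i)\<^sup>2" using i by simp
    finally show ?thesis by simp
  qed
  have "(norm (A *v x))\<^sup>2 = (A *v x) \<bullet> (\<Sum>i\<in>?I. (x \<bullet> v i) *\<^sub>R (A *v v i))"
    unfolding power2_norm_eq_inner using Ax by simp
  also have "\<dots> = (\<Sum>i\<in>?I. (x \<bullet> v i) * ((sing_value A i)\<^sup>2 * (x \<bullet> v i)))"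
    unfolding inner_sum_right inner_scaleR_right by (intro sum.cong refl) (simp add: in2)
  finally show "(norm (A *v x))\<^sup>2 = (\<Sum>i\<in>?I. (sing_value A i * (x \<bullet> v i))\<^sup>2)"
    by (simp add: power2_eq_square ac_simps)
qed

lemma norm_mult_vec_le_sing_value:
  fixes A :: "real^'d^'d"
  shows "norm (A *v x) \<le> sing_value A 1 * norm x"
proof -
  obtain v where v: "orthonormal_family v"
    "\<And>i j. i \<in> {1..CARD('d)} \<Longrightarrow> j \<in> {1..CARD('d)} \<Longrightarrow>
       (A *v v i) \<bullet> (A *v v j) = (if i = j then (sing_value A i)\<^sup>2 else 0)"
    by (rule sing_value_basis_orthonormal) blast
  have "(norm (A *v x))\<^sup>2 = (\<Sum>i\<in>{1..CARD('d)}. (sing_value A i * (x \<bullet> v i))\<^sup>2)"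
    by (rule norm_mult_vec_sing_value(1)[OF v])
  also have "\<dots> \<le> (\<Sum>i\<in>{1..CARD('d)}. (sing_value A 1 * (x \<bullet> v i))\<^sup>2)"
    unfolding power_mult_distrib
    by (intro sum_mono mult_right_mono power_mono sing_value_antimono sing_value_nonneg) auto
  also have "\<dots> = (sing_value A 1 * norm x)\<^sup>2"
    by (simp add: power_mult_distrib norm_orthonormal_family[OF v(1), of x] sum_distrib_left)
  finally show ?thesis
    by (rule power2_le_imp_le) (simp add: sing_value_nonneg)
qed

lemma sing_value_le_norm_mult_vec:
  fixes A :: "real^'d^'d"
  shows "sing_value A CARD('d) * norm x \<le> norm (A *v x)"
proof -
  obtain v where v: "orthonormal_family v"
    "\<And>i j. i \<in> {1..CARD('d)} \<Longrightarrow> j \<in> {1..CARD('d)} \<Longrightarrow>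
       (A *v v i) \<bullet> (A *v v j) = (if i = j then (sing_value A i)\<^sup>2 else 0)"
    by (rule sing_value_basis_orthonormal) blast
  have "(sing_value A CARD('d) * norm x)\<^sup>2 = (\<Sum>i\<in>{1..CARD('d)}. (sing_value A CARD('d) * (x \<bullet> v i))\<^sup>2)"
    by (simp add: power_mult_distrib norm_orthonormal_family[OF v(1), of x] sum_distrib_left)
  also have "\<dots> \<le> (\<Sum>i\<in>{1..CARD('d)}. (sing_value A i * (x \<bullet> v i))\<^sup>2)"
    unfolding power_mult_distrib
    by (intro sum_mono mult_right_mono power_mono sing_value_antimono sing_value_nonneg) auto
  also have "\<dots> = (norm (A *v x))\<^sup>2"
    by (rule norm_mult_vec_sing_value(1)[OF v, symmetric])
  finally show ?thesis
    by (rule power2_le_imp_le) simp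
qed

lemma sing_value_attained:
  fixes A :: "real^'d^'d"
  assumes i: "i \<in> {1..CARD('d)}"
  obtains x where "norm x = 1" "norm (A *v x) = sing_value A i"
proof -
  obtain v where v: "orthonormal_family v"
    "\<And>i j. i \<in> {1..CARD('d)} \<Longrightarrow> j \<in> {1..CARD('d)} \<Longrightarrow>
       (A *v v i) \<bullet> (A *v v j) = (if i = j then (sing_value A i)\<^sup>2 else 0)"
    by (rule sing_value_basis_orthonormal) blast
  show ?thesis
  proof (rule that)
    show "norm (v i) = 1" using v(1) i by (simp add: orthonormal_family_def norm_eq_1)
    have "(norm (A *v v i))\<^sup>2 = (sing_value A i)\<^sup>2"
      unfolding power2_norm_eq_inner using v(2)[OF i i] by simp
    then show "norm (A *v v i) = sing_value A i"
      using sing_value_nonneg[OF i] by simp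
  qed
qed

text \<open>Singular values of matrix products are estimated through this lemma and
  \<open>sing_value_ge\<close> from norm inequalities, which multiply along products.\<close>

lemma sing_value_le:
  fixes A :: "real^'d^'d"
  assumes "i \<in> {1..CARD('d)}" "\<And>x. norm (A *v x) \<le> c * norm x"
  shows "sing_value A i \<le> c"
  using sing_value_attained[OF assms(1), of A] assms(2) by (metis mult.right_neutral)

lemma sing_value_ge:
  fixes A :: "real^'d^'d"
  assumes "i \<in> {1..CARD('d)}" "\<And>x. c * norm x \<le> norm (A *v x)"
  shows "c \<le> sing_value A i"
  using sing_value_attained[OF assms(1), of A] assms(2) by (metis mult.right_neutral)

lemma sing_value_pos:
  fixes A :: "real^'d^'d"
  assumes "0 < sing_value A CARD('d)" "i \<in> {1..CARD('d)}"
  shows "0 < sing_value A i"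
  using sing_value_antimono[of i "CARD('d)" A] assms by auto

text \<open>The exponent carried by the i-th singular value in \<psi>. For \<open>s \<le> d\<close>
  it is the length of the part of the interval from \<open>i - 1\<close> to \<open>i\<close> that
  lies below \<open>s\<close>, so the exponents add up to \<open>s\<close>. This replaces the case
  distinction on the critical index by one product.\<close>

definition sing_exponent :: "nat \<Rightarrow> real \<Rightarrow> nat \<Rightarrow> real" where
  "sing_exponent d s i = (if s \<le> real d then max 0 (min 1 (s - real i + 1)) else s / real d)"

lemma sing_exponent_nonneg: "0 \<le> s \<Longrightarrow> 0 \<le> sing_exponent d s i"
  by (auto simp: sing_exponent_def)

lemma sing_exponent_le_1: "s \<le> real d \<Longrightarrow> sing_exponent d s i \<le> 1"
  by (auto simp: sing_exponent_def)

lemma sing_exponent_mono: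
  assumes "s \<le> t" "0 < d"
  shows "sing_exponent d s i \<le> sing_exponent d t i"
proof (cases "t \<le> real d")
  case True
  then show ?thesis using assms by (auto simp: sing_exponent_def)
next
  case False
  have "1 \<le> t / real d" using assms False by (simp add: field_simps)
  show ?thesis
  proof (cases "s \<le> real d")
    case True
    with sing_exponent_le_1[of s d i] \<open>1 \<le> t / real d\<close> False show ?thesis
      by (simp add: sing_exponent_def[of d t])
  next
    case False
    with assms show ?thesis by (auto simp: sing_exponent_def divide_right_mono)
  qed
qed

lemma sum_sing_exponent:
  assumes "0 \<le> s" "s \<le> real d"
  shows "(\<Sum>i\<in>{1..d}. sing_exponent d s i) = s"
proof -
  have "(\<Sum>i\<in>{1..k}. max 0 (min 1 (s - real i + 1))) = min s (real k)" for k
  proof (induction k)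
    case 0 then show ?case using assms by simp
  next
    case (Suc k)
    then show ?case by (auto simp: min_def max_def)
  qed
  then show ?thesis using assms by (simp add: sing_exponent_def)
qed

lemma sing_value_fun_eq_prod:
  fixes A :: "real^'d^'d"
  assumes nz: "0 < sing_value A CARD('d)" and s: "s > 0"
  shows "sing_value_fun s A = (\<Prod>i\<in>{1..CARD('d)}. sing_value A i powr sing_exponent CARD('d) s i)"
proof (cases "s \<le> real CARD('d)")
  note pos = sing_value_pos[OF nz]
  case False
  have "(\<Prod>i\<in>{1..CARD('d)}. sing_value A i) powr (s / real CARD('d))
    = (\<Prod>i\<in>{1..CARD('d)}. sing_value A i powr (s / real CARD('d)))"
    using pos by (simp add: prod_powr_distrib less_imp_le)
  then show ?thesis using False s by (simp add: sing_value_fun_def sing_exponent_def)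
next
  note pos = sing_value_pos[OF nz]
  case True
  define m where "m = nat \<lceil>s\<rceil>"
  have m: "1 \<le> m" "real m < s + 1" "s \<le> real m" "m \<le> CARD('d)"
    using s True unfolding m_def by linarith+
  let ?f = "\<lambda>i. sing_value A i powr sing_exponent CARD('d) s i"
  have split: "{1..CARD('d)} = {1..m-1} \<union> ({m} \<union> {m+1..CARD('d)})" using m by auto
  have "(\<Prod>i\<in>{1..CARD('d)}. ?f i) = (\<Prod>i\<in>{1..m-1}. ?f i) * (?f m * (\<Prod>i\<in>{m+1..CARD('d)}. ?f i))"
  proof -
    have "prod ?f ({1..m-1} \<union> ({m} \<union> {m+1..CARD('d)})) = prod ?f {1..m-1} * prod ?f ({m} \<union> {m+1..CARD('d)})"
      by (rule prod.union_disjoint) auto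
    moreover have "prod ?f ({m} \<union> {m+1..CARD('d)}) = ?f m * prod ?f {m+1..CARD('d)}"
      by (subst prod.union_disjoint) auto
    ultimately show ?thesis unfolding split by simp
  qed
  also have "(\<Prod>i\<in>{m+1..CARD('d)}. ?f i) = 1"
  proof (rule prod.neutral, rule ballI)
    fix i assume i: "i \<in> {m+1..CARD('d)}"
    then have "sing_exponent CARD('d) s i = 0" using m True by (auto simp: sing_exponent_def)
    then show "?f i = 1" using pos[of i] i by auto
  qed
  also have "?f m = sing_value A m powr (s - real m + 1)"
    using m True by (auto simp: sing_exponent_def)
  also have "(\<Prod>i\<in>{1..m-1}. ?f i) = (\<Prod>i\<in>{1..m-1}. sing_value A i)"
  proof (rule prod.cong[OF refl])
    fix i assume i: "i \<in> {1..m-1}"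
    then have "real i + 1 \<le> real m" using m by auto
    then have "sing_exponent CARD('d) s i = 1" using m True by (auto simp: sing_exponent_def)
    moreover have "0 < sing_value A i" using i m by (intro pos) auto
    ultimately show "?f i = sing_value A i" by simp
  qed
  finally show ?thesis using s True by (simp add: sing_value_fun_def Let_def m_def)
qed

lemma sing_value_fun_pos:
  fixes A :: "real^'d^'d"
  assumes nz: "0 < sing_value A CARD('d)" and s: "s > 0"
  shows "0 < sing_value_fun s A"
  unfolding sing_value_fun_eq_prod[OF assms] using sing_value_pos[OF nz]
  by (intro prod_pos) (metis less_irrefl powr_gt_zero)

text \<open>Every exponent grows with \<open>s\<close>, also across \<open>s = d\<close>, while the
  bases are at most 1. It makes the set behind \<open>d_minus\<close> downward closed.\<close>

lemma sing_value_fun_antimono: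
  fixes A :: "real^'d^'d"
  assumes nz: "0 < sing_value A CARD('d)"
    and le: "sing_value A 1 \<le> 1" and st: "0 < s" "s \<le> t"
  shows "sing_value_fun t A \<le> sing_value_fun s A"
proof -
  note pos = sing_value_pos[OF nz]
  have le1: "sing_value A i \<le> 1" if "i \<in> {1..CARD('d)}" for i
    using sing_value_antimono[of 1 i A] le that by auto
  show ?thesis
    unfolding sing_value_fun_eq_prod[OF nz st(1)] sing_value_fun_eq_prod[OF nz less_le_trans[OF st]]
    by (intro prod_mono conjI powr_mono') (use st pos le1 in \<open>auto simp: less_imp_le intro: sing_exponent_mono\<close>)
qed

lemma sing_value_fun_le_powr:
  fixes A :: "real^'d^'d"
  assumes nz: "0 < sing_value A CARD('d)"
    and le: "sing_value A 1 \<le> a" and s: "0 < s" "s \<le> real CARD('d)"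
  shows "sing_value_fun s A \<le> a powr s"
proof -
  note pos = sing_value_pos[OF nz]
  have le1: "sing_value A i \<le> a" if "i \<in> {1..CARD('d)}" for i
    using sing_value_antimono[of 1 i A] le that by auto
  have a: "a > 0" using pos[of 1] le by (simp add: Suc_le_eq)
  have "sing_value_fun s A \<le> (\<Prod>i\<in>{1..CARD('d)}. a powr sing_exponent CARD('d) s i)"
    unfolding sing_value_fun_eq_prod[OF nz s(1)]
    by (intro prod_mono conjI powr_mono2) (use s pos le1 in \<open>auto simp: less_imp_le sing_exponent_nonneg\<close>)
  also have "\<dots> = a powr (\<Sum>i\<in>{1..CARD('d)}. sing_exponent CARD('d) s i)"
    using a by (subst powr_sum) auto
  also have "\<dots> = a powr s" using s by (simp add: sum_sing_exponent[unfolded One_nat_def])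
  finally show ?thesis .
qed

lemma min_le_powr:
  fixes x e :: real
  assumes "x > 0" "0 \<le> e" "e \<le> 1"
  shows "min 1 x \<le> x powr e"
proof (cases "x \<le> 1")
  case True
  then have "x powr 1 \<le> x powr e" using assms by (intro powr_mono') auto
  then show ?thesis using assms by auto
next
  case False
  then show ?thesis using assms ge_one_powr_ge_zero[of x e] by auto
qed

lemma prod_divide_sing_exponent:
  fixes A :: "real^'d^'d"
  assumes nz: "0 < sing_value A CARD('d)"
    and s: "0 < s" "s \<le> real CARD('d)" and r: "r > 0"
  shows "(\<Prod>i\<in>{1..CARD('d)}. (r / sing_value A i) powr sing_exponent CARD('d) s i)
    = r powr s / sing_value_fun s A"
proof -
  note pos = sing_value_pos[OF nz]
  have "(\<Prod>i\<in>{1..CARD('d)}. (r / sing_value A i) powr sing_exponent CARD('d) s i)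
    = (\<Prod>i\<in>{1..CARD('d)}. r powr sing_exponent CARD('d) s i / sing_value A i powr sing_exponent CARD('d) s i)"
    using pos r by (intro prod.cong) (auto simp: powr_divide less_imp_le)
  also have "\<dots> = (\<Prod>i\<in>{1..CARD('d)}. r powr sing_exponent CARD('d) s i) / sing_value_fun s A"
    unfolding sing_value_fun_eq_prod[OF nz s(1)] by (simp add: prod_dividef)
  also have "(\<Prod>i\<in>{1..CARD('d)}. r powr sing_exponent CARD('d) s i) = r powr s"
    using r s by (subst powr_sum[symmetric]) (auto simp: sum_sing_exponent[unfolded One_nat_def])
  finally show ?thesis .
qed

text \<open>In the singular basis the preimage of a ball lies in a box with sides \<open>min (2 R) (2 r / \<alpha>\<^sub>i)\<close>,
  and \<open>min 1 y \<le> y powr e\<close> for exponents \<open>e\<close> in the unit interval.\<close>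

lemma emeasure_lborel_ball_vimage_le:
  fixes A :: "real^'d^'d"
  assumes nz: "0 < sing_value A CARD('d)"
    and s: "0 < s" "s \<le> real CARD('d)" and r: "r > 0" and R: "R \<ge> 1"
  shows "\<exists>B. B \<in> sets borel \<and> {y. norm y \<le> R \<and> norm (A *v y - b) \<le> r} \<subseteq> B \<and>
    emeasure lborel B \<le> ennreal ((2 * R) ^ CARD('d) * (r powr s / sing_value_fun s A))"
proof -
  note pos = sing_value_pos[OF nz]
  let ?I = "{1..CARD('d)}"
  obtain v where v: "orthonormal_family v"
    "\<And>i j. i \<in> ?I \<Longrightarrow> j \<in> ?I \<Longrightarrow>
       (A *v v i) \<bullet> (A *v v j) = (if i = j then (sing_value A i)\<^sup>2 else 0)"
    by (rule sing_value_basis_orthonormal) blast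
  \<comment> \<open>The coordinate along \<open>v i\<close> of the preimage of \<open>b\<close>
    under \<open>A\<close>. In each direction the box keeps the sharper of two constraints: distance
    \<open>r / sing_value A i\<close> from \<open>c i\<close>, or the a priori bound
    \<open>R\<close>.\<close>
  define c where "c i = (b \<bullet> (A *v v i)) / (sing_value A i)\<^sup>2" for i
  define lo where "lo i = (if r / sing_value A i < R then c i - r / sing_value A i else - R)" for i
  define hi where "hi i = (if r / sing_value A i < R then c i + r / sing_value A i else R)" for i
  define B where "B = {x. \<forall>i\<in>?I. lo i \<le> x \<bullet> v i \<and> x \<bullet> v i \<le> hi i}"
  have lohi: "lo i \<le> hi i" if "i \<in> ?I" for i
    using pos[OF that] r R by (auto simp: lo_def hi_def)
  have B: "B \<in> sets borel" "emeasure lborel B = ennreal (\<Prod>i\<in>?I. hi i - lo i)"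
    unfolding B_def using emeasure_lborel_orthonormal_box[OF v(1), of lo hi] lohi by blast+
  have sub: "{y. norm y \<le> R \<and> norm (A *v y - b) \<le> r} \<subseteq> B"
  proof
    fix y assume "y \<in> {y. norm y \<le> R \<and> norm (A *v y - b) \<le> r}"
    then have y: "norm y \<le> R" "norm (A *v y - b) \<le> r" by auto
    have "lo i \<le> y \<bullet> v i \<and> y \<bullet> v i \<le> hi i" if i: "i \<in> ?I" for i
    proof (cases "r / sing_value A i < R")
      case False
      have "\<bar>y \<bullet> v i\<bar> \<le> norm y * norm (v i)" by (rule Cauchy_Schwarz_ineq2)
      also have "norm (v i) = 1" using v(1) i by (simp add: orthonormal_family_def norm_eq_1)
      finally show ?thesis using y False by (auto simp: lo_def hi_def)
    next
      case True
      have nAv: "norm (A *v v i) = sing_value A i"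
      proof -
        have "(norm (A *v v i))\<^sup>2 = (sing_value A i)\<^sup>2"
          unfolding power2_norm_eq_inner using v(2)[OF i i] by simp
        then show ?thesis using sing_value_nonneg[OF i] by simp
      qed
      have "\<bar>(A *v y - b) \<bullet> (A *v v i)\<bar> \<le> norm (A *v y - b) * norm (A *v v i)"
        by (rule Cauchy_Schwarz_ineq2)
      also have "\<dots> \<le> r * sing_value A i"
        unfolding nAv using y pos[OF i] by (intro mult_right_mono) auto
      also have "(A *v y - b) \<bullet> (A *v v i) = (sing_value A i)\<^sup>2 * (y \<bullet> v i - c i)"
        using pos[OF i] norm_mult_vec_sing_value(2)[OF v i, of y]
        by (simp add: inner_diff_left c_def field_simps)
      finally have "sing_value A i * \<bar>y \<bullet> v i - c i\<bar> * sing_value A i \<le> r * sing_value A i"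
        by (simp add: abs_mult power2_eq_square ac_simps)
      then have "sing_value A i * \<bar>y \<bullet> v i - c i\<bar> \<le> r"
        using pos[OF i] by (simp add: mult.commute)
      then have "\<bar>y \<bullet> v i - c i\<bar> \<le> r / sing_value A i"
        using pos[OF i] by (simp add: field_simps)
      then show ?thesis using True by (auto simp: lo_def hi_def abs_le_iff)
    qed
    then show "y \<in> B" by (simp add: B_def)
  qed
  have "(\<Prod>i\<in>?I. hi i - lo i) \<le> (\<Prod>i\<in>?I. 2 * R * (r / sing_value A i) powr sing_exponent CARD('d) s i)"
  proof (intro prod_mono conjI)
    fix i assume i: "i \<in> ?I"
    show "0 \<le> hi i - lo i" using lohi[OF i] by simp
    have x: "r / sing_value A i > 0" using r pos[OF i] by simp
    have "hi i - lo i = 2 * min R (r / sing_value A i)" by (auto simp: hi_def lo_def)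
    also have "\<dots> \<le> 2 * (R * min 1 (r / sing_value A i))"
      using R x mult_right_mono[of 1 R "r / sing_value A i"] by (auto simp: min_def)
    also have "\<dots> \<le> 2 * (R * (r / sing_value A i) powr sing_exponent CARD('d) s i)"
      using R s x by (intro mult_left_mono min_le_powr sing_exponent_nonneg sing_exponent_le_1) auto
    finally show "hi i - lo i \<le> 2 * R * (r / sing_value A i) powr sing_exponent CARD('d) s i" by simp
  qed
  also have "\<dots> = (2 * R) ^ CARD('d) * (r powr s / sing_value_fun s A)"
    by (subst prod.distrib, subst prod_divide_sing_exponent[OF nz s r]) auto
  finally show ?thesis using B sub by (intro exI[of _ B]) (auto intro: ennreal_leI)
qed

text \<open>The side condition on \<open>r\<close> makes \<open>max (\<alpha>\<^sub>i / r) 1\<close> comparable to \<open>(\<alpha>\<^sub>i / r) powr e\<^sub>i\<close>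
  for every \<open>i\<close>: the exponent is 1 below the critical index and 0 above it.\<close>

lemma emeasure_lborel_image_nbhd_le:
  fixes A :: "real^'d^'d"
  assumes nz: "0 < sing_value A CARD('d)"
    and s: "0 < s" "s \<le> real CARD('d)" and r: "r > 0" and R: "R \<ge> 0" and c: "c \<ge> 0"
    and m: "m = nat \<lceil>s\<rceil>" "r \<le> sing_value A m" "sing_value A m \<le> 2 * r"
  shows "\<exists>B. B \<in> sets borel \<and> {A *v y + b + z |y z. norm y \<le> R \<and> norm z \<le> c * r} \<subseteq> B \<and>
    emeasure lborel B \<le> ennreal ((4 * (R + c)) ^ CARD('d) * r ^ CARD('d) * (sing_value_fun s A / r powr s))"
proof -
  note pos = sing_value_pos[OF nz]
  let ?I = "{1..CARD('d)}"
  obtain v where v: "orthonormal_family v"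
    "\<And>i j. i \<in> ?I \<Longrightarrow> j \<in> ?I \<Longrightarrow>
       (A *v v i) \<bullet> (A *v v j) = (if i = j then (sing_value A i)\<^sup>2 else 0)"
    by (rule sing_value_basis_orthonormal) blast
  \<comment> \<open>The left singular vectors. In these directions the image of the ball of radius
    \<open>R\<close> is an ellipsoid with half-axes \<open>sing_value A i * R\<close>, which the
    perturbation \<open>z\<close> lengthens by at most \<open>c * r\<close>.\<close>
  define w where "w i = (1 / sing_value A i) *\<^sub>R (A *v v i)" for i
  have w: "orthonormal_family w"
    unfolding orthonormal_family_def
  proof (intro ballI)
    fix i j assume ij: "i \<in> ?I" "j \<in> ?I"
    show "w i \<bullet> w j = (if i = j then 1 else 0)"
      using v(2)[OF ij] pos[OF ij(1)] by (auto simp: w_def power2_eq_square)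
  qed
  have m': "1 \<le> m" "real m < s + 1" "s \<le> real m" "m \<le> CARD('d)"
    using s unfolding m(1) by linarith+
  define h where "h i = sing_value A i * R + c * r" for i
  have h0: "h i \<ge> 0" if "i \<in> ?I" for i using pos[OF that] R c r by (simp add: h_def)
  define B where "B = {x. \<forall>i\<in>?I. b \<bullet> w i - h i \<le> x \<bullet> w i \<and> x \<bullet> w i \<le> b \<bullet> w i + h i}"
  have le: "b \<bullet> w i - h i \<le> b \<bullet> w i + h i" if "i \<in> ?I" for i using h0[OF that] by simp
  have B: "B \<in> sets borel" "emeasure lborel B = ennreal (\<Prod>i\<in>?I. (b \<bullet> w i + h i) - (b \<bullet> w i - h i))"
    unfolding B_def
    using emeasure_lborel_orthonormal_box[OF w, of "\<lambda>i. b \<bullet> w i - h i" "\<lambda>i. b \<bullet> w i + h i"] le by blast+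
  have "A *v y + b + z \<in> B" if yz: "norm y \<le> R" "norm z \<le> c * r" for y z
  proof -
    have "\<bar>(A *v y + z) \<bullet> w i\<bar> \<le> h i" if i: "i \<in> ?I" for i
    proof -
      have nv: "norm (v i) = 1" using v(1) i by (simp add: orthonormal_family_def norm_eq_1)
      have nw: "norm (w i) = 1" using w i by (simp add: orthonormal_family_def norm_eq_1)
      have 1: "(A *v y) \<bullet> w i = sing_value A i * (y \<bullet> v i)"
        using norm_mult_vec_sing_value(2)[OF v i, of y] pos[OF i]
        by (simp add: w_def power2_eq_square)
      have 2: "\<bar>y \<bullet> v i\<bar> \<le> R" "\<bar>z \<bullet> w i\<bar> \<le> c * r"
        using Cauchy_Schwarz_ineq2[of y "v i"] Cauchy_Schwarz_ineq2[of z "w i"] yz nv nw by auto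
      have "\<bar>(A *v y + z) \<bullet> w i\<bar> \<le> sing_value A i * \<bar>y \<bullet> v i\<bar> + \<bar>z \<bullet> w i\<bar>"
        unfolding inner_add_left 1 using pos[OF i] abs_triangle_ineq[of "sing_value A i * (y \<bullet> v i)" "z \<bullet> w i"]
        by (simp add: abs_mult)
      also have "\<dots> \<le> h i" unfolding h_def using 2 pos[OF i] by (intro add_mono mult_left_mono) auto
      finally show ?thesis .
    qed
    then show ?thesis unfolding B_def by (auto simp: inner_add_left abs_le_iff) fastforce+
  qed
  then have sub: "{A *v y + b + z |y z. norm y \<le> R \<and> norm z \<le> c * r} \<subseteq> B" by auto
  have "(\<Prod>i\<in>?I. (b \<bullet> w i + h i) - (b \<bullet> w i - h i))
    \<le> (\<Prod>i\<in>?I. 4 * (R + c) * r * (1 / (r / sing_value A i) powr sing_exponent CARD('d) s i))"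
  proof (intro prod_mono conjI)
    fix i assume i: "i \<in> ?I"
    show "0 \<le> (b \<bullet> w i + h i) - (b \<bullet> w i - h i)" using h0[OF i] by simp
    let ?x = "sing_value A i / r" and ?e = "sing_exponent CARD('d) s i"
    have x: "?x > 0" using pos[OF i] r by simp
    have key: "max ?x 1 \<le> 2 * ?x powr ?e"
    proof -
      consider "i < m" | "i = m" | "i > m" by linarith
      then show ?thesis
      proof cases
        case 1
        then have "real i + 1 \<le> real m" by linarith
        then have "?e = 1" using m' s by (auto simp: sing_exponent_def)
        moreover have "sing_value A m \<le> sing_value A i" using 1 i m' by (intro sing_value_antimono) auto
        then have "?x \<ge> 1" using m(2) r by (simp add: field_simps)
        moreover have "?x powr 1 = ?x" using x by (intro powr_one) simp
        ultimately show ?thesis by (simp only:)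
      next
        case 2
        then have "?x \<ge> 1" "?x \<le> 2" using m r by (auto simp: field_simps)
        moreover have "1 \<le> ?x powr ?e"
          using calculation s by (intro ge_one_powr_ge_zero sing_exponent_nonneg) auto
        ultimately show ?thesis by linarith
      next
        case 3
        then have "?e = 0" using m' s by (auto simp: sing_exponent_def)
        moreover have "sing_value A i \<le> sing_value A m" using 3 i m' by (intro sing_value_antimono) auto
        then have "?x \<le> 2" using m(3) r by (simp add: field_simps)
        ultimately show ?thesis using pos[OF i] r by auto
      qed
    qed
    have inv: "1 / (r / sing_value A i) powr ?e = ?x powr ?e"
      using r pos[OF i] by (simp add: powr_divide)
    have "(b \<bullet> w i + h i) - (b \<bullet> w i - h i) = 2 * r * (?x * R + c)"
      using r by (simp add: h_def field_simps)
    also have "\<dots> \<le> 2 * r * (max ?x 1 * R + max ?x 1 * c)"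
      using r R c x by (intro mult_left_mono add_mono mult_right_mono) (auto simp: mult_le_cancel_right1)
    also have "\<dots> = 2 * (R + c) * r * max ?x 1" by (simp add: algebra_simps)
    also have "\<dots> \<le> 2 * (R + c) * r * (2 * ?x powr ?e)"
      using key r R c by (intro mult_left_mono) auto
    also have "\<dots> = 4 * (R + c) * r * (1 / (r / sing_value A i) powr ?e)"
      unfolding inv by (simp add: algebra_simps)
    finally show "(b \<bullet> w i + h i) - (b \<bullet> w i - h i)
      \<le> 4 * (R + c) * r * (1 / (r / sing_value A i) powr ?e)" .
  qed
  also have "\<dots> = (4 * (R + c)) ^ CARD('d) * r ^ CARD('d) * (sing_value_fun s A / r powr s)"
    by (subst prod.distrib, subst prod_dividef, subst prod_divide_sing_exponent[OF nz s r])
      (auto simp: power_mult_distrib)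
  finally show ?thesis using B sub by (intro exI[of _ B]) (auto intro: ennreal_leI)
qed

section \<open>Resampling in product spaces\<close>

text \<open>Conditioning on the coordinates in \<open>F\<close> is expressed by freezing them at the
  values of \<eta> and integrating over \<omega>, which replaces conditional expectations by
  ordinary integrals.\<close>

definition mix :: "'i set \<Rightarrow> ('i \<Rightarrow> 'b) \<Rightarrow> ('i \<Rightarrow> 'b) \<Rightarrow> 'i \<Rightarrow> 'b" where
  "mix F \<eta> \<omega> = (\<lambda>i. if i \<in> F then \<eta> i else \<omega> i)"

lemma mix_mix: "mix F \<eta> (mix G \<omega> \<omega>') = mix (F \<union> G) (mix F \<eta> \<omega>) \<omega>'"
  by (auto simp: mix_def)

lemma mix_in_space:
  "\<eta> \<in> space (PiM I M) \<Longrightarrow> \<omega> \<in> space (PiM I M) \<Longrightarrow> mix F \<eta> \<omega> \<in> space (PiM I M)"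
  by (auto simp: mix_def space_PiM PiE_def extensional_def Pi_def)

lemma measurable_mix_pair:
  "(\<lambda>(x, y). mix F x y) \<in> measurable (PiM I M \<Otimes>\<^sub>M PiM I M) (PiM I M)"
proof -
  have meas: "(\<lambda>z. \<lambda>i. (if i \<in> F then fst z else snd z) i) \<in> measurable (PiM I M \<Otimes>\<^sub>M PiM I M) (PiM I M)"
  proof (rule measurable_PiM_single')
    fix i assume i: "i \<in> I"
    show "(\<lambda>z. (if i \<in> F then fst z else snd z) i) \<in> measurable (PiM I M \<Otimes>\<^sub>M PiM I M) (M i)"
      using i by (cases "i \<in> F") simp_all
  next
    show "(\<lambda>z i. (if i \<in> F then fst z else snd z) i) \<in> space (PiM I M \<Otimes>\<^sub>M PiM I M) \<rightarrow> (\<Pi>\<^sub>E i\<in>I. space (M i))"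
      by (auto simp: space_pair_measure space_PiM PiE_def extensional_def Pi_def)
  qed
  have eq: "(\<lambda>(x, y). mix F x y) = (\<lambda>z. \<lambda>i. (if i \<in> F then fst z else snd z) i)"
    by (auto simp: mix_def fun_eq_iff)
  show ?thesis unfolding eq by (rule meas)
qed

lemma measurable_mix[measurable (raw)]:
  assumes "f \<in> measurable N (PiM I M)" "g \<in> measurable N (PiM I M)"
  shows "(\<lambda>x. mix F (f x) (g x)) \<in> measurable N (PiM I M)"
  using measurable_compose[OF measurable_Pair[OF assms] measurable_mix_pair] by simp

text \<open>The two arguments supply complementary coordinates. On a rectangle over a finite set
  \<open>J\<close> the measure therefore splits into the factors over \<open>J \<inter> F\<close>
  and \<open>J - F\<close>, which determines it.\<close>

lemma distr_mix:
  assumes M: "\<And>i. i \<in> I \<Longrightarrow> prob_space (M i)"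
  shows "distr (PiM I M \<Otimes>\<^sub>M PiM I M) (PiM I M) (\<lambda>(x, y). mix F x y) = PiM I M"
proof (rule measure_eqI_PiM_infinite[symmetric, OF refl])
  interpret I: prob_space "PiM I M" using M by (rule prob_space_PiM)
  show "finite_measure (PiM I M)" by unfold_locales
  fix J A assume J: "finite J" "J \<subseteq> I" and A: "\<And>i. i \<in> J \<Longrightarrow> A i \<in> sets (M i)"
  let ?X = "\<lambda>J. prod_emb I M J (Pi\<^sub>E J A)"
  have X: "emeasure (PiM I M) (?X K) = (\<Prod>i\<in>K. emeasure (M i) (A i))" if "K \<subseteq> J" for K
    using that J A by (intro emeasure_PiM_emb M) (auto intro: finite_subset)
  have Xs: "?X K \<in> sets (PiM I M)" if "K \<subseteq> J" for K
    using that J A by (intro sets_PiM_I) (auto intro: finite_subset)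
  have "emeasure (distr (PiM I M \<Otimes>\<^sub>M PiM I M) (PiM I M) (\<lambda>(x, y). mix F x y)) (?X J)
    = emeasure (PiM I M \<Otimes>\<^sub>M PiM I M)
        ((\<lambda>(x, y). mix F x y) -` ?X J \<inter> space (PiM I M \<Otimes>\<^sub>M PiM I M))"
    using Xs[of J] by (intro emeasure_distr measurable_mix_pair) auto
  also have "(\<lambda>(x, y). mix F x y) -` ?X J \<inter> space (PiM I M \<Otimes>\<^sub>M PiM I M) = ?X (J \<inter> F) \<times> ?X (J - F)"
  proof -
    have *: "z \<in> ?X K \<longleftrightarrow> z \<in> space (PiM I M) \<and> (\<forall>i\<in>K. z i \<in> A i)" if "K \<subseteq> J" for z K
      using that J by (auto simp: prod_emb_def space_PiM PiE_iff)
    have "x \<in> space (PiM I M) \<Longrightarrow> y \<in> space (PiM I M) \<Longrightarrow>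
      mix F x y \<in> ?X J \<longleftrightarrow> x \<in> ?X (J \<inter> F) \<and> y \<in> ?X (J - F)" for x y
      using mix_in_space[of x I M y F] by (auto simp: *) (auto simp: mix_def split: if_splits)
    then show ?thesis
      using * by (fastforce simp: space_pair_measure)
  qed
  also have "emeasure (PiM I M \<Otimes>\<^sub>M PiM I M) (?X (J \<inter> F) \<times> ?X (J - F))
    = emeasure (PiM I M) (?X (J \<inter> F)) * emeasure (PiM I M) (?X (J - F))"
    by (intro I.emeasure_pair_measure_Times Xs) auto
  also have "\<dots> = (\<Prod>i\<in>(J \<inter> F) \<union> (J - F). emeasure (M i) (A i))"
    using J by (subst prod.union_disjoint) (auto simp: X)
  also have "(J \<inter> F) \<union> (J - F) = J" by auto
  finally show "emeasure (PiM I M) (?X J)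
    = emeasure (distr (PiM I M \<Otimes>\<^sub>M PiM I M) (PiM I M) (\<lambda>(x, y). mix F x y)) (?X J)"
    using X[of J] by simp
qed simp

lemma nn_integral_PiM_mix:
  assumes M: "\<And>i. i \<in> I \<Longrightarrow> prob_space (M i)" and f: "f \<in> borel_measurable (PiM I M)"
  shows "(\<integral>\<^sup>+\<omega>. f \<omega> \<partial>PiM I M) = (\<integral>\<^sup>+\<omega>. \<integral>\<^sup>+\<omega>'. f (mix G \<omega> \<omega>') \<partial>PiM I M \<partial>PiM I M)"
proof -
  interpret I: prob_space "PiM I M" using M by (rule prob_space_PiM)
  have "(\<integral>\<^sup>+\<omega>. f \<omega> \<partial>PiM I M)
    = (\<integral>\<^sup>+\<omega>. f \<omega> \<partial>distr (PiM I M \<Otimes>\<^sub>M PiM I M) (PiM I M) (\<lambda>(x, y). mix G x y))"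
    by (simp only: distr_mix[OF M])
  also have "\<dots> = (\<integral>\<^sup>+z. f ((\<lambda>(x, y). mix G x y) z) \<partial>(PiM I M \<Otimes>\<^sub>M PiM I M))"
    by (rule nn_integral_distr[OF measurable_mix_pair]) (use f in simp)
  also have "\<dots> = (\<integral>\<^sup>+\<omega>. \<integral>\<^sup>+\<omega>'. f (mix G \<omega> \<omega>') \<partial>PiM I M \<partial>PiM I M)"
    using measurable_compose[OF measurable_mix_pair f]
    by (subst I.nn_integral_fst[symmetric]) auto
  finally show ?thesis .
qed

text \<open>The tower property with \<open>F\<close> already frozen: the coordinates in
  \<open>G\<close> are frozen as well and the rest is resampled in the inner integral.\<close>

lemma nn_integral_PiM_mix_fixed:
  assumes M: "\<And>i. i \<in> I \<Longrightarrow> prob_space (M i)" and f: "f \<in> borel_measurable (PiM I M)"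
    and \<eta>: "\<eta> \<in> space (PiM I M)"
  shows "(\<integral>\<^sup>+\<omega>. f (mix F \<eta> \<omega>) \<partial>PiM I M)
    = (\<integral>\<^sup>+\<omega>. \<integral>\<^sup>+\<omega>'. f (mix (F \<union> G) (mix F \<eta> \<omega>) \<omega>') \<partial>PiM I M \<partial>PiM I M)"
proof -
  have "(\<lambda>\<omega>. f (mix F \<eta> \<omega>)) \<in> borel_measurable (PiM I M)"
    using \<eta> by (intro measurable_compose[OF _ f] measurable_mix) auto
  from nn_integral_PiM_mix[OF M this, of G] show ?thesis by (simp add: mix_mix)
qed

text \<open>The Radon-Nikodym density is cut at a height \<open>n\<close>; by monotone convergence
  the mass above the cut is at most \<delta> once \<open>n\<close> is large.\<close>

lemma absolutely_continuous_truncation: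
  fixes P :: "'a::euclidean_space measure"
  assumes P: "prob_space P" "sets P = sets borel" "absolutely_continuous lborel P" and \<delta>: "\<delta> > 0"
  obtains K :: real and h1 h2 :: "'a \<Rightarrow> ennreal"
  where "K > 0" "h1 \<in> borel_measurable borel" "h2 \<in> borel_measurable borel"
    "P = density lborel (\<lambda>x. h1 x + h2 x)" "\<And>x. h1 x \<le> ennreal K" "(\<integral>\<^sup>+x. h2 x \<partial>lborel) \<le> ennreal \<delta>"
proof -
  interpret P: prob_space P by fact
  define f where "f = RN_deriv lborel P"
  have fm[measurable]: "f \<in> borel_measurable borel"
    using borel_measurable_RN_deriv[of lborel P] by (simp add: f_def)
  have fP: "density lborel f = P"
    unfolding f_def using P by (intro sigma_finite_measure.density_RN_deriv[OF sigma_finite_lborel]) auto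
  have int: "(\<integral>\<^sup>+x. f x \<partial>lborel) = 1"
    using P.emeasure_space_1 unfolding fP[symmetric] by (simp add: emeasure_density)
  define g where "g n x = min (f x) (ennreal (real n))" for n x
  have [measurable]: "g n \<in> borel_measurable borel" for n unfolding g_def by measurable
  have "(SUP n. g n x) = f x" for x
  proof (rule antisym)
    show "(SUP n. g n x) \<le> f x" by (intro SUP_least) (simp add: g_def)
    have "(SUP n. g n x) = min (f x) (SUP n. ennreal (real n))"
      unfolding g_def inf_min[symmetric] by (simp add: inf_SUP)
    also have "(SUP n. ennreal (real n)) = top"
      using ennreal_SUP_of_nat_eq_top by (simp add: ennreal_of_nat_eq_real_of_nat)
    finally show "f x \<le> (SUP n. g n x)" by (simp add: min_def)
  qed
  then have "(SUP n. \<integral>\<^sup>+x. g n x \<partial>lborel) = 1"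
  proof -
    have "(\<integral>\<^sup>+x. (SUP n. g n x) \<partial>lborel) = (SUP n. \<integral>\<^sup>+x. g n x \<partial>lborel)"
      by (intro nn_integral_monotone_convergence_SUP)
        (auto simp: incseq_def le_fun_def g_def min.mono[OF order_refl] ennreal_leI simp del: min.bounded_iff)
    then show ?thesis using int \<open>\<And>x. (SUP n. g n x) = f x\<close> by simp
  qed
  moreover have "1 - ennreal \<delta> < (1::ennreal)" using \<delta> by (simp add: ennreal_between)
  ultimately obtain n where n: "1 - ennreal \<delta> < (\<integral>\<^sup>+x. g n x \<partial>lborel)"
    by (metis less_SUP_iff)
  define h where "h x = f x - g n x" for x
  have [measurable]: "h \<in> borel_measurable borel" unfolding h_def by measurable
  have sum: "g n x + h x = f x" for x
    by (simp add: h_def g_def add.commute[of _ "f x - _"] diff_add_cancel_ennreal)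
  let ?G = "\<integral>\<^sup>+x. g n x \<partial>lborel"
  have GH: "?G + (\<integral>\<^sup>+x. h x \<partial>lborel) = 1"
    by (subst nn_integral_add[symmetric]) (auto simp: sum int)
  have "1 \<le> ?G + ennreal \<delta>"
  proof (cases "ennreal \<delta> \<le> 1")
    case True
    have "(1 - ennreal \<delta>) + ennreal \<delta> \<le> ?G + ennreal \<delta>"
      using n by (intro add_right_mono) auto
    then show ?thesis using diff_add_cancel_ennreal[OF True] by simp
  next
    case False
    then show ?thesis by (simp add: add_increasing)
  qed
  then have "?G + (\<integral>\<^sup>+x. h x \<partial>lborel) \<le> ?G + ennreal \<delta>" using GH by simp
  moreover have "?G \<noteq> top" using GH by (auto simp: top_add)
  ultimately have "(\<integral>\<^sup>+x. h x \<partial>lborel) \<le> ennreal \<delta>"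
    by (simp add: ennreal_add_left_cancel_le)
  show ?thesis
  \<comment> \<open>\<open>Suc n\<close> instead of \<open>n\<close> keeps the bound positive when
    \<open>n = 0\<close>.\<close>
  proof (rule that[of "real (Suc n)" "g n" h])
    show "P = density lborel (\<lambda>x. g n x + h x)" using fP sum by simp
    show "g n x \<le> ennreal (real (Suc n))" for x
      unfolding g_def by (rule min.coboundedI2) (simp add: ennreal_leI)
  qed (use \<open>(\<integral>\<^sup>+x. h x \<partial>lborel) \<le> ennreal \<delta>\<close> in auto)
qed

section \<open>Smoothing by random translations\<close>

text \<open>The Horner form of the translation part of a composition of the maps
  \<open>x -> S x + \<omega> i\<close>; the last linear part acts on 0. Unfolding from the outside
  isolates the first translation, over which the smoothing estimate integrates.\<close>

fun nested_sum :: "('i \<times> ('a \<Rightarrow> 'a::real_vector)) list \<Rightarrow> ('i \<Rightarrow> 'a) \<Rightarrow> 'a" where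
  "nested_sum [] \<omega> = 0"
| "nested_sum ((i, S) # xs) \<omega> = \<omega> i + S (nested_sum xs \<omega>)"

lemma nested_sum_cong:
  "(\<And>i. i \<in> fst ` set xs \<Longrightarrow> \<omega> i = \<omega>' i) \<Longrightarrow> nested_sum xs \<omega> = nested_sum xs \<omega>'"
  by (induction xs) force+

lemma measurable_nested_sum:
  fixes P :: "'a::euclidean_space measure"
  assumes "sets P = sets borel" "fst ` set xs \<subseteq> I" "\<And>S. S \<in> snd ` set xs \<Longrightarrow> linear S"
  shows "nested_sum xs \<in> borel_measurable (PiM I (\<lambda>_. P))"
  using assms(2,3)
proof (induction xs)
  case Nil
  have "nested_sum [] = (\<lambda>_. 0 :: 'a)" by auto
  then show ?case by simp
next
  case (Cons a xs)
  obtain i S where a: "a = (i, S)" by (cases a)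
  have [measurable]: "nested_sum xs \<in> borel_measurable (PiM I (\<lambda>_. P))"
    using Cons by auto
  have "linear S" using Cons.prems(2) a by auto
  then have [measurable]: "S \<in> borel_measurable borel"
    by (intro borel_measurable_continuous_onI) (simp add: linear_continuous_on linear_conv_bounded_linear)
  have "i \<in> I" using Cons.prems(1) a by auto
  then have "(\<lambda>\<omega>. \<omega> i) \<in> measurable (PiM I (\<lambda>_. P)) P" by simp
  then have [measurable]: "(\<lambda>\<omega>. \<omega> i) \<in> borel_measurable (PiM I (\<lambda>_. P))"
    using assms(1) by (simp cong: measurable_cong_sets)
  have "nested_sum (a # xs) = (\<lambda>\<omega>. \<omega> i + S (nested_sum xs \<omega>))" by (auto simp: a)
  then show ?case by simp
qed

text \<open>Splitting the density of the first summand at height \<open>K\<close>, the bounded part contributes at most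
  \<open>K\<close> times the volume, while the remaining mass \<open>\<delta>\<close> is too small to compensate the volume
  distortion \<open>(1 / a) ^ d\<close> of the next linear map.\<close>

lemma emeasure_nested_sum_le:
  fixes P :: "'a::euclidean_space measure" and h1 h2 :: "'a \<Rightarrow> ennreal"
  assumes P: "prob_space P" "P = density lborel (\<lambda>x. h1 x + h2 x)"
    and h[measurable]: "h1 \<in> borel_measurable borel" "h2 \<in> borel_measurable borel"
    and hK: "\<And>x. h1 x \<le> ennreal K" and h\<delta>: "(\<integral>\<^sup>+x. h2 x \<partial>lborel) \<le> ennreal \<delta>"
    and K: "K > 0" and \<delta>: "\<delta> > 0" "2 * \<delta> * (1 / a) ^ DIM('a) \<le> 1" and a: "a > 0"
    and xs: "distinct (map fst xs)" "fst ` set xs \<subseteq> I"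
      "\<And>S. S \<in> snd ` set xs \<Longrightarrow> linear S \<and> (\<forall>x. a * norm x \<le> norm (S x))"
    and A: "A \<in> sets borel"
  shows "emeasure (PiM I (\<lambda>_. P)) {\<omega> \<in> space (PiM I (\<lambda>_. P)). nested_sum xs \<omega> \<in> A}
    \<le> ennreal (2 * K) * emeasure lborel A + ennreal (\<delta> ^ length xs)"
  using xs A
proof (induction xs arbitrary: A)
  case Nil
  interpret M: prob_space "PiM I (\<lambda>_. P)" using P(1) by (intro prob_space_PiM)
  show ?case using M.emeasure_le_1 by (simp add: add_increasing)
next
  case (Cons b xs)
  let ?M = "PiM I (\<lambda>_. P)"
  interpret P: prob_space P by fact
  interpret M: prob_space ?M using P(1) by (intro prob_space_PiM)
  interpret pair_sigma_finite ?M lborel ..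
  obtain i S where b: "b = (i, S)" by (cases b)
  have setsP: "sets P = sets borel" using P(2) by simp
  have S: "linear S" "\<And>x. a * norm x \<le> norm (S x)" using Cons.prems(3) b by auto
  have i: "i \<in> I" "i \<notin> fst ` set xs" using Cons.prems b by auto
  define V where "V = nested_sum xs"
  have V[measurable]: "V \<in> borel_measurable ?M"
    unfolding V_def using Cons.prems setsP by (intro measurable_nested_sum) auto
  have Sm[measurable]: "S \<in> borel_measurable borel"
    using S(1) by (intro borel_measurable_continuous_onI)
      (simp add: linear_continuous_on linear_conv_bounded_linear)
  note A[measurable] = Cons.prems(4)
  have comp: "(\<lambda>\<omega>. \<omega> i) \<in> measurable ?M P" using i by simp
  then have [measurable]: "(\<lambda>\<omega>. \<omega> i) \<in> borel_measurable ?M"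
    using setsP by (simp cong: measurable_cong_sets)
  have f[measurable]: "(\<lambda>\<omega>. indicator A (\<omega> i + S (V \<omega>)) :: ennreal) \<in> borel_measurable ?M"
    by measurable
  have dens: "(\<integral>\<^sup>+x. g x \<partial>P) = (\<integral>\<^sup>+x. (h1 x + h2 x) * g x \<partial>lborel)"
    if "g \<in> borel_measurable borel" for g
    using that by (subst P(2), subst nn_integral_density) auto
  have "emeasure ?M {\<omega> \<in> space ?M. nested_sum (b # xs) \<omega> \<in> A}
    = (\<integral>\<^sup>+\<omega>. indicator A (\<omega> i + S (V \<omega>)) \<partial>?M)"
  proof -
    have "{\<omega> \<in> space ?M. \<omega> i + S (V \<omega>) \<in> A} \<in> sets ?M" by measurable
    from nn_integral_indicator[OF this, symmetric] show ?thesis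
      unfolding b V_def[symmetric] nested_sum.simps
      by (rule trans) (rule nn_integral_cong, auto simp: indicator_def)
  qed
  also have "\<dots> = (\<integral>\<^sup>+\<omega>. \<integral>\<^sup>+\<omega>'. indicator A (mix {i} \<omega> \<omega>' i + S (V (mix {i} \<omega> \<omega>'))) \<partial>?M \<partial>?M)"
    by (rule nn_integral_PiM_mix[OF P(1) f])
  also have "\<dots> = (\<integral>\<^sup>+\<omega>. \<integral>\<^sup>+\<omega>'. indicator A (\<omega> i + S (V \<omega>')) \<partial>?M \<partial>?M)"
  proof -
    \<comment> \<open>The nodes are distinct, so \<open>V\<close> does not see coordinate
      \<open>i\<close>. Resampling everything but \<open>i\<close> thus separates the first
      translation from the rest.\<close>
    have "V (mix {i} \<omega> \<omega>') = V \<omega>'" for \<omega> \<omega>'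
      unfolding V_def using i by (intro nested_sum_cong) (auto simp: mix_def)
    then show ?thesis by (simp add: mix_def)
  qed
  also have "\<dots> = (\<integral>\<^sup>+x. \<integral>\<^sup>+\<omega>'. indicator A (x + S (V \<omega>')) \<partial>?M \<partial>distr ?M P (\<lambda>\<omega>. \<omega> i))"
    by (subst nn_integral_distr[OF comp]) (auto simp: setsP cong: measurable_cong_sets)
  also have "distr ?M P (\<lambda>\<omega>. \<omega> i) = P" using i P(1) by (intro distr_PiM_component) auto
  also have "(\<integral>\<^sup>+x. \<integral>\<^sup>+\<omega>'. indicator A (x + S (V \<omega>')) \<partial>?M \<partial>P)
    = (\<integral>\<^sup>+x. (h1 x + h2 x) * (\<integral>\<^sup>+\<omega>'. indicator A (x + S (V \<omega>')) \<partial>?M) \<partial>lborel)"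
    by (rule dens) measurable
  also have "\<dots> = (\<integral>\<^sup>+x. h1 x * (\<integral>\<^sup>+\<omega>'. indicator A (x + S (V \<omega>')) \<partial>?M) \<partial>lborel)
    + (\<integral>\<^sup>+x. h2 x * (\<integral>\<^sup>+\<omega>'. indicator A (x + S (V \<omega>')) \<partial>?M) \<partial>lborel)"
    by (subst nn_integral_add[symmetric]) (auto simp: distrib_right)
  also have "\<dots> \<le> ennreal K * emeasure lborel A
    + (ennreal K * emeasure lborel A + ennreal (\<delta> ^ Suc (length xs)))"
  proof (rule add_mono)
    have "(\<integral>\<^sup>+x. h1 x * (\<integral>\<^sup>+\<omega>'. indicator A (x + S (V \<omega>')) \<partial>?M) \<partial>lborel)
      \<le> (\<integral>\<^sup>+x. ennreal K * (\<integral>\<^sup>+\<omega>'. indicator A (x + S (V \<omega>')) \<partial>?M) \<partial>lborel)"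
      using hK by (intro nn_integral_mono mult_right_mono) auto
    also have "\<dots> = ennreal K * (\<integral>\<^sup>+x. \<integral>\<^sup>+\<omega>'. indicator A (x + S (V \<omega>')) \<partial>?M \<partial>lborel)"
      by (rule nn_integral_cmult) measurable
    also have "(\<integral>\<^sup>+x. \<integral>\<^sup>+\<omega>'. indicator A (x + S (V \<omega>')) \<partial>?M \<partial>lborel)
      = (\<integral>\<^sup>+\<omega>'. \<integral>\<^sup>+x. indicator A (x + S (V \<omega>')) \<partial>lborel \<partial>?M)"
      by (rule Fubini') measurable
    also have "\<dots> = (\<integral>\<^sup>+\<omega>'. emeasure lborel A \<partial>?M)"
    proof (rule nn_integral_cong)
      fix \<omega>'
      have "(\<integral>\<^sup>+x. indicator A x \<partial>lborel) = (\<integral>\<^sup>+x. indicator A x \<partial>distr lborel borel ((+) (S (V \<omega>'))))"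
        by (simp only: lborel_distr_plus)
      also have "\<dots> = (\<integral>\<^sup>+x. indicator A (S (V \<omega>') + x) \<partial>lborel)"
        by (rule nn_integral_distr) auto
      finally show "(\<integral>\<^sup>+x. indicator A (x + S (V \<omega>')) \<partial>lborel) = emeasure lborel A"
        by (simp add: add.commute)
    qed
    also have "\<dots> = emeasure lborel A" by (simp add: M.emeasure_space_1)
    finally show "(\<integral>\<^sup>+x. h1 x * (\<integral>\<^sup>+\<omega>'. indicator A (x + S (V \<omega>')) \<partial>?M) \<partial>lborel)
      \<le> ennreal K * emeasure lborel A" .
  next
    \<comment> \<open>\<open>c\<close> is the induction hypothesis for the preimage of
      \<open>A\<close> under \<open>x + S\<close>, whose volume grows at most by
      \<open>(1 / a) ^ DIM('a)\<close>. The condition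
      \<open>2 * \<delta> * (1 / a) ^ DIM('a) \<le> 1\<close> makes the volume term of
      \<open>\<delta> * c\<close> at most \<open>K\<close> times the volume of \<open>A\<close>, so
      the constant \<open>2 * K\<close> reproduces itself.\<close>
    define c where "c = ennreal (2 * K) * (ennreal ((1 / a) ^ DIM('a)) * emeasure lborel A) + ennreal (\<delta> ^ length xs)"
    have "(\<integral>\<^sup>+\<omega>'. indicator A (x + S (V \<omega>')) \<partial>?M) \<le> c" for x
    proof -
      define B where "B = S -` ((+) x -` A)"
      have xA: "(+) x -` A \<in> sets borel"
        using measurable_sets_borel[of "(+) x" borel A] by simp
      have B: "B \<in> sets borel"
        unfolding B_def using measurable_sets_borel[OF Sm xA] by simp
      have "emeasure lborel ((+) x -` A) = emeasure (distr lborel borel ((+) x)) A"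
        by (subst emeasure_distr) auto
      then have vol: "emeasure lborel ((+) x -` A) = emeasure lborel A"
        by (simp only: lborel_distr_plus)
      have "(\<integral>\<^sup>+\<omega>'. indicator A (x + S (V \<omega>')) \<partial>?M) = emeasure ?M {\<omega> \<in> space ?M. nested_sum xs \<omega> \<in> B}"
      proof -
        have "{\<omega> \<in> space ?M. V \<omega> \<in> B} \<in> sets ?M" using B by measurable
        from nn_integral_indicator[OF this, symmetric] show ?thesis
          unfolding V_def[symmetric]
          by (rule trans[THEN sym]) (rule nn_integral_cong, auto simp: indicator_def B_def)
      qed
      also have "\<dots> \<le> ennreal (2 * K) * emeasure lborel B + ennreal (\<delta> ^ length xs)"
        using Cons.prems B by (intro Cons.IH) auto
      also have "\<dots> \<le> c"
        unfolding c_def B_def vol[symmetric]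
        using S a xA by (intro add_right_mono mult_left_mono emeasure_lborel_linear_vimage_le) auto
      finally show ?thesis .
    qed
    then have "(\<integral>\<^sup>+x. h2 x * (\<integral>\<^sup>+\<omega>'. indicator A (x + S (V \<omega>')) \<partial>?M) \<partial>lborel) \<le> (\<integral>\<^sup>+x. h2 x * c \<partial>lborel)"
      by (intro nn_integral_mono mult_left_mono) auto
    also have "\<dots> = (\<integral>\<^sup>+x. h2 x \<partial>lborel) * c" by (rule nn_integral_multc) simp
    also have "\<dots> \<le> ennreal \<delta> * c" using h\<delta> by (intro mult_right_mono) auto
    also have "\<dots> = ennreal (\<delta> * (2 * K) * (1 / a) ^ DIM('a)) * emeasure lborel A + ennreal (\<delta> ^ Suc (length xs))"
      unfolding c_def using \<delta> K a by (simp add: distrib_left ennreal_mult mult_ac)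
    also have "\<dots> \<le> ennreal K * emeasure lborel A + ennreal (\<delta> ^ Suc (length xs))"
    proof -
      have "\<delta> * (2 * K) * (1 / a) ^ DIM('a) = K * (2 * \<delta> * (1 / a) ^ DIM('a))" by simp
      also have "\<dots> \<le> K * 1" using \<delta> K by (intro mult_left_mono) auto
      finally show ?thesis by (intro add_right_mono mult_right_mono ennreal_leI) auto
    qed
    finally show "(\<integral>\<^sup>+x. h2 x * (\<integral>\<^sup>+\<omega>'. indicator A (x + S (V \<omega>')) \<partial>?M) \<partial>lborel)
      \<le> ennreal K * emeasure lborel A + ennreal (\<delta> ^ Suc (length xs))" .
  qed
  also have "\<dots> = ennreal (2 * K) * emeasure lborel A + ennreal (\<delta> ^ length (b # xs))"
    using K by (simp add: ennreal_plus[symmetric] distrib_right[symmetric] add.assoc[symmetric] del: ennreal_plus)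
  finally show ?case .
qed

section \<open>Moments on a random tree\<close>

lemma bernoulli_powr:
  fixes x r :: real
  assumes "0 \<le> x" "1 \<le> r"
  shows "1 + r * (x - 1) \<le> x powr r"
proof (cases "x = 0")
  case True then show ?thesis using assms by simp
next
  case False
  then have x: "x > 0" using assms by simp
  have "((\<lambda>x. x powr r) has_real_derivative r * 1 powr (r - 1)) (at 1 within {0<..})"
    by (rule has_field_derivative_at_within[OF has_real_derivative_powr]) simp
  from convex_on_imp_above_tangent[OF powr_convex[OF assms(2)] _ _ _ this, of x]
  have "x powr r - 1 powr r \<ge> r * 1 powr (r - 1) * (x - 1)"
    using x by (simp add: interior_open convex_connected)
  then show ?thesis by simp
qed

text \<open>Jensen's inequality for a power, from the tangent line at the mean \<open>a\<close>.
  Total weight 0 is included: division by zero then makes the mean 0.\<close>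

lemma weighted_mean_powr_le:
  fixes m h :: "'a \<Rightarrow> real"
  assumes fin: "finite A" and m: "\<And>w. w \<in> A \<Longrightarrow> 0 \<le> m w" and h: "\<And>w. w \<in> A \<Longrightarrow> 0 \<le> h w" and r: "1 \<le> r"
  defines "M \<equiv> \<Sum>w\<in>A. m w"
  shows "M * ((\<Sum>w\<in>A. m w * h w) / M) powr r \<le> (\<Sum>w\<in>A. m w * h w powr r)"
proof -
  define a where "a = (\<Sum>w\<in>A. m w * h w) / M"
  have M0: "M \<ge> 0" unfolding M_def by (intro sum_nonneg m)
  have a0: "a \<ge> 0" unfolding a_def using M0 m h by (intro divide_nonneg_nonneg sum_nonneg) auto
  show ?thesis
  proof (cases "a = 0")
    case True
    then show ?thesis unfolding a_def[symmetric] by (auto intro!: sum_nonneg mult_nonneg_nonneg m)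
  next
    case False
    then have a: "a > 0" using a0 by simp
    have Mn: "M \<noteq> 0" using False by (auto simp: a_def)
    have "M * a powr r = (\<Sum>w\<in>A. m w * (a powr r * (1 + r * (h w / a - 1))))"
    proof -
      have "(\<Sum>w\<in>A. m w * (a powr r * (1 + r * (h w / a - 1))))
        = (\<Sum>w\<in>A. a powr r * (1 - r) * m w + a powr r * r / a * (m w * h w))"
        by (intro sum.cong refl) (simp add: algebra_simps)
      also have "\<dots> = a powr r * (1 - r) * M + a powr r * r / a * (\<Sum>w\<in>A. m w * h w)"
        unfolding M_def by (simp only: sum.distrib sum_distrib_left)
      also have "(\<Sum>w\<in>A. m w * h w) = a * M" using Mn by (simp add: a_def)
      also have "a powr r * r / a * (a * M) = a powr r * r * M" using a by simp
      also have "a powr r * (1 - r) * M + a powr r * r * M = M * a powr r"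
        by (simp add: algebra_simps)
      finally show ?thesis by simp
    qed
    also have "\<dots> \<le> (\<Sum>w\<in>A. m w * h w powr r)"
    proof (intro sum_mono mult_left_mono m)
      fix w assume w: "w \<in> A"
      have "a powr r * (1 + r * (h w / a - 1)) \<le> a powr r * (h w / a) powr r"
        using a h[OF w] r by (intro mult_left_mono bernoulli_powr) auto
      also have "\<dots> = h w powr r" using a h[OF w] by (simp add: powr_divide)
      finally show "a powr r * (1 + r * (h w / a - 1)) \<le> h w powr r" .
    qed
    finally show ?thesis by (simp add: a_def)
  qed
qed

text \<open>Replacing every term by the largest one works for exponents below and above 1 alike. The
  price \<open>N powr \<kappa>\<close> goes into the polynomial loss.\<close>

lemma sum_powr_le:
  fixes z :: "'a \<Rightarrow> real"
  assumes fin: "finite A" and z: "\<And>i. i \<in> A \<Longrightarrow> 0 \<le> z i" and \<kappa>: "\<kappa> > 0" and N: "real (card A) \<le> N"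
  shows "(\<Sum>i\<in>A. z i) powr \<kappa> \<le> N powr \<kappa> * (\<Sum>i\<in>A. z i powr \<kappa>)"
proof (cases "A = {}")
  case False
  define M where "M = Max (z ` A)"
  have M: "\<And>i. i \<in> A \<Longrightarrow> z i \<le> M" unfolding M_def using fin by auto
  have "M \<in> z ` A" unfolding M_def using fin False by (intro Max_in) auto
  then obtain j where j: "j \<in> A" "M = z j" by auto
  have M0: "0 \<le> M" using j z by auto
  have N0: "0 \<le> N" using N by (metis of_nat_0_le_iff order_trans)
  have "(\<Sum>i\<in>A. z i) \<le> real (card A) * M" using sum_bounded_above[of A z M] M by auto
  also have "\<dots> \<le> N * M" using N M0 by (intro mult_right_mono)
  finally have "(\<Sum>i\<in>A. z i) powr \<kappa> \<le> (N * M) powr \<kappa>"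
    using \<kappa> z by (intro powr_mono2 sum_nonneg) auto
  also have "\<dots> = N powr \<kappa> * z j powr \<kappa>" using N0 M0 j by (simp add: powr_mult)
  also have "\<dots> \<le> N powr \<kappa> * (\<Sum>i\<in>A. z i powr \<kappa>)"
    using member_le_sum[of j A "\<lambda>i. z i powr \<kappa>"] fin j by (intro mult_left_mono) auto
  finally show ?thesis .
qed simp

text \<open>Young's inequality for the conjugate exponents \<open>\<kappa> + 1\<close> and
  \<open>(\<kappa> + 1) / \<kappa>\<close>, obtained by comparing \<open>y\<close> with
  \<open>x powr \<kappa>\<close>. With a maximum on the right, a further power can be taken term by
  term.\<close>

lemma mult_le_powr_add_powr:
  fixes x y \<kappa> :: real
  assumes "0 \<le> x" "0 \<le> y" "\<kappa> > 0"
  shows "x * y \<le> max (x powr (\<kappa> + 1)) (y powr ((\<kappa> + 1) / \<kappa>))"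
proof (cases "y \<le> x powr \<kappa>")
  case True
  then have "x * y \<le> x * x powr \<kappa>" using assms by (intro mult_left_mono)
  also have "\<dots> = x powr (\<kappa> + 1)" using assms by (cases "x = 0") (simp_all add: powr_add)
  finally show ?thesis by simp
next
  case False
  then have "(x powr \<kappa>) powr (1 / \<kappa>) \<le> y powr (1 / \<kappa>)"
    using assms by (intro powr_mono2) auto
  then have "x \<le> y powr (1 / \<kappa>)" using assms by (simp add: powr_powr)
  then have "x * y \<le> y powr (1 / \<kappa>) * y" using assms by (intro mult_right_mono)
  also have "\<dots> = y powr ((\<kappa> + 1) / \<kappa>)"
    using assms by (cases "y = 0") (simp_all add: powr_add[symmetric] add_divide_distrib powr_mult_base mult.commute)
  finally show ?thesis by simp
qed

text \<open>The constant accumulated over \<open>j\<close> rounds of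
  \<open>sum_moment_bound_le\<close>. Each round pays \<open>(L + 1) powr \<theta>\<close> for the
  prefactor of the recursion, a power \<open>\<theta> / (\<kappa> + j)\<close> of
  \<open>L + 1\<close> for a power of a sum over levels, and one more \<open>L + 1\<close> for
  summing over the levels of the peeled node. The initial value comes from the factor 2 in
  \<open>moment_bound\<close>.\<close>

fun loss :: "nat \<Rightarrow> real \<Rightarrow> real \<Rightarrow> nat \<Rightarrow> real" where
  "loss L \<kappa> \<theta> 0 = 2 powr (\<theta> / \<kappa>)"
| "loss L \<kappa> \<theta> (Suc j) = (real L + 1) powr \<theta> *
     (1 + (real L + 1) powr (1 + \<theta> / (\<kappa> + real j)) * loss L \<kappa> \<theta> j)"

lemma loss_polynomially_bounded:
  assumes "\<kappa> > 0" "\<theta> \<ge> 0"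
  shows "\<exists>c e. 0 \<le> c \<and> 0 \<le> e \<and> (\<forall>L. loss L \<kappa> \<theta> j \<le> c * (real L + 1) powr e)"
proof (induction j)
  case 0
  show ?case by (rule exI[of _ "2 powr (\<theta> / \<kappa>)"], rule exI[of _ 0]) simp
next
  case (Suc j)
  then obtain c e where ce: "0 \<le> c" "0 \<le> e" "\<And>L. loss L \<kappa> \<theta> j \<le> c * (real L + 1) powr e" by blast
  define r where "r = \<theta> / (\<kappa> + real j)"
  have r: "0 \<le> r" using assms by (simp add: r_def)
  have "loss L \<kappa> \<theta> (Suc j) \<le> (1 + c) * (real L + 1) powr (\<theta> + (1 + r + e))" for L
  proof -
    define N where "N = real L + 1"
    have N: "N \<ge> 1" by (simp add: N_def)
    have "1 + N powr (1 + r) * loss L \<kappa> \<theta> j \<le> N powr (1 + r + e) + N powr (1 + r) * (c * N powr e)"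
      using ce r N unfolding N_def by (intro add_mono mult_left_mono ge_one_powr_ge_zero) auto
    also have "\<dots> = (1 + c) * N powr (1 + r + e)"
      by (simp add: powr_add algebra_simps)
    finally have "N powr \<theta> * (1 + N powr (1 + r) * loss L \<kappa> \<theta> j) \<le> N powr \<theta> * ((1 + c) * N powr (1 + r + e))"
      by (intro mult_left_mono) auto
    then show ?thesis by (simp add: N_def r_def powr_add mult_ac)
  qed
  then show ?case using ce r assms
    by (intro exI[of _ "1 + c"] exI[of _ "\<theta> + (1 + r + e)"]) auto
qed

text \<open>Leaves are the words in \<open>W\<close>, nodes are their prefixes. The weight
  \<open>\<gamma> p\<close> stands for the conditional probability that a leaf below
  \<open>p\<close> hits a given ball when only the randomness down to \<open>p\<close> is
  frozen.\<close>

locale leaf_tree =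
  fixes W :: "'a list set" and L :: nat and m :: "'a list \<Rightarrow> real" and \<gamma> :: "'a list \<Rightarrow> real"
  assumes finW: "finite W" and lenW: "\<And>w. w \<in> W \<Longrightarrow> length w = L"
    and m_nonneg: "\<And>w. 0 \<le> m w" and \<gamma>_pos: "\<And>p. 0 < \<gamma> p"
begin

definition leaves :: "'a list \<Rightarrow> 'a list set" where
  "leaves p = {w \<in> W. take (length p) w = p}"

definition mass :: "'a list \<Rightarrow> real" where
  "mass p = (\<Sum>w\<in>leaves p. m w)"

text \<open>The recursion mirrors the peeling of one factor from the moment of order
  \<open>\<kappa> + j + 1\<close>. The factor \<open>\<gamma> p\<close> is the hit probability of
  the peeled leaf \<open>w\<close>, and the inner sum runs over the nodes \<open>take l w\<close> at
  which the remaining leaves may separate from \<open>w\<close>. At \<open>j = 0\<close> a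
  fractional moment is bounded by twice the power of the mean.\<close>

fun moment_bound :: "real \<Rightarrow> nat \<Rightarrow> 'a list \<Rightarrow> real" where
  "moment_bound \<kappa> 0 p = 2 * (\<gamma> p * mass p) powr \<kappa>"
| "moment_bound \<kappa> (Suc j) p = (real L + 1) powr (\<kappa> + real j) * \<gamma> p *
     (\<Sum>w\<in>leaves p. m w * (\<Sum>l\<le>L. moment_bound \<kappa> j (take l w)))"

lemma finite_leaves: "finite (leaves p)" using finW by (simp add: leaves_def)

lemma mass_nonneg: "0 \<le> mass p" unfolding mass_def by (intro sum_nonneg m_nonneg)

lemma moment_bound_nonneg: "0 \<le> moment_bound \<kappa> j p"
  by (induction j arbitrary: p)
    (auto intro!: mult_nonneg_nonneg sum_nonneg m_nonneg less_imp_le[OF \<gamma>_pos])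

lemma leaves_take: "w \<in> W \<Longrightarrow> k \<le> L \<Longrightarrow> leaves (take k w) = {v \<in> W. take k v = take k w}"
  by (simp add: leaves_def lenW)

lemma sum_over_leaves:
  assumes k: "k \<le> L"
  shows "(\<Sum>w\<in>W. f w (take k w)) = (\<Sum>p\<in>take k ` W. \<Sum>w\<in>leaves p. f w p)"
proof -
  have "(\<Sum>w\<in>W. f w (take k w)) = (\<Sum>p\<in>take k ` W. \<Sum>w\<in>{v \<in> W. take k v = p}. f w (take k w))"
    by (rule sum.image_gen[OF finW])
  also have "\<dots> = (\<Sum>p\<in>take k ` W. \<Sum>w\<in>leaves p. f w p)"
  proof (rule sum.cong[OF refl])
    fix p assume "p \<in> take k ` W"
    then obtain u where u: "u \<in> W" "p = take k u" by auto
    have "leaves p = {v \<in> W. take k v = p}" using leaves_take[OF u(1) k] u(2) by simp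
    then show "(\<Sum>w\<in>{v \<in> W. take k v = p}. f w (take k w)) = (\<Sum>w\<in>leaves p. f w p)"
      by (auto intro: sum.cong)
  qed
  finally show ?thesis .
qed

text \<open>For cylinder masses and hit probabilities this is bounded by a partial sum of the series
  in \<open>d_minus\<close>, up to a constant and a power of the radius.\<close>

definition level_sum :: "real \<Rightarrow> real" where
  "level_sum \<theta> = (\<Sum>k\<le>L. \<Sum>w\<in>W. m w * (\<gamma> (take k w) * mass (take k w)) powr \<theta>)"

text \<open>Young's inequality separates the factor \<open>\<gamma> p * mass p\<close> from the conditional mean in the recursion,
  and Jensen's inequality removes the conditional mean; the exponents are chosen so that
  both resulting terms are homogeneous of degree \<open>\<theta>\<close>.\<close>

lemma sum_moment_bound_le:
  assumes \<kappa>: "\<kappa> > 0" "\<kappa> + real j \<le> \<theta>"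
  shows "(\<Sum>k\<le>L. \<Sum>w\<in>W. m w * moment_bound \<kappa> j (take k w) powr (\<theta> / (\<kappa> + real j)))
    \<le> loss L \<kappa> \<theta> j * level_sum \<theta>"
  using \<kappa>(2)
proof (induction j)
  case 0
  have "moment_bound \<kappa> 0 p powr (\<theta> / \<kappa>) = 2 powr (\<theta> / \<kappa>) * (\<gamma> p * mass p) powr \<theta>" for p
    using \<kappa>(1) by (simp add: powr_mult powr_powr)
  then show ?case
    by (simp add: level_sum_def sum_distrib_left mult.left_commute)
next
  case (Suc j)
  define N where "N = real L + 1"
  define \<kappa>j where "\<kappa>j = \<kappa> + real j"
  define r where "r = \<theta> / \<kappa>j"
  define t where "t = \<theta> / (\<kappa>j + 1)"
  define h where "h w = (\<Sum>l\<le>L. moment_bound \<kappa> j (take l w))" for w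
  define avg where "avg p = (\<Sum>w\<in>leaves p. m w * h w) / mass p" for p
  have N: "N \<ge> 1" by (simp add: N_def)
  have kj: "\<kappa>j > 0" "\<kappa>j + 1 \<le> \<theta>" using \<kappa>(1) Suc.prems by (auto simp: \<kappa>j_def)
  have t0: "t > 0" and r1: "r \<ge> 1" using kj by (auto simp: t_def r_def field_simps)
  have h0: "h w \<ge> 0" for w unfolding h_def by (intro sum_nonneg moment_bound_nonneg)
  have avg0: "avg p \<ge> 0" for p
    unfolding avg_def by (intro divide_nonneg_nonneg sum_nonneg mult_nonneg_nonneg m_nonneg h0 mass_nonneg)
  have step: "moment_bound \<kappa> (Suc j) p powr t \<le> N powr \<theta> * ((\<gamma> p * mass p) powr \<theta> + avg p powr r)" for p
  proof -
    define x where "x = \<gamma> p * mass p"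
    have x0: "x \<ge> 0" unfolding x_def using \<gamma>_pos[of p] mass_nonneg[of p] by simp
    have "moment_bound \<kappa> (Suc j) p = N powr \<kappa>j * (x * avg p)"
    \<comment> \<open>With mass 0 all leaf weights below \<open>p\<close> vanish and
      \<open>avg p\<close> is 0 by division by zero, so both sides are 0.\<close>
    proof (cases "mass p = 0")
      case True
      then have "m w = 0" if "w \<in> leaves p" for w
        using that m_nonneg finite_leaves unfolding mass_def by (subst (asm) sum_nonneg_eq_0_iff) auto
      then show ?thesis using True by (simp add: x_def)
    next
      case False
      then show ?thesis by (simp add: x_def avg_def h_def[symmetric] N_def \<kappa>j_def)
    qed
    also have "\<dots> powr t = N powr (\<kappa>j * t) * (x * avg p) powr t"
      using x0 avg0[of p] N by (simp add: powr_mult powr_powr)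
    also have "\<dots> \<le> N powr \<theta> * (x powr \<theta> + avg p powr r)"
    proof (intro mult_mono)
      have "\<kappa>j * t \<le> \<theta>" using kj by (simp add: t_def field_simps)
      then show "N powr (\<kappa>j * t) \<le> N powr \<theta>" using N by (intro powr_mono) auto
      have "(x * avg p) powr t \<le> (max (x powr (\<kappa>j + 1)) (avg p powr ((\<kappa>j + 1) / \<kappa>j))) powr t"
        using x0 avg0[of p] t0 kj by (intro powr_mono2 mult_le_powr_add_powr) auto
      also have "\<dots> \<le> (x powr (\<kappa>j + 1)) powr t + (avg p powr ((\<kappa>j + 1) / \<kappa>j)) powr t"
        by (auto simp: max_def)
      also have "\<dots> = x powr \<theta> + avg p powr r"
        using kj by (simp add: powr_powr t_def r_def)
      finally show "(x * avg p) powr t \<le> x powr \<theta> + avg p powr r" .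
    qed auto
    finally show ?thesis by (simp add: x_def)
  qed
  have jensen: "(\<Sum>w\<in>W. m w * avg (take k w) powr r) \<le> (\<Sum>w\<in>W. m w * h w powr r)" if k: "k \<le> L" for k
  proof -
    have "(\<Sum>w\<in>W. m w * avg (take k w) powr r) = (\<Sum>p\<in>take k ` W. mass p * avg p powr r)"
      by (subst sum_over_leaves[OF k, of "\<lambda>w p. m w * avg p powr r"])
        (simp add: mass_def sum_distrib_right)
    also have "\<dots> \<le> (\<Sum>p\<in>take k ` W. \<Sum>w\<in>leaves p. m w * h w powr r)"
      unfolding avg_def mass_def
      by (intro sum_mono weighted_mean_powr_le finite_leaves m_nonneg h0 r1)
    also have "\<dots> = (\<Sum>w\<in>W. m w * h w powr r)"
      by (rule sum_over_leaves[OF k, of "\<lambda>w p. m w * h w powr r", symmetric])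
    finally show ?thesis .
  qed
  have hr: "h w powr r \<le> N powr r * (\<Sum>l\<le>L. moment_bound \<kappa> j (take l w) powr r)" for w
    unfolding h_def using r1 by (intro sum_powr_le moment_bound_nonneg) (auto simp: N_def)
  define S where "S = (\<Sum>k\<le>L. \<Sum>w\<in>W. m w * moment_bound \<kappa> j (take k w) powr r)"
  have S: "S \<le> loss L \<kappa> \<theta> j * level_sum \<theta>"
    using Suc by (simp add: S_def r_def \<kappa>j_def)
  have "(\<Sum>w\<in>W. m w * h w powr r) \<le> (\<Sum>w\<in>W. m w * (N powr r * (\<Sum>l\<le>L. moment_bound \<kappa> j (take l w) powr r)))"
    by (intro sum_mono mult_left_mono hr m_nonneg)
  also have "\<dots> = N powr r * S"
    unfolding S_def by (subst sum.swap) (simp add: sum_distrib_left mult.left_commute)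
  finally have hS: "(\<Sum>w\<in>W. m w * h w powr r) \<le> N powr r * S" .
  have "(\<Sum>k\<le>L. \<Sum>w\<in>W. m w * moment_bound \<kappa> (Suc j) (take k w) powr t)
    \<le> (\<Sum>k\<le>L. \<Sum>w\<in>W. m w * (N powr \<theta> * ((\<gamma> (take k w) * mass (take k w)) powr \<theta> + avg (take k w) powr r)))"
    by (intro sum_mono mult_left_mono step m_nonneg)
  also have "\<dots> = N powr \<theta> * (level_sum \<theta> + (\<Sum>k\<le>L. \<Sum>w\<in>W. m w * avg (take k w) powr r))"
    by (simp add: level_sum_def sum_distrib_left sum.distrib distrib_left mult.left_commute)
  also have "\<dots> \<le> N powr \<theta> * (level_sum \<theta> + (\<Sum>k\<le>L. N powr r * S))"
    by (intro mult_left_mono add_left_mono sum_mono order_trans[OF jensen hS]) auto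
  also have "(\<Sum>k\<le>L. N powr r * S) = N powr (1 + r) * S"
    using N by (simp add: powr_add N_def)
  also have "N powr \<theta> * (level_sum \<theta> + N powr (1 + r) * S)
    \<le> N powr \<theta> * (level_sum \<theta> + N powr (1 + r) * (loss L \<kappa> \<theta> j * level_sum \<theta>))"
    by (intro mult_left_mono add_left_mono S) auto
  also have "\<dots> = loss L \<kappa> \<theta> (Suc j) * level_sum \<theta>"
    by (simp add: N_def r_def \<kappa>j_def algebra_simps)
  finally show ?case by (simp add: t_def \<kappa>j_def add.assoc[symmetric] add.commute[of 1])
qed

end

text \<open>The interface between geometry and moments. A point depends only on the coordinates
  along its own branch, and the hit probability is controlled when exactly the part of the branch
  down to level \<open>k\<close> is frozen. Uniformity in the centre \<open>c\<close> allows the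
  centre to be the point of another, already frozen word.\<close>

locale random_leaf_tree = leaf_tree W L m \<gamma>
  for W :: "'a list set" and L :: nat and m :: "'a list \<Rightarrow> real" and \<gamma> :: "'a list \<Rightarrow> real" +
  fixes I :: "'a list set" and P :: "'b measure"
    and X :: "'a list \<Rightarrow> ('a list \<Rightarrow> 'b) \<Rightarrow> 'c::euclidean_space" and \<rho> :: real
  assumes P: "prob_space P"
    and X_cong: "\<And>w \<omega> \<omega>'. w \<in> W \<Longrightarrow> (\<And>j. j \<le> L \<Longrightarrow> \<omega> (take j w) = \<omega>' (take j w)) \<Longrightarrow> X w \<omega> = X w \<omega>'"
    and X_measurable: "\<And>w. w \<in> W \<Longrightarrow> X w \<in> borel_measurable (PiM I (\<lambda>_. P))"
    and hit_bound: "\<And>F w k \<eta> c. w \<in> W \<Longrightarrow> k \<le> L \<Longrightarrow> \<eta> \<in> space (PiM I (\<lambda>_. P)) \<Longrightarrow>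
      (\<And>j. j \<le> k \<Longrightarrow> take j w \<in> F) \<Longrightarrow> (\<And>j. k < j \<Longrightarrow> j \<le> L \<Longrightarrow> take j w \<notin> F) \<Longrightarrow>
      (\<integral>\<^sup>+\<omega>. indicator (cball c \<rho>) (X w (mix F \<eta> \<omega>)) \<partial>PiM I (\<lambda>_. P)) \<le> ennreal (\<gamma> (take k w))"
begin

abbreviation "M \<equiv> PiM I (\<lambda>_. P)"

sublocale M: prob_space M by (rule prob_space_PiM) (rule P)

text \<open>Leaves below \<open>p\<close> whose coordinates beyond \<open>p\<close> are still random
  after freezing \<open>F\<close>; \<open>hit_bound\<close> applies to them at the node
  \<open>p\<close> once the branch down to \<open>p\<close> is frozen.\<close>

definition free :: "'a list set \<Rightarrow> 'a list \<Rightarrow> 'a list set" where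
  "free F p = {w \<in> leaves p. \<forall>j. length p < j \<longrightarrow> j \<le> L \<longrightarrow> take j w \<notin> F}"

definition hits :: "'a list set \<Rightarrow> 'a list \<Rightarrow> 'c \<Rightarrow> ('a list \<Rightarrow> 'b) \<Rightarrow> real" where
  "hits F p c \<omega> = (\<Sum>w\<in>free F p. m w * indicator (cball c \<rho>) (X w \<omega>))"

definition branch :: "'a list \<Rightarrow> 'a list set" where
  "branch w = (\<lambda>j. take j w) ` {..L}"

lemma free_subset: "free F p \<subseteq> W" "free F p \<subseteq> leaves p"
  by (auto simp: free_def leaves_def)

lemma free_take:
  assumes "v \<in> free F (take k w)" "w \<in> W" "k \<le> L" "j \<le> k"
  shows "take j v = take j w"
proof -
  have "length (take k w) = k" using assms lenW by simp
  then have "take k v = take k w" using assms(1) unfolding free_def leaves_def by auto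
  then have "take j (take k v) = take j (take k w)" by simp
  then show ?thesis using assms(4) by (simp add: min_absorb1)
qed

lemma finite_free: "finite (free F p)"
  using free_subset(1) finW by (rule finite_subset)

lemma hits_nonneg: "0 \<le> hits F p c \<omega>"
  unfolding hits_def by (intro sum_nonneg mult_nonneg_nonneg m_nonneg) auto

lemma measurable_hit:
  assumes "w \<in> W" "f \<in> measurable N M"
  shows "(\<lambda>\<omega>. indicator (cball c \<rho>) (X w (f \<omega>)) :: real) \<in> borel_measurable N"
    and "(\<lambda>\<omega>. indicator (cball c \<rho>) (X w (f \<omega>)) :: ennreal) \<in> borel_measurable N"
  by (rule measurable_compose[OF measurable_compose[OF assms(2) X_measurable[OF assms(1)]]
        borel_measurable_indicator], simp)+

lemma measurable_hits[measurable]: "hits F p c \<in> borel_measurable M"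
proof -
  have "(\<lambda>\<omega>. indicator (cball c \<rho>) (X w \<omega>) :: real) \<in> borel_measurable M" if "w \<in> free F p" for w
    using that free_subset by (intro measurable_hit) auto
  then show ?thesis unfolding hits_def[abs_def] by (intro borel_measurable_sum borel_measurable_times) auto
qed

text \<open>Free leaves \<open>v\<close> are sorted by the length \<open>l\<close> of their longest
  common prefix with \<open>w\<close>. Beyond that prefix \<open>v\<close> meets neither
  \<open>F\<close> nor the branch of \<open>w\<close>, so it stays free after this branch is frozen
  as well. The leaf \<open>w\<close> itself is counted at \<open>l = L\<close>.\<close>

lemma hits_le_sum_branch:
  assumes "w \<in> free F p"
  shows "hits F p c \<omega> \<le> (\<Sum>l\<le>L. hits (F \<union> branch w) (take l w) c \<omega>)"
proof -
  let ?g = "\<lambda>v. m v * indicator (cball c \<rho>) (X v \<omega>)"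
  have w: "w \<in> W" "take (length p) w = p" using assms by (auto simp: free_def leaves_def)
  have cover: "\<exists>l\<le>L. v \<in> free (F \<union> branch w) (take l w)" if v: "v \<in> free F p" for v
  proof -
    have v': "v \<in> W" "take (length p) v = p" "\<And>j. length p < j \<Longrightarrow> j \<le> L \<Longrightarrow> take j v \<notin> F"
      using v by (auto simp: free_def leaves_def)
    define l where "l = Max {l. l \<le> L \<and> take l v = take l w}"
    have fin: "finite {l. l \<le> L \<and> take l v = take l w}" by simp
    have "0 \<in> {l. l \<le> L \<and> take l v = take l w}" by simp
    then have l: "l \<le> L" "take l v = take l w"
      using Max_in[OF fin] unfolding l_def by blast+
    have l_max: "j \<le> l" if "j \<le> L" "take j v = take j w" for j
      unfolding l_def using that by (intro Max_ge fin) auto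
    have "length p \<le> L" using w lenW by (metis length_take min.cobounded1)
    then have pl: "length p \<le> l" using w v' by (intro l_max) auto
    have "take j v \<notin> F \<union> branch w" if j: "l < j" "j \<le> L" for j
    proof -
      have "take j v \<noteq> take i w" if "i \<le> L" for i
      proof
        assume eq: "take j v = take i w"
        then have "length (take j v) = length (take i w)" by simp
        then have "i = j" using that j lenW[OF w(1)] lenW[OF v'(1)] by simp
        then show False using eq l_max[of j] j by simp
      qed
      then show ?thesis using v'(3)[of j] j pl by (auto simp: branch_def)
    qed
    then have "v \<in> free (F \<union> branch w) (take l w)"
      using l v' w lenW by (auto simp: free_def leaves_def)
    then show ?thesis using l by blast
  qed
  have "hits F p c \<omega> \<le> (\<Sum>v\<in>free F p. \<Sum>l\<le>L. if v \<in> free (F \<union> branch w) (take l w) then ?g v else 0)"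
    unfolding hits_def
  proof (rule sum_mono)
    fix v assume "v \<in> free F p"
    then obtain l where l: "l \<le> L" "v \<in> free (F \<union> branch w) (take l w)" using cover by blast
    have "?g v = (if v \<in> free (F \<union> branch w) (take l w) then ?g v else 0)" using l by simp
    also have "\<dots> \<le> (\<Sum>l\<le>L. if v \<in> free (F \<union> branch w) (take l w) then ?g v else 0)"
      using l m_nonneg by (intro member_le_sum) auto
    finally show "?g v \<le> (\<Sum>l\<le>L. if v \<in> free (F \<union> branch w) (take l w) then ?g v else 0)" .
  qed
  also have "\<dots> = (\<Sum>l\<le>L. \<Sum>v\<in>free F p. if v \<in> free (F \<union> branch w) (take l w) then ?g v else 0)"
    by (rule sum.swap)
  also have "\<dots> \<le> (\<Sum>l\<le>L. hits (F \<union> branch w) (take l w) c \<omega>)"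
  proof (rule sum_mono)
    fix l
    have "(\<Sum>v\<in>free F p. if v \<in> free (F \<union> branch w) (take l w) then ?g v else 0)
      = (\<Sum>v\<in>free F p \<inter> free (F \<union> branch w) (take l w). ?g v)"
      by (rule sum.inter_restrict[OF finite_free, symmetric])
    also have "\<dots> \<le> (\<Sum>v\<in>free (F \<union> branch w) (take l w). ?g v)"
      using finite_free m_nonneg by (intro sum_mono2) auto
    finally show "(\<Sum>v\<in>free F p. if v \<in> free (F \<union> branch w) (take l w) then ?g v else 0)
      \<le> hits (F \<union> branch w) (take l w) c \<omega>" by (simp add: hits_def)
  qed
  finally show ?thesis .
qed

lemma hits_powr_le_sum_branch:
  assumes "w \<in> free F p" "\<kappa> > 0"
  shows "hits F p c \<omega> powr \<kappa> \<le> (real L + 1) powr \<kappa> * (\<Sum>l\<le>L. hits (F \<union> branch w) (take l w) c \<omega> powr \<kappa>)"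
proof -
  have "hits F p c \<omega> powr \<kappa> \<le> (\<Sum>l\<le>L. hits (F \<union> branch w) (take l w) c \<omega>) powr \<kappa>"
    using assms by (intro powr_mono2 hits_le_sum_branch hits_nonneg) auto
  also have "\<dots> \<le> (real L + 1) powr \<kappa> * (\<Sum>l\<le>L. hits (F \<union> branch w) (take l w) c \<omega> powr \<kappa>)"
    using assms(2) by (intro sum_powr_le hits_nonneg) auto
  finally show ?thesis .
qed

lemma X_mix_branch:
  assumes "w \<in> W" "branch w \<subseteq> F"
  shows "X w (mix F \<eta> \<omega>) = X w \<eta>"
  using assms by (intro X_cong) (auto simp: mix_def branch_def)

lemma nn_integral_hits_le:
  assumes w: "w \<in> W" "k \<le> L" and \<eta>: "\<eta> \<in> space M" and F: "\<And>j. j \<le> k \<Longrightarrow> take j w \<in> F"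
  shows "(\<integral>\<^sup>+\<omega>. ennreal (hits F (take k w) c (mix F \<eta> \<omega>)) \<partial>M) \<le> ennreal (\<gamma> (take k w) * mass (take k w))"
proof -
  let ?p = "take k w"
  have len: "length ?p = k" using w lenW by simp
  have pre: "take j v = take j w" if "v \<in> free F ?p" "j \<le> k" for v j
    using free_take[OF that(1) w that(2)] .
  have mm: "(\<lambda>\<omega>. mix F \<eta> \<omega>) \<in> measurable M M" using \<eta> by measurable
  have meas: "(\<lambda>\<omega>. indicator (cball c \<rho>) (X v (mix F \<eta> \<omega>)) :: ennreal) \<in> borel_measurable M"
    if "v \<in> free F ?p" for v
    using that free_subset by (intro measurable_hit mm) auto
  have "(\<integral>\<^sup>+\<omega>. ennreal (hits F ?p c (mix F \<eta> \<omega>)) \<partial>M)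
    = (\<integral>\<^sup>+\<omega>. (\<Sum>v\<in>free F ?p. ennreal (m v) * indicator (cball c \<rho>) (X v (mix F \<eta> \<omega>))) \<partial>M)"
    unfolding hits_def using m_nonneg
    by (intro nn_integral_cong) (simp add: sum_ennreal[symmetric] ennreal_mult ennreal_indicator[symmetric] del: sum_ennreal)
  also have "\<dots> = (\<Sum>v\<in>free F ?p. ennreal (m v) * (\<integral>\<^sup>+\<omega>. indicator (cball c \<rho>) (X v (mix F \<eta> \<omega>)) \<partial>M))"
    using meas by (subst nn_integral_sum) (auto intro!: sum.cong nn_integral_cmult)
  also have "\<dots> \<le> (\<Sum>v\<in>free F ?p. ennreal (m v) * ennreal (\<gamma> ?p))"
  proof (intro sum_mono mult_left_mono)
    fix v assume v: "v \<in> free F ?p"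
    have "(\<integral>\<^sup>+\<omega>. indicator (cball c \<rho>) (X v (mix F \<eta> \<omega>)) \<partial>M) \<le> ennreal (\<gamma> (take k v))"
    proof (rule hit_bound)
      show "v \<in> W" using v free_subset by blast
      show "take j v \<in> F" if "j \<le> k" for j using pre[OF v that] F[OF that] by simp
      show "take j v \<notin> F" if "k < j" "j \<le> L" for j using v that by (simp add: free_def len)
    qed (use w \<eta> in auto)
    then show "(\<integral>\<^sup>+\<omega>. indicator (cball c \<rho>) (X v (mix F \<eta> \<omega>)) \<partial>M) \<le> ennreal (\<gamma> ?p)"
      using pre[OF v, of k] by simp
  qed simp
  also have "\<dots> = ennreal ((\<Sum>v\<in>free F ?p. m v) * \<gamma> ?p)"
    using m_nonneg \<gamma>_pos[of ?p] by (simp add: ennreal_mult[symmetric] sum_distrib_right less_imp_le)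
  also have "\<dots> \<le> ennreal (\<gamma> ?p * mass ?p)"
    unfolding mass_def using m_nonneg \<gamma>_pos[of ?p] free_subset(2) finite_leaves
    by (intro ennreal_leI) (simp add: mult.commute, intro mult_left_mono sum_mono2, auto)
  finally show ?thesis .
qed

lemma nn_integral_hits_powr_le:
  assumes \<kappa>: "0 < \<kappa>" "\<kappa> \<le> 1"
    and w: "w \<in> W" "k \<le> L" and \<eta>: "\<eta> \<in> space M" and F: "\<And>j. j \<le> k \<Longrightarrow> take j w \<in> F"
  shows "(\<integral>\<^sup>+\<omega>. ennreal (hits F (take k w) c (mix F \<eta> \<omega>) powr (\<kappa> + real j)) \<partial>M)
    \<le> ennreal (moment_bound \<kappa> j (take k w))"
  using w \<eta> F
proof (induction j arbitrary: F w k \<eta>)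
  case 0
  let ?p = "take k w"
  define a where "a = \<gamma> ?p * mass ?p"
  let ?Z = "\<lambda>\<omega>. hits F ?p c (mix F \<eta> \<omega>)"
  have a0: "a \<ge> 0" unfolding a_def using \<gamma>_pos[of ?p] mass_nonneg by simp
  have [measurable]: "(\<lambda>\<omega>. mix F \<eta> \<omega>) \<in> measurable M M" using 0 by measurable
  have EZ: "(\<integral>\<^sup>+\<omega>. ennreal (?Z \<omega>) \<partial>M) \<le> ennreal a"
    unfolding a_def using 0 by (intro nn_integral_hits_le) auto
  show ?case
  proof (cases "a = 0")
    case True
    then have "(\<integral>\<^sup>+\<omega>. ennreal (?Z \<omega>) \<partial>M) = 0" using EZ by simp
    then have "AE \<omega> in M. ennreal (?Z \<omega>) = 0" by (subst (asm) nn_integral_0_iff_AE) auto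
    then have "AE \<omega> in M. ennreal (?Z \<omega> powr (\<kappa> + real 0)) = 0"
    proof eventually_elim
      case (elim \<omega>)
      then have "?Z \<omega> = 0"
        using hits_nonneg[of F ?p c "mix F \<eta> \<omega>"] by (simp add: ennreal_eq_0_iff)
      then show ?case by simp
    qed
    then have "(\<integral>\<^sup>+\<omega>. ennreal (?Z \<omega> powr (\<kappa> + real 0)) \<partial>M) = 0"
      by (subst nn_integral_0_iff_AE) auto
    then show ?thesis by simp
  next
    case False
    then have a: "a > 0" using a0 by simp
    \<comment> \<open>A linear majorant of the concave power, scaled to the bound \<open>a\<close>
      for the mean. Integration gives at most twice \<open>a powr \<kappa>\<close>, the origin of
      the factor 2 in \<open>moment_bound\<close>; the division by \<open>a\<close> is the reason
      for treating \<open>a = 0\<close> apart.\<close>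
    have pw: "z powr \<kappa> \<le> a powr \<kappa> * (1 + z / a)" if z: "z \<ge> 0" for z
    proof (cases "z \<le> a")
      case True
      then have "z powr \<kappa> \<le> a powr \<kappa> * 1" using z \<kappa> by (simp add: powr_mono2)
      also have "\<dots> \<le> a powr \<kappa> * (1 + z / a)" using z a by (intro mult_left_mono) auto
      finally show ?thesis .
    next
      case False
      then have "z / a \<ge> 1" using a by simp
      then have "(z / a) powr \<kappa> \<le> (z / a) powr 1" using \<kappa> by (intro powr_mono) auto
      then have "a powr \<kappa> * (z / a) powr \<kappa> \<le> a powr \<kappa> * (1 + z / a)"
        using z a by (intro mult_left_mono) auto
      then show ?thesis using z a by (simp add: powr_divide)
    qed
    have "(\<integral>\<^sup>+\<omega>. ennreal (?Z \<omega> powr (\<kappa> + real 0)) \<partial>M)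
      \<le> (\<integral>\<^sup>+\<omega>. ennreal (a powr \<kappa>) + ennreal (a powr \<kappa> / a) * ennreal (?Z \<omega>) \<partial>M)"
    proof (rule nn_integral_mono)
      fix \<omega>
      have "?Z \<omega> powr \<kappa> \<le> a powr \<kappa> + a powr \<kappa> / a * ?Z \<omega>"
        using pw[OF hits_nonneg] by (simp add: distrib_left)
      then show "ennreal (?Z \<omega> powr (\<kappa> + real 0)) \<le> ennreal (a powr \<kappa>) + ennreal (a powr \<kappa> / a) * ennreal (?Z \<omega>)"
        using a hits_nonneg by (simp add: ennreal_mult[symmetric] ennreal_plus[symmetric] ennreal_leI del: ennreal_plus)
    qed
    also have "\<dots> = ennreal (a powr \<kappa>) + ennreal (a powr \<kappa> / a) * (\<integral>\<^sup>+\<omega>. ennreal (?Z \<omega>) \<partial>M)"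
      by (subst nn_integral_add) (auto simp: nn_integral_cmult M.emeasure_space_1)
    also have "\<dots> \<le> ennreal (a powr \<kappa>) + ennreal (a powr \<kappa> / a) * ennreal a"
      by (intro add_left_mono mult_left_mono EZ) auto
    also have "\<dots> = ennreal (moment_bound \<kappa> 0 ?p)"
      using a by (simp add: ennreal_mult[symmetric] ennreal_plus[symmetric] a_def[symmetric] del: ennreal_plus)
    finally show ?thesis .
  qed
next
  case (Suc j)
  let ?p = "take k w"
  have len: "length ?p = k" using Suc.prems lenW by simp
  define \<kappa>j where "\<kappa>j = \<kappa> + real j"
  have kj: "\<kappa>j > 0" using \<kappa> by (simp add: \<kappa>j_def)
  define N where "N = real L + 1"
  let ?Z = "\<lambda>\<omega>. hits F ?p c (mix F \<eta> \<omega>)"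
  let ?h = "\<lambda>v \<omega>. indicator (cball c \<rho>) (X v \<omega>) :: real"
  let ?Y = "\<lambda>v l \<omega>. hits (F \<union> branch v) (take l v) c \<omega> powr \<kappa>j"
  note \<eta> = Suc.prems(3)
  have mm[measurable]: "(\<lambda>\<omega>. mix F \<eta> \<omega>) \<in> measurable M M" using \<eta> by measurable
  have hm[measurable]: "?h v \<in> borel_measurable M" if "v \<in> free F ?p" for v
    using that free_subset by (intro measurable_hit measurable_ident_sets) auto
  have hm': "(\<lambda>\<omega>. ?h v (mix F \<eta> \<omega>)) \<in> borel_measurable M" if "v \<in> free F ?p" for v
    using that free_subset by (intro measurable_hit mm) auto
  have summand: "(\<integral>\<^sup>+\<omega>. ennreal (?h v (mix F \<eta> \<omega>)) * ennreal (?Y v l (mix F \<eta> \<omega>)) \<partial>M)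
    \<le> ennreal (\<gamma> ?p) * ennreal (moment_bound \<kappa> j (take l v))" if v: "v \<in> free F ?p" and l: "l \<le> L" for v l
  proof -
    \<comment> \<open>The integral is nested: the outer one reveals the branch of \<open>v\<close>,
      the inner one resamples everything outside \<open>?F\<close>. The inner integral is bounded by
      the induction hypothesis at the node \<open>take l v\<close>, the outer one then by
      \<open>hit_bound\<close> for \<open>v\<close>.\<close>
    let ?F = "F \<union> branch v"
    have vW: "v \<in> W" using v free_subset by blast
    have pre: "take i v = take i w" if "i \<le> k" for i
      using free_take[OF v Suc.prems(1,2) that] .
    have "(\<integral>\<^sup>+\<omega>. ennreal (?h v (mix F \<eta> \<omega>)) * ennreal (?Y v l (mix F \<eta> \<omega>)) \<partial>M)
      = (\<integral>\<^sup>+\<omega>. \<integral>\<^sup>+\<omega>'. ennreal (?h v (mix ?F (mix F \<eta> \<omega>) \<omega>')) * ennreal (?Y v l (mix ?F (mix F \<eta> \<omega>) \<omega>')) \<partial>M \<partial>M)"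
    proof (rule nn_integral_PiM_mix_fixed[OF P _ \<eta>])
      show "(\<lambda>\<omega>. ennreal (?h v \<omega>) * ennreal (?Y v l \<omega>)) \<in> borel_measurable M"
        using hm[OF v] by measurable
    qed
    also have "\<dots> \<le> (\<integral>\<^sup>+\<omega>. ennreal (?h v (mix F \<eta> \<omega>)) * ennreal (moment_bound \<kappa> j (take l v)) \<partial>M)"
    proof (rule nn_integral_mono)
      fix \<omega> assume \<omega>: "\<omega> \<in> space M"
      let ?\<eta> = "mix F \<eta> \<omega>"
      have e: "?\<eta> \<in> space M" using \<eta> \<omega> by (rule mix_in_space)
      have [measurable]: "(\<lambda>\<omega>'. mix ?F ?\<eta> \<omega>') \<in> measurable M M" using e by measurable
      have "X v (mix ?F ?\<eta> \<omega>') = X v ?\<eta>" for \<omega>' by (rule X_mix_branch[OF vW]) simp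
      then have "(\<integral>\<^sup>+\<omega>'. ennreal (?h v (mix ?F ?\<eta> \<omega>')) * ennreal (?Y v l (mix ?F ?\<eta> \<omega>')) \<partial>M)
        = (\<integral>\<^sup>+\<omega>'. ennreal (?h v ?\<eta>) * ennreal (?Y v l (mix ?F ?\<eta> \<omega>')) \<partial>M)" by simp
      also have "\<dots> = ennreal (?h v ?\<eta>) * (\<integral>\<^sup>+\<omega>'. ennreal (?Y v l (mix ?F ?\<eta> \<omega>')) \<partial>M)"
        by (rule nn_integral_cmult) measurable
      also have "\<dots> \<le> ennreal (?h v ?\<eta>) * ennreal (moment_bound \<kappa> j (take l v))"
        unfolding \<kappa>j_def using vW l e
        by (intro mult_left_mono Suc.IH) (auto simp: branch_def)
      finally show "(\<integral>\<^sup>+\<omega>'. ennreal (?h v (mix ?F ?\<eta> \<omega>')) * ennreal (?Y v l (mix ?F ?\<eta> \<omega>')) \<partial>M)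
        \<le> ennreal (?h v ?\<eta>) * ennreal (moment_bound \<kappa> j (take l v))" .
    qed
    also have "\<dots> = (\<integral>\<^sup>+\<omega>. ennreal (?h v (mix F \<eta> \<omega>)) \<partial>M) * ennreal (moment_bound \<kappa> j (take l v))"
      by (intro nn_integral_multc measurable_compose[OF hm'[OF v] measurable_ennreal])
    also have "\<dots> \<le> ennreal (\<gamma> ?p) * ennreal (moment_bound \<kappa> j (take l v))"
    proof (rule mult_right_mono)
      have "(\<integral>\<^sup>+\<omega>. indicator (cball c \<rho>) (X v (mix F \<eta> \<omega>)) \<partial>M) \<le> ennreal (\<gamma> (take k v))"
      proof (rule hit_bound)
        show "take i v \<in> F" if "i \<le> k" for i using pre[OF that] Suc.prems(4)[OF that] by simp
        show "take i v \<notin> F" if "k < i" "i \<le> L" for i using v that by (simp add: free_def len)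
      qed (use Suc.prems vW \<eta> in auto)
      then show "(\<integral>\<^sup>+\<omega>. ennreal (?h v (mix F \<eta> \<omega>)) \<partial>M) \<le> ennreal (\<gamma> ?p)"
        using pre[of k] by (simp add: ennreal_indicator)
    qed simp
    finally show ?thesis .
  qed
  have pointwise: "hits F ?p c \<omega> powr (\<kappa>j + 1)
    \<le> (\<Sum>v\<in>free F ?p. \<Sum>l\<le>L. (N powr \<kappa>j * m v) * (?h v \<omega> * ?Y v l \<omega>))" for \<omega>
  proof -
    have "hits F ?p c \<omega> powr (\<kappa>j + 1) = hits F ?p c \<omega> * hits F ?p c \<omega> powr \<kappa>j"
      using hits_nonneg[of F ?p c \<omega>] by (cases "hits F ?p c \<omega> = 0") (simp_all add: powr_add)
    also have "\<dots> = (\<Sum>v\<in>free F ?p. m v * ?h v \<omega> * hits F ?p c \<omega> powr \<kappa>j)"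
      by (subst (1) hits_def) (simp add: sum_distrib_right)
    also have "\<dots> \<le> (\<Sum>v\<in>free F ?p. m v * ?h v \<omega> * (N powr \<kappa>j * (\<Sum>l\<le>L. ?Y v l \<omega>)))"
      unfolding N_def using kj m_nonneg
      by (intro sum_mono mult_left_mono hits_powr_le_sum_branch) auto
    also have "\<dots> = (\<Sum>v\<in>free F ?p. \<Sum>l\<le>L. (N powr \<kappa>j * m v) * (?h v \<omega> * ?Y v l \<omega>))"
      by (simp add: sum_distrib_left mult_ac)
    finally show ?thesis .
  qed
  have "(\<integral>\<^sup>+\<omega>. ennreal (?Z \<omega> powr (\<kappa> + real (Suc j))) \<partial>M)
    \<le> (\<integral>\<^sup>+\<omega>. (\<Sum>v\<in>free F ?p. \<Sum>l\<le>L. ennreal (N powr \<kappa>j * m v) *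
          (ennreal (?h v (mix F \<eta> \<omega>)) * ennreal (?Y v l (mix F \<eta> \<omega>)))) \<partial>M)"
  proof (rule nn_integral_mono)
    fix \<omega>
    have "?Z \<omega> powr (\<kappa> + real (Suc j)) = ?Z \<omega> powr (\<kappa>j + 1)" by (simp add: \<kappa>j_def add_ac)
    then have "ennreal (?Z \<omega> powr (\<kappa> + real (Suc j)))
      \<le> ennreal (\<Sum>v\<in>free F ?p. \<Sum>l\<le>L. (N powr \<kappa>j * m v) * (?h v (mix F \<eta> \<omega>) * ?Y v l (mix F \<eta> \<omega>)))"
      using pointwise[of "mix F \<eta> \<omega>"] by (simp only: ennreal_leI)
    also have "\<dots> = (\<Sum>v\<in>free F ?p. \<Sum>l\<le>L. ennreal (N powr \<kappa>j * m v) *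
          (ennreal (?h v (mix F \<eta> \<omega>)) * ennreal (?Y v l (mix F \<eta> \<omega>))))"
      using m_nonneg by (simp add: sum_nonneg flip: ennreal_mult)
    finally show "ennreal (?Z \<omega> powr (\<kappa> + real (Suc j))) \<le> \<dots>" .
  qed
  also have "\<dots> = (\<Sum>v\<in>free F ?p. \<Sum>l\<le>L. ennreal (N powr \<kappa>j * m v) *
          (\<integral>\<^sup>+\<omega>. ennreal (?h v (mix F \<eta> \<omega>)) * ennreal (?Y v l (mix F \<eta> \<omega>)) \<partial>M))"
  proof -
    have meas: "(\<lambda>\<omega>. ennreal (?h v (mix F \<eta> \<omega>)) * ennreal (?Y v l (mix F \<eta> \<omega>))) \<in> borel_measurable M"
      if "v \<in> free F ?p" for v l
      by (intro borel_measurable_times_ennreal measurable_compose[OF hm'[OF that] measurable_ennreal]) measurable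
    show ?thesis
      using meas by (subst nn_integral_sum, force)
        (intro sum.cong refl, subst nn_integral_sum, auto intro!: sum.cong nn_integral_cmult)
  qed
  also have "\<dots> \<le> (\<Sum>v\<in>free F ?p. \<Sum>l\<le>L. ennreal (N powr \<kappa>j * m v) *
      (ennreal (\<gamma> ?p) * ennreal (moment_bound \<kappa> j (take l v))))"
    using summand by (intro sum_mono mult_left_mono) auto
  also have "\<dots> = ennreal (\<Sum>v\<in>free F ?p. \<Sum>l\<le>L. (N powr \<kappa>j * m v) * (\<gamma> ?p * moment_bound \<kappa> j (take l v)))"
    using m_nonneg \<gamma>_pos[of ?p] moment_bound_nonneg
    by (simp add: sum_nonneg less_imp_le flip: ennreal_mult)
  also have "\<dots> \<le> ennreal (\<Sum>v\<in>leaves ?p. \<Sum>l\<le>L. (N powr \<kappa>j * m v) * (\<gamma> ?p * moment_bound \<kappa> j (take l v)))"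
    using m_nonneg \<gamma>_pos[of ?p] moment_bound_nonneg free_subset(2) finite_leaves
    by (intro ennreal_leI sum_mono2) (auto intro!: sum_nonneg mult_nonneg_nonneg simp: less_imp_le)
  also have "(\<Sum>v\<in>leaves ?p. \<Sum>l\<le>L. (N powr \<kappa>j * m v) * (\<gamma> ?p * moment_bound \<kappa> j (take l v)))
    = moment_bound \<kappa> (Suc j) ?p"
    by (simp add: N_def \<kappa>j_def sum_distrib_left mult_ac)
  finally show ?case .
qed

text \<open>Freezing the branch of \<open>u\<close> first makes the centre
  \<open>X u \<omega>\<close> constant. Before that nothing is frozen, so all of \<open>W\<close> is
  free at the root, and the moment bounds apply at each node of the branch.\<close>

lemma nn_integral_correlation_le:
  assumes \<kappa>: "0 < \<kappa>" "\<kappa> \<le> 1" and \<theta>: "\<theta> = \<kappa> + real j"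
  shows "(\<integral>\<^sup>+\<omega>. ennreal (\<Sum>u\<in>W. m u * (\<Sum>w\<in>W. m w * indicator (cball (X u \<omega>) \<rho>) (X w \<omega>)) powr \<theta>) \<partial>M)
    \<le> ennreal ((real L + 1) powr \<theta> * loss L \<kappa> \<theta> j * level_sum \<theta>)"
proof -
  define N where "N = real L + 1"
  have \<theta>0: "\<theta> > 0" using \<kappa> \<theta> by simp
  have free0: "free {} [] = W" by (auto simp: free_def leaves_def)
  have Xm[measurable]: "X u \<in> borel_measurable M" if "u \<in> W" for u using that by (rule X_measurable)
  let ?f = "\<lambda>u \<omega>. (\<Sum>w\<in>W. m w * indicator (cball (X u \<omega>) \<rho>) (X w \<omega>)) powr \<theta>"
  have ind: "(\<lambda>\<omega>. indicator (cball (X u \<omega>) \<rho>) (X w \<omega>) :: real) \<in> borel_measurable M" if "u \<in> W" "w \<in> W" for u w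
  proof -
    have [measurable]: "X u \<in> borel_measurable M" "X w \<in> borel_measurable M" using that Xm by auto
    have "(\<lambda>\<omega>. indicator (cball (X u \<omega>) \<rho>) (X w \<omega>) :: real) = (\<lambda>\<omega>. if dist (X u \<omega>) (X w \<omega>) \<le> \<rho> then 1 else 0)"
      by (auto simp: fun_eq_iff)
    then show ?thesis by simp
  qed
  have fm: "?f u \<in> borel_measurable M" if "u \<in> W" for u
    using ind[OF that] by measurable
  have f0: "?f u \<omega> \<ge> 0" for u \<omega> by simp
  have one: "(\<integral>\<^sup>+\<omega>. ennreal (?f u \<omega>) \<partial>M) \<le> ennreal (N powr \<theta> * (\<Sum>l\<le>L. moment_bound \<kappa> j (take l u)))"
    if u: "u \<in> W" for u
  proof -
    let ?B = "branch u"
    have "(\<integral>\<^sup>+\<omega>. ennreal (?f u \<omega>) \<partial>M) = (\<integral>\<^sup>+\<omega>. \<integral>\<^sup>+\<omega>'. ennreal (?f u (mix ?B \<omega> \<omega>')) \<partial>M \<partial>M)"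
      using fm[OF u] by (intro nn_integral_PiM_mix P) auto
    also have "\<dots> \<le> (\<integral>\<^sup>+\<omega>. ennreal (N powr \<theta> * (\<Sum>l\<le>L. moment_bound \<kappa> j (take l u))) \<partial>M)"
    proof (rule nn_integral_mono)
      fix \<omega> assume \<omega>: "\<omega> \<in> space M"
      have [measurable]: "(\<lambda>\<omega>'. mix ?B \<omega> \<omega>') \<in> measurable M M" using \<omega> by measurable
      let ?Y = "\<lambda>l \<omega>'. hits ?B (take l u) (X u \<omega>) (mix ?B \<omega> \<omega>') powr \<theta>"
      have "(\<integral>\<^sup>+\<omega>'. ennreal (?f u (mix ?B \<omega> \<omega>')) \<partial>M)
        \<le> (\<integral>\<^sup>+\<omega>'. ennreal (N powr \<theta>) * (\<Sum>l\<le>L. ennreal (?Y l \<omega>')) \<partial>M)"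
      proof (rule nn_integral_mono)
        fix \<omega>'
        have "?f u (mix ?B \<omega> \<omega>') = hits {} [] (X u \<omega>) (mix ?B \<omega> \<omega>') powr \<theta>"
          using X_mix_branch[OF u, of ?B \<omega> \<omega>'] by (simp add: hits_def free0)
        also have "\<dots> \<le> N powr \<theta> * (\<Sum>l\<le>L. ?Y l \<omega>')"
          unfolding N_def using hits_powr_le_sum_branch[of u "{}" "[]" \<theta>] u free0 \<theta>0 by simp
        finally show "ennreal (?f u (mix ?B \<omega> \<omega>')) \<le> ennreal (N powr \<theta>) * (\<Sum>l\<le>L. ennreal (?Y l \<omega>'))"
          by (simp add: sum_nonneg ennreal_leI flip: ennreal_mult)
      qed
      also have "\<dots> = ennreal (N powr \<theta>) * (\<Sum>l\<le>L. \<integral>\<^sup>+\<omega>'. ennreal (?Y l \<omega>') \<partial>M)"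
        by (subst nn_integral_cmult) (auto simp: nn_integral_sum simp del: sum_ennreal)
      also have "\<dots> \<le> ennreal (N powr \<theta>) * (\<Sum>l\<le>L. ennreal (moment_bound \<kappa> j (take l u)))"
        unfolding \<theta> using u \<omega> \<kappa>
        by (intro mult_left_mono sum_mono nn_integral_hits_powr_le) (auto simp: branch_def)
      also have "\<dots> = ennreal (N powr \<theta> * (\<Sum>l\<le>L. moment_bound \<kappa> j (take l u)))"
        by (simp add: moment_bound_nonneg sum_nonneg flip: ennreal_mult)
      finally show "(\<integral>\<^sup>+\<omega>'. ennreal (?f u (mix ?B \<omega> \<omega>')) \<partial>M) \<le> \<dots>" .
    qed
    also have "\<dots> = ennreal (N powr \<theta> * (\<Sum>l\<le>L. moment_bound \<kappa> j (take l u)))"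
      by (simp add: M.emeasure_space_1)
    finally show ?thesis .
  qed
  have "(\<integral>\<^sup>+\<omega>. ennreal (\<Sum>u\<in>W. m u * ?f u \<omega>) \<partial>M) = (\<integral>\<^sup>+\<omega>. (\<Sum>u\<in>W. ennreal (m u) * ennreal (?f u \<omega>)) \<partial>M)"
    using m_nonneg by (intro nn_integral_cong) (simp flip: ennreal_mult)
  also have "\<dots> = (\<Sum>u\<in>W. ennreal (m u) * (\<integral>\<^sup>+\<omega>. ennreal (?f u \<omega>) \<partial>M))"
    using fm by (subst nn_integral_sum) (auto intro!: sum.cong nn_integral_cmult)
  also have "\<dots> \<le> (\<Sum>u\<in>W. ennreal (m u) * ennreal (N powr \<theta> * (\<Sum>l\<le>L. moment_bound \<kappa> j (take l u))))"
    by (intro sum_mono mult_left_mono one) auto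
  also have "\<dots> = ennreal (\<Sum>u\<in>W. m u * (N powr \<theta> * (\<Sum>l\<le>L. moment_bound \<kappa> j (take l u))))"
    using m_nonneg moment_bound_nonneg by (simp add: sum_nonneg flip: ennreal_mult)
  \<comment> \<open>The inserted exponent \<open>\<theta> / (\<kappa> + real j)\<close> equals 1; it
    gives the sum the shape of \<open>sum_moment_bound_le\<close>.\<close>
  also have "\<dots> = ennreal (N powr \<theta> * (\<Sum>l\<le>L. \<Sum>u\<in>W. m u * moment_bound \<kappa> j (take l u) powr (\<theta> / (\<kappa> + real j))))"
    using \<theta> \<theta>0 moment_bound_nonneg
    by (subst sum.swap) (simp add: sum_distrib_left mult.left_commute)
  also have "\<dots> \<le> ennreal (N powr \<theta> * (loss L \<kappa> \<theta> j * level_sum \<theta>))"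
    using \<kappa> \<theta> by (intro ennreal_leI mult_left_mono sum_moment_bound_le) auto
  finally show ?thesis by (simp add: N_def mult.assoc)
qed

end

section \<open>Random affine systems\<close>

lemma words_0: "words n 0 = {[]}"
  by (auto simp: words_def)

lemma wordsD:
  assumes "u \<in> words n k"
  shows "length u = k" "\<And>j. 1 \<le> j \<Longrightarrow> j \<le> k \<Longrightarrow> u ! (j - 1) \<in> {1..n j}"
  using assms by (auto simp: words_def)

lemma take_words: "u \<in> words n l \<Longrightarrow> k \<le> l \<Longrightarrow> take k u \<in> words n k"
  by (auto simp: words_def)

lemma words_fin_words: "u \<in> words n k \<Longrightarrow> u \<in> fin_words n"
  by (auto simp: fin_words_def)

lemma take_fin_words:
  assumes "u \<in> words n l"
  shows "take k u \<in> fin_words n"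
proof (cases "k \<le> l")
  case True
  from words_fin_words[OF take_words[OF assms this]] show ?thesis .
next
  case False
  with assms show ?thesis using wordsD(1)[OF assms] by (simp add: words_fin_words)
qed

lemma finite_words: "finite (words n k)"
proof -
  define N where "N = (\<Sum>j\<in>{1..k}. n j)"
  have "words n k \<subseteq> {xs. set xs \<subseteq> {..N} \<and> length xs = k}"
  proof
    fix u assume u: "u \<in> words n k"
    have "u ! i \<le> N" if "i < k" for i
    proof -
      have "u ! i \<le> n (Suc i)" using wordsD(2)[OF u, of "Suc i"] that by auto
      also have "\<dots> \<le> N" unfolding N_def using that by (intro member_le_sum) auto
      finally show ?thesis .
    qed
    then show "u \<in> {xs. set xs \<subseteq> {..N} \<and> length xs = k}"
      using wordsD(1)[OF u] by (auto simp: in_set_conv_nth)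
  qed
  then show ?thesis using finite_lists_length_eq[of "{..N}" k] by (rule finite_subset) simp
qed

lemma countable_fin_words: "countable (fin_words n)"
  unfolding fin_words_def by (rule countable_UN) (auto intro: countable_finite finite_words)

text \<open>The range of levels \<open>js\<close> is a parameter so that the sum along a word can be
  cut at an arbitrary level.\<close>

definition path_nodes :: "(nat \<Rightarrow> nat \<Rightarrow> real^'d^'d) \<Rightarrow> nat list \<Rightarrow> nat list \<Rightarrow>
    (nat list \<times> (real^'d \<Rightarrow> real^'d)) list" where
  "path_nodes T u js = map (\<lambda>j. (take j u, (*v) (T j (u ! (j - 1))))) js"

definition path_matrix :: "(nat \<Rightarrow> nat \<Rightarrow> real^'d^'d) \<Rightarrow> nat list \<Rightarrow> nat list \<Rightarrow> real^'d^'d" where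
  "path_matrix T u js = foldr (**) (map (\<lambda>j. T j (u ! (j - 1))) js) (mat 1)"

text \<open>The image of the origin under the composed maps, used as a reference point of the basic
  set whether or not the origin lies in \<open>J\<close>.\<close>

definition base_point :: "(nat \<Rightarrow> nat \<Rightarrow> real^'d^'d) \<Rightarrow> nat list \<Rightarrow> (nat list \<Rightarrow> real^'d) \<Rightarrow> real^'d" where
  "base_point T u \<omega> = nested_sum (path_nodes T u [1..<Suc (length u)]) \<omega>"

lemma word_matrix_eq: "word_matrix T u = path_matrix T u [1..<Suc (length u)]"
  by (simp add: word_matrix_def path_matrix_def)

lemma foldr_level_map:
  "foldr (\<circ>) (map (level_map T \<omega> u) js) id x
    = nested_sum (path_nodes T u js) \<omega> + path_matrix T u js *v x"
  by (induction js)
    (auto simp: path_nodes_def path_matrix_def level_map_def matrix_vector_right_distrib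
      matrix_vector_mul_assoc add_ac)

lemma nested_sum_path_append:
  "nested_sum (path_nodes T u (js @ js')) \<omega>
    = nested_sum (path_nodes T u js) \<omega> + path_matrix T u js *v nested_sum (path_nodes T u js') \<omega>"
  by (induction js)
    (auto simp: path_nodes_def path_matrix_def matrix_vector_right_distrib
      matrix_vector_mul_assoc add_ac)

lemma basic_set_eq: "basic_set T J \<omega> u = (\<lambda>x. base_point T u \<omega> + word_matrix T u *v x) ` J"
  unfolding basic_set_def base_point_def word_matrix_eq
  by (rule image_cong[OF refl foldr_level_map])

lemma path_take:
  assumes "set js \<subseteq> {1..k}" "k \<le> length u"
  shows "path_nodes T (take k u) js = path_nodes T u js" "path_matrix T (take k u) js = path_matrix T u js"
proof -
  have *: "take j (take k u) = take j u" "take k u ! (j - 1) = u ! (j - 1)" if "j \<in> set js" for j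
    using assms that by (auto simp: min_absorb1 subset_iff)
  show "path_nodes T (take k u) js = path_nodes T u js" "path_matrix T (take k u) js = path_matrix T u js"
    unfolding path_nodes_def path_matrix_def using * by (auto intro!: arg_cong[where f = "\<lambda>xs. foldr (**) xs (mat 1)"])
qed

text \<open>With the translations along \<open>take k u\<close> frozen, the randomness left is the
  image, under the fixed matrix of the prefix, of a nested sum over deeper nodes. This is the form
  in which smoothing meets the singular value function.\<close>

lemma base_point_split:
  assumes "k \<le> length u"
  shows "base_point T u \<omega> = base_point T (take k u) \<omega>
    + word_matrix T (take k u) *v nested_sum (path_nodes T u [Suc k..<Suc (length u)]) \<omega>"
proof -
  have "[1..<Suc (length u)] = [1..<Suc k] @ [Suc k..<Suc (length u)]"
    using assms by (metis One_nat_def Suc_le_mono le_add1 plus_1_eq_Suc upt_add_eq_append le_Suc_ex add_Suc)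
  moreover have "path_nodes T (take k u) [1..<Suc k] = path_nodes T u [1..<Suc k]"
    "path_matrix T (take k u) [1..<Suc k] = path_matrix T u [1..<Suc k]"
    using assms by (auto intro!: path_take)
  ultimately show ?thesis
    using assms unfolding base_point_def word_matrix_eq
    by (simp add: nested_sum_path_append min_absorb2 del: upt_Suc)
qed

lemma fst_path_nodes: "fst ` set (path_nodes T u js) = (\<lambda>j. take j u) ` set js"
  by (auto simp: path_nodes_def image_image)

lemma snd_path_nodes: "snd ` set (path_nodes T u js) = (\<lambda>j. (*v) (T j (u ! (j - 1)))) ` set js"
  by (auto simp: path_nodes_def image_image)

lemma base_point_cong:
  "(\<And>j. 1 \<le> j \<Longrightarrow> j \<le> length u \<Longrightarrow> \<omega> (take j u) = \<omega>' (take j u)) \<Longrightarrow> base_point T u \<omega> = base_point T u \<omega>'"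
  unfolding base_point_def by (intro nested_sum_cong) (auto simp: fst_path_nodes)

text \<open>The constants \<open>a\<close> and \<open>b\<close> will be \<alpha>_+ and \<alpha>_-.
  Two-sided norm bounds, unlike individual singular values, pass to products by a simple
  induction.\<close>

locale affine_system =
  fixes n :: "nat \<Rightarrow> nat" and T :: "nat \<Rightarrow> nat \<Rightarrow> real^'d^'d" and a b :: real
  assumes a: "0 < a" "a < 1" and b: "0 < b"
    and T_upper: "\<And>k i x. k \<ge> 1 \<Longrightarrow> i \<in> {1..n k} \<Longrightarrow> norm (T k i *v x) \<le> a * norm x"
    and T_lower: "\<And>k i x. k \<ge> 1 \<Longrightarrow> i \<in> {1..n k} \<Longrightarrow> b * norm x \<le> norm (T k i *v x)"
begin

lemma path_matrix_bounds:
  assumes u: "u \<in> words n L" and js: "set js \<subseteq> {1..L}"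
  shows "norm (path_matrix T u js *v x) \<le> a ^ length js * norm x"
    and "b ^ length js * norm x \<le> norm (path_matrix T u js *v x)"
proof -
  have "norm (path_matrix T u js *v x) \<le> a ^ length js * norm x \<and>
    b ^ length js * norm x \<le> norm (path_matrix T u js *v x)"
    using js
  proof (induction js)
    case Nil
    then show ?case by (simp add: path_matrix_def)
  next
    case (Cons j js)
    let ?A = "T j (u ! (j - 1))" and ?y = "path_matrix T u js *v x"
    have j: "j \<ge> 1" "u ! (j - 1) \<in> {1..n j}" using Cons.prems wordsD(2)[OF u, of j] by auto
    have eq: "path_matrix T u (j # js) *v x = ?A *v ?y"
      by (simp add: path_matrix_def matrix_vector_mul_assoc)
    have "norm (?A *v ?y) \<le> a * norm ?y" by (rule T_upper[OF j])
    also have "\<dots> \<le> a * (a ^ length js * norm x)" using Cons a by (intro mult_left_mono) auto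
    finally have 1: "norm (?A *v ?y) \<le> a ^ length (j # js) * norm x" by (simp add: mult.assoc)
    have "b ^ length (j # js) * norm x = b * (b ^ length js * norm x)" by (simp add: mult.assoc)
    also have "\<dots> \<le> b * norm ?y" using Cons b by (intro mult_left_mono) auto
    also have "\<dots> \<le> norm (?A *v ?y)" by (rule T_lower[OF j])
    finally show ?case using 1 eq by simp
  qed
  then show "norm (path_matrix T u js *v x) \<le> a ^ length js * norm x"
    and "b ^ length js * norm x \<le> norm (path_matrix T u js *v x)" by auto
qed

lemma word_matrix_bounds:
  assumes u: "u \<in> words n k"
  shows "norm (word_matrix T u *v x) \<le> a ^ k * norm x" "b ^ k * norm x \<le> norm (word_matrix T u *v x)"
proof -
  have js: "set [1..<Suc k] \<subseteq> {1..k}" by auto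
  show "norm (word_matrix T u *v x) \<le> a ^ k * norm x" "b ^ k * norm x \<le> norm (word_matrix T u *v x)"
    using path_matrix_bounds[OF u js, of x] wordsD(1)[OF u] by (simp_all add: word_matrix_eq del: upt_Suc)
qed

lemma word_matrix_sing_values:
  assumes u: "u \<in> words n k"
  shows "0 < sing_value (word_matrix T u) CARD('d)" "sing_value (word_matrix T u) 1 \<le> a ^ k"
    "i \<in> {1..CARD('d)} \<Longrightarrow> sing_value (word_matrix T u) i \<le> a ^ k"
    "i \<in> {1..CARD('d)} \<Longrightarrow> 0 < sing_value (word_matrix T u) i"
proof -
  have d: "1 \<in> {1..CARD('d)}" "CARD('d) \<in> {1..CARD('d)}" by (auto simp: Suc_le_eq)
  have "b ^ k \<le> sing_value (word_matrix T u) CARD('d)"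
    using word_matrix_bounds(2)[OF u] by (intro sing_value_ge[OF d(2)])
  moreover have "b ^ k > 0" using b by simp
  ultimately show pos: "0 < sing_value (word_matrix T u) CARD('d)" by linarith
  show "i \<in> {1..CARD('d)} \<Longrightarrow> 0 < sing_value (word_matrix T u) i" by (rule sing_value_pos[OF pos])
  show "i \<in> {1..CARD('d)} \<Longrightarrow> sing_value (word_matrix T u) i \<le> a ^ k"
    using word_matrix_bounds(1)[OF u] by (intro sing_value_le)
  show "sing_value (word_matrix T u) 1 \<le> a ^ k"
    using word_matrix_bounds(1)[OF u] by (intro sing_value_le[OF d(1)])
qed

lemma norm_nested_sum_le:
  assumes u: "u \<in> words n L" and js: "set js \<subseteq> {1..L}" and R: "0 \<le> R"
    and \<omega>: "\<And>j. j \<in> set js \<Longrightarrow> norm (\<omega> (take j u)) \<le> R"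
  shows "norm (nested_sum (path_nodes T u js) \<omega>) \<le> R / (1 - a)"
  using js \<omega>
proof (induction js)
  case Nil
  then show ?case using R a by (simp add: path_nodes_def)
next
  case (Cons j js)
  let ?A = "T j (u ! (j - 1))" and ?y = "nested_sum (path_nodes T u js) \<omega>"
  have j: "j \<ge> 1" "u ! (j - 1) \<in> {1..n j}" using Cons.prems wordsD(2)[OF u, of j] by auto
  have "norm (nested_sum (path_nodes T u (j # js)) \<omega>) \<le> norm (\<omega> (take j u)) + norm (?A *v ?y)"
    by (simp add: path_nodes_def norm_triangle_ineq)
  also have "\<dots> \<le> R + a * norm ?y" using Cons.prems j by (intro add_mono T_upper) auto
  also have "\<dots> \<le> R + a * (R / (1 - a))" using Cons a by (intro add_left_mono mult_left_mono) auto
  also have "\<dots> = R / (1 - a)" using a by (simp add: field_simps)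
  finally show ?case .
qed

end

locale random_affine_system = affine_system n T a b
  for n :: "nat \<Rightarrow> nat" and T :: "nat \<Rightarrow> nat \<Rightarrow> real^'d^'d" and a b :: real +
  fixes P :: "(real^'d) measure" and R :: real
  assumes P: "prob_space P" "sets P = sets borel" "absolutely_continuous lborel P"
    and R: "0 \<le> R" "AE x in P. norm x \<le> R"
begin

abbreviation "M \<equiv> PiM (fin_words n) (\<lambda>_. P)"

sublocale M: prob_space M by (rule prob_space_PiM) (rule P)

lemma AE_norm_le: "AE \<omega> in M. \<forall>u\<in>fin_words n. norm (\<omega> u) \<le> R"
  using P R by (subst AE_ball_countable[OF countable_fin_words]) (auto intro!: AE_PiM_component)

lemma measurable_path_sum:
  assumes u: "u \<in> words n L" and js: "set js \<subseteq> {1..L}"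
  shows "nested_sum (path_nodes T u js) \<in> borel_measurable M"
  using take_fin_words[OF u] by (intro measurable_nested_sum P) (auto simp: fst_path_nodes snd_path_nodes)

lemma measurable_base_point:
  assumes u: "u \<in> words n L"
  shows "base_point T u \<in> borel_measurable M"
  unfolding base_point_def[abs_def] using wordsD(1)[OF u]
  by (intro measurable_path_sum[OF u, of "[1..<Suc (length u)]", unfolded eta_contract_eq]) auto

lemma distinct_path_nodes:
  assumes u: "u \<in> words n L" and js: "set js \<subseteq> {1..L}" "distinct js"
  shows "distinct (map fst (path_nodes T u js))"
proof -
  have "inj_on (\<lambda>j. take j u) (set js)"
  proof (rule inj_onI)
    fix i j assume "i \<in> set js" "j \<in> set js" "take i u = take j u"
    then show "i = j" using js wordsD(1)[OF u] by (metis atLeastAtMost_iff length_take min.absorb2 subsetD)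
  qed
  then show ?thesis using js by (simp add: path_nodes_def distinct_map o_def)
qed

text \<open>All translations have the same law, so one truncation of one density yields a
  \<open>K\<close> that is uniform in the word, the two levels and the Borel set.\<close>

lemma path_sum_density:
  assumes \<delta>: "\<delta> > 0" "2 * \<delta> * (1 / b) ^ CARD('d) \<le> 1"
  obtains K :: real where "K > 0"
    "\<And>u L k A. u \<in> words n L \<Longrightarrow> k \<le> L \<Longrightarrow> A \<in> sets borel \<Longrightarrow>
       emeasure M {\<omega> \<in> space M. nested_sum (path_nodes T u [Suc k..<Suc L]) \<omega> \<in> A}
         \<le> ennreal (2 * K) * emeasure lborel A + ennreal (\<delta> ^ (L - k))"
proof -
  obtain K h1 h2 where K: "K > 0" and h: "h1 \<in> borel_measurable borel" "h2 \<in> borel_measurable borel"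
    "P = density lborel (\<lambda>x. h1 x + h2 x)" "\<And>x. h1 x \<le> ennreal K" "(\<integral>\<^sup>+x. h2 x \<partial>lborel) \<le> ennreal \<delta>"
    using absolutely_continuous_truncation[OF P \<delta>(1)] by blast
  show ?thesis
  proof (rule that[OF K])
    fix u L k A assume u: "u \<in> words n L" and k: "k \<le> L" and A: "(A :: (real^'d) set) \<in> sets borel"
    have js: "set [Suc k..<Suc L] \<subseteq> {1..L}" by auto
    have "emeasure M {\<omega> \<in> space M. nested_sum (path_nodes T u [Suc k..<Suc L]) \<omega> \<in> A}
      \<le> ennreal (2 * K) * emeasure lborel A + ennreal (\<delta> ^ length (path_nodes T u [Suc k..<Suc L]))"
    proof (rule emeasure_nested_sum_le[OF P(1) h(3,1,2,4,5) K \<delta>(1) _ b])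
      show "2 * \<delta> * (1 / b) ^ DIM(real^'d) \<le> 1" using \<delta> by simp
      show "distinct (map fst (path_nodes T u [Suc k..<Suc L]))"
        by (rule distinct_path_nodes[OF u js]) simp
      show "fst ` set (path_nodes T u [Suc k..<Suc L]) \<subseteq> fin_words n"
        using take_fin_words[OF u] by (auto simp: fst_path_nodes)
      fix S assume "S \<in> snd ` set (path_nodes T u [Suc k..<Suc L])"
      then obtain j where j: "j \<in> set [Suc k..<Suc L]" "S = (*v) (T j (u ! (j - 1)))"
        by (auto simp: snd_path_nodes simp del: upt_Suc)
      then show "linear S \<and> (\<forall>x. b * norm x \<le> norm (S x))"
        using wordsD(2)[OF u, of j] by (auto intro!: T_lower)
    qed (rule A)
    then show "emeasure M {\<omega> \<in> space M. nested_sum (path_nodes T u [Suc k..<Suc L]) \<omega> \<in> A}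
      \<le> ennreal (2 * K) * emeasure lborel A + ennreal (\<delta> ^ (L - k))"
      by (simp add: path_nodes_def del: upt_Suc)
  qed
qed

text \<open>The unsmoothed remainder \<open>\<delta> ^ (L - k)\<close> is harmless: for \<open>k \<ge> K\<close> the bound is trivial,
  and for \<open>k < K\<close> at least \<open>K\<close> independent translations are available below level \<open>k\<close>.\<close>

lemma hit_probability_le:
  assumes s: "0 < s" "s \<le> real CARD('d)"
  obtains C where "C \<ge> 1"
    "\<And>w K k F \<eta> c \<rho>. w \<in> words n (2 * K) \<Longrightarrow> k \<le> 2 * K \<Longrightarrow> a ^ K \<le> \<rho> \<Longrightarrow> \<eta> \<in> space M \<Longrightarrow>
      (\<And>j. j \<le> k \<Longrightarrow> take j w \<in> F) \<Longrightarrow> (\<And>j. k < j \<Longrightarrow> j \<le> 2 * K \<Longrightarrow> take j w \<notin> F) \<Longrightarrow>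
      (\<integral>\<^sup>+\<omega>. indicator (cball c \<rho>) (base_point T w (mix F \<eta> \<omega>)) \<partial>M)
        \<le> ennreal (C * (\<rho> powr s / sing_value_fun s (word_matrix T (take k w))))"
proof -
  \<comment> \<open>The value \<open>b ^ CARD('d) / 2\<close> meets the condition of the smoothing
    recursion. The value \<open>a ^ CARD('d)\<close> gives
    \<open>\<delta> ^ K \<le> (a ^ K) powr s\<close> for \<open>s \<le> d\<close>, which is at most
    \<open>\<rho> powr s\<close>.\<close>
  define \<delta> where "\<delta> = min (a ^ CARD('d)) (b ^ CARD('d) / 2)"
  have \<delta>0: "\<delta> > 0" using a b by (simp add: \<delta>_def)
  have "2 * \<delta> * (1 / b) ^ CARD('d) \<le> 2 * (b ^ CARD('d) / 2) * (1 / b) ^ CARD('d)"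
    using b by (intro mult_right_mono mult_left_mono) (auto simp: \<delta>_def)
  then have \<delta>1: "2 * \<delta> * (1 / b) ^ CARD('d) \<le> 1" using b by (simp add: power_divide)
  have \<delta>a: "\<delta> \<le> a ^ CARD('d)" by (simp add: \<delta>_def)
  obtain H where H: "H > 0" and dens: "\<And>u L k A. u \<in> words n L \<Longrightarrow> k \<le> L \<Longrightarrow> A \<in> sets borel \<Longrightarrow>
       emeasure M {\<omega> \<in> space M. nested_sum (path_nodes T u [Suc k..<Suc L]) \<omega> \<in> A}
         \<le> ennreal (2 * H) * emeasure lborel A + ennreal (\<delta> ^ (L - k))"
    using path_sum_density[OF \<delta>0 \<delta>1] by blast
  define R' where "R' = max 1 (R / (1 - a))"
  define C where "C = 2 * H * (2 * R') ^ CARD('d) + 1"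
  have C1: "C \<ge> 1" using H by (simp add: C_def R'_def)
  show ?thesis
  proof (rule that[OF C1])
    fix w K k F \<eta> c \<rho>
    assume w: "w \<in> words n (2 * K)" and k: "k \<le> 2 * K" and \<rho>: "a ^ K \<le> \<rho>" and \<eta>: "\<eta> \<in> space M"
      and F: "\<And>j. j \<le> k \<Longrightarrow> take j w \<in> F" and nF: "\<And>j. k < j \<Longrightarrow> j \<le> 2 * K \<Longrightarrow> take j w \<notin> F"
    let ?A = "word_matrix T (take k w)"
    let ?\<psi> = "sing_value_fun s ?A"
    let ?I = "\<integral>\<^sup>+\<omega>. indicator (cball c \<rho>) (base_point T w (mix F \<eta> \<omega>)) \<partial>M"
    have p: "take k w \<in> words n k" by (rule take_words[OF w k])
    note sv = word_matrix_sing_values[OF p]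
    have aK: "a ^ K > 0" using a by simp
    then have \<rho>0: "\<rho> > 0" using \<rho> by linarith
    have \<psi>0: "?\<psi> > 0" by (rule sing_value_fun_pos[OF sv(1) s(1)])
    have \<psi>a: "?\<psi> \<le> (a ^ k) powr s" by (rule sing_value_fun_le_powr[OF sv(1,2) s])
    show "?I \<le> ennreal (C * (\<rho> powr s / ?\<psi>))"
    proof (cases "K \<le> k")
      case True
      have "?\<psi> \<le> (a ^ k) powr s" by (rule \<psi>a)
      also have "\<dots> \<le> (a ^ K) powr s" using True a s by (intro powr_mono2 power_decreasing) auto
      also have "\<dots> \<le> \<rho> powr s" using \<rho> aK s by (intro powr_mono2) auto
      finally have "1 * 1 \<le> C * (\<rho> powr s / ?\<psi>)" using \<psi>0 C1 by (intro mult_mono) auto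
      have "?I \<le> (\<integral>\<^sup>+\<omega>. 1 \<partial>M)" by (intro nn_integral_mono) (auto simp: indicator_def)
      also have "\<dots> = ennreal 1" by (simp add: M.emeasure_space_1)
      also have "\<dots> \<le> ennreal (C * (\<rho> powr s / ?\<psi>))"
        using \<open>1 * 1 \<le> C * (\<rho> powr s / ?\<psi>)\<close> by (intro ennreal_leI) simp
      finally show ?thesis .
    next
      case False
      let ?js = "[Suc k..<Suc (2 * K)]"
      let ?Y = "nested_sum (path_nodes T w ?js)"
      let ?x = "base_point T (take k w) \<eta>"
      have js: "set ?js \<subseteq> {1..2 * K}" by auto
      obtain B where B: "B \<in> sets borel" "{y. norm y \<le> R' \<and> norm (?A *v y - (c - ?x)) \<le> \<rho>} \<subseteq> B"
        and Bvol: "emeasure lborel B \<le> ennreal ((2 * R') ^ CARD('d) * (\<rho> powr s / ?\<psi>))"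
        using emeasure_lborel_ball_vimage_le[OF sv(1) s \<rho>0, of R' "c - ?x"] by (auto simp: R'_def)
      \<comment> \<open>The prefix is frozen at \<eta> and the tail \<open>?Y\<close> is untouched
        by \<open>F\<close>. A hit thus says that \<open>?A *v ?Y \<omega>\<close> is \<rho>-close
        to the fixed point \<open>c - ?x\<close>, and \<open>?Y\<close> is almost surely bounded by
        \<open>R'\<close>.\<close>
      have split: "base_point T w (mix F \<eta> \<omega>) = ?x + ?A *v ?Y \<omega>" for \<omega>
      proof -
        have "base_point T (take k w) (mix F \<eta> \<omega>) = ?x"
          using F k wordsD(1)[OF w] by (intro base_point_cong) (auto simp: mix_def min_def)
        moreover have "?Y (mix F \<eta> \<omega>) = ?Y \<omega>"
          using nF by (intro nested_sum_cong) (auto simp: mix_def fst_path_nodes)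
        ultimately show ?thesis using base_point_split[of k w T "mix F \<eta> \<omega>"] k wordsD(1)[OF w] by simp
      qed
      have Ym: "{\<omega> \<in> space M. ?Y \<omega> \<in> B} \<in> sets M"
        using measurable_sets[OF measurable_path_sum[OF w js] B(1)]
        by (simp add: vimage_def Int_def conj_commute)
      have "AE \<omega> in M. norm (?Y \<omega>) \<le> R'"
        using AE_norm_le
      proof eventually_elim
        case (elim \<omega>)
        have "norm (?Y \<omega>) \<le> R / (1 - a)"
          using elim take_fin_words[OF w] by (intro norm_nested_sum_le[OF w js R(1)]) auto
        then show ?case by (simp add: R'_def)
      qed
      then have "AE \<omega> in M. indicator (cball c \<rho>) (base_point T w (mix F \<eta> \<omega>))
          \<le> (indicator {\<omega> \<in> space M. ?Y \<omega> \<in> B} \<omega> :: ennreal)"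
        using AE_space
      proof eventually_elim
        case (elim \<omega>)
        have "?Y \<omega> \<in> B" if "base_point T w (mix F \<eta> \<omega>) \<in> cball c \<rho>"
        proof -
          have "norm (?A *v ?Y \<omega> - (c - ?x)) \<le> \<rho>"
            using that unfolding split by (simp add: dist_norm norm_minus_commute algebra_simps)
          then show ?thesis using B(2) elim by auto
        qed
        then show ?case using elim by (auto simp: indicator_def)
      qed
      then have "?I \<le> (\<integral>\<^sup>+\<omega>. indicator {\<omega> \<in> space M. ?Y \<omega> \<in> B} \<omega> \<partial>M)"
        by (rule nn_integral_mono_AE)
      also have "\<dots> = emeasure M {\<omega> \<in> space M. ?Y \<omega> \<in> B}" using Ym by simp
      also have "\<dots> \<le> ennreal (2 * H) * emeasure lborel B + ennreal (\<delta> ^ (2 * K - k))"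
        by (rule dens[OF w k B(1)])
      also have "\<dots> \<le> ennreal (2 * H) * ennreal ((2 * R') ^ CARD('d) * (\<rho> powr s / ?\<psi>)) + ennreal (\<rho> powr s / ?\<psi>)"
      proof (intro add_mono mult_left_mono Bvol ennreal_leI)
        have "\<delta> \<le> 1" using \<delta>a a by (meson less_imp_le order_trans power_le_one)
        then have "\<delta> ^ (2 * K - k) \<le> \<delta> ^ K" using False \<delta>0 by (intro power_decreasing) auto
        also have "\<dots> \<le> (a ^ CARD('d)) ^ K" using \<delta>a \<delta>0 by (intro power_mono) auto
        also have "\<dots> = (a ^ K) ^ CARD('d)" by (simp add: power_mult[symmetric] mult.commute)
        also have "\<dots> = (a ^ K) powr real CARD('d)" using aK by (simp add: powr_realpow)
        also have "\<dots> \<le> (a ^ K) powr s" using aK a s by (intro powr_mono') (auto simp: power_le_one)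
        also have "\<dots> \<le> \<rho> powr s" using \<rho> aK s by (intro powr_mono2) auto
        also have "\<dots> \<le> \<rho> powr s / ?\<psi>"
        proof -
          have "(a ^ k) powr s \<le> 1" using a s by (intro powr_le1) (auto simp: power_le_one)
          then have "?\<psi> \<le> 1" using \<psi>a by linarith
          then show ?thesis using \<psi>0 by (simp add: field_simps mult_left_le)
        qed
        finally show "\<delta> ^ (2 * K - k) \<le> \<rho> powr s / ?\<psi>" .
      qed simp
      also have "\<dots> = ennreal (C * (\<rho> powr s / ?\<psi>))"
        using H \<psi>0 by (simp add: C_def R'_def ennreal_mult[symmetric] ennreal_plus[symmetric] algebra_simps del: ennreal_plus)
      finally show ?thesis .
    qed
  qed
qed

end

section \<open>Cylinders, projection and mesh cubes\<close>

lemma prefix_word_words: "w \<in> inf_words n \<Longrightarrow> prefix_word k w \<in> words n k"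
  by (auto simp: prefix_word_def words_def inf_words_def)

lemma prefix_word_Suc: "prefix_word (Suc k) w = prefix_word k w @ [w k]"
  by (simp add: prefix_word_def)

lemma take_prefix_word: "k \<le> l \<Longrightarrow> take k (prefix_word l w) = prefix_word k w"
  by (simp add: prefix_word_def take_map min_absorb1)

lemma cylinder_iff:
  "u \<in> words n k \<Longrightarrow> w \<in> cylinder n u \<longleftrightarrow> w \<in> inf_words n \<and> prefix_word k w = u"
  by (auto simp: cylinder_def dest: wordsD(1))

lemma cylinder_Nil: "cylinder n [] = inf_words n"
  by (auto simp: cylinder_def prefix_word_def)

lemma cylinder_eq_UN:
  assumes u: "u \<in> words n k" and kl: "k \<le> l"
  shows "cylinder n u = (\<Union>w\<in>{w \<in> words n l. take k w = u}. cylinder n w)"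
  using u kl by (auto simp: cylinder_iff take_prefix_word prefix_word_words)
    (metis cylinder_iff prefix_word_words take_prefix_word)

lemma disjoint_cylinders: "disjoint_family_on (cylinder n) (words n l)"
  by (auto simp: disjoint_family_on_def cylinder_iff)

lemma sets_cylinder:
  assumes "sets \<mu> = sets (restrict_space borel (inf_words n))"
  shows "cylinder n u \<in> sets \<mu>"
proof -
  have "closed {w :: nat \<Rightarrow> nat. w i = c}" for i c
    by (intro closed_Collect_eq continuous_on_product_coordinates continuous_on_const)
  then have "closed (\<Inter>i\<in>{..<length u}. {w :: nat \<Rightarrow> nat. w i = u ! i})" by auto
  then have "(\<Inter>i\<in>{..<length u}. {w :: nat \<Rightarrow> nat. w i = u ! i}) \<in> sets borel" by auto
  then have "inf_words n \<inter> (\<Inter>i\<in>{..<length u}. {w :: nat \<Rightarrow> nat. w i = u ! i}) \<in> sets \<mu>"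
    unfolding assms sets_restrict_space by (rule imageI)
  moreover have "prefix_word (length u) w = u \<longleftrightarrow> (\<forall>i<length u. w i = u ! i)" for w
    unfolding prefix_word_def by (subst list_eq_iff_nth_eq) simp
  then have "cylinder n u = inf_words n \<inter> (\<Inter>i\<in>{..<length u}. {w. w i = u ! i})"
    unfolding cylinder_def by blast
  ultimately show ?thesis by simp
qed

section \<open>Mesh cubes and volume counting\<close>

definition mesh_cube :: "real \<Rightarrow> int^'d \<Rightarrow> (real^'d) set" where
  "mesh_cube r j = {x. \<forall>i. of_int (j $ i) * r \<le> x $ i \<and> x $ i < (of_int (j $ i) + 1) * r}"

lemma mesh_cubes_eq: "mesh_cubes r = range (mesh_cube r)"
  by (simp add: mesh_cubes_def mesh_cube_def)

lemma mem_mesh_cube_iff: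
  assumes "r > 0"
  shows "x \<in> mesh_cube r j \<longleftrightarrow> j = (\<chi> i. \<lfloor>x $ i / r\<rfloor>)"
proof -
  have "of_int m * r \<le> y \<and> y < (of_int m + 1) * r \<longleftrightarrow> m = \<lfloor>y / r\<rfloor>" for m :: int and y :: real
    using assms by (subst eq_commute, subst floor_eq_iff) (simp add: field_simps)
  then show ?thesis by (auto simp: mesh_cube_def vec_eq_iff)
qed

lemma countable_mesh_cubes: "countable (mesh_cubes r :: (real^'d) set set)"
proof -
  have "countable (UNIV :: (int^'d) set)"
  proof -
    have "inj (\<lambda>(j :: int^'d). (\<chi> i. real_of_int (j $ i)))"
      by (auto simp: inj_def vec_eq_iff)
    moreover have "countable {x :: real^'d. \<forall>i. x $ i \<in> \<int>}"
    proof -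
      have "countable {f :: 'd \<Rightarrow> real. range f \<subseteq> \<int>}"
        using countable_PiE[of "UNIV :: 'd set" "\<lambda>_. \<int> :: real set"]
        by (simp add: PiE_UNIV_domain Pi_def image_subset_iff Ints_def)
      then have "countable ((\<lambda>f. (\<chi> i. f i) :: real^'d) ` {f :: 'd \<Rightarrow> real. range f \<subseteq> \<int>})" by simp
      moreover have "{x :: real^'d. \<forall>i. x $ i \<in> \<int>} \<subseteq> (\<lambda>f. (\<chi> i. f i)) ` {f :: 'd \<Rightarrow> real. range f \<subseteq> \<int>}"
      proof
        fix x :: "real^'d" assume "x \<in> {x. \<forall>i. x $ i \<in> \<int>}"
        then show "x \<in> (\<lambda>f. (\<chi> i. f i)) ` {f :: 'd \<Rightarrow> real. range f \<subseteq> \<int>}"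
          by (intro image_eqI[of _ _ "\<lambda>i. x $ i"]) auto
      qed
      ultimately show ?thesis by (rule countable_subset[rotated])
    qed
    ultimately show ?thesis
      by (intro countable_image_inj_on[of "\<lambda>(j :: int^'d). (\<chi> i. real_of_int (j $ i))"])
        (auto intro: countable_subset)
  qed
  then show ?thesis unfolding mesh_cubes_eq by simp
qed

lemma mesh_cubes_borel: "Q \<in> mesh_cubes r \<Longrightarrow> (Q :: (real^'d) set) \<in> sets borel"
proof -
  assume "Q \<in> mesh_cubes r"
  then obtain j where j: "Q = mesh_cube r j" by (auto simp: mesh_cubes_eq)
  have "Q = (\<Inter>i\<in>UNIV. {x. of_int (j $ i) * r \<le> x $ i} \<inter> {x. x $ i < (of_int (j $ i) + 1) * r})"
    unfolding j mesh_cube_def by auto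
  moreover have "{x :: real^'d. of_int (j $ i) * r \<le> x $ i} \<in> sets borel" for i
    by (intro borel_closed closed_Collect_le continuous_intros)
  moreover have "{x :: real^'d. x $ i < (of_int (j $ i) + 1) * r} \<in> sets borel" for i
    by (intro borel_open open_Collect_less continuous_intros)
  ultimately show ?thesis by (simp add: sets.finite_INT)
qed

lemma disjoint_mesh_cubes:
  assumes "r > 0" "Q \<in> mesh_cubes r" "Q' \<in> mesh_cubes r" "Q \<noteq> Q'"
  shows "Q \<inter> Q' = {}"
  using assms by (auto simp: mesh_cubes_eq mem_mesh_cube_iff)

lemma Union_mesh_cubes: "r > 0 \<Longrightarrow> \<Union>(mesh_cubes r) = UNIV"
  by (auto simp: mesh_cubes_eq mem_mesh_cube_iff)

text \<open>The sum norm gives d in place of its square root, which affects constants only.\<close>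

lemma norm_diff_mesh_cube:
  assumes "Q \<in> mesh_cubes r" "x \<in> Q" "y \<in> Q"
  shows "norm (x - y :: real^'d) \<le> real CARD('d) * r"
proof -
  obtain j where j: "Q = mesh_cube r j" using assms(1) by (auto simp: mesh_cubes_eq)
  have "norm (x - y) \<le> (\<Sum>i\<in>UNIV. \<bar>(x - y) $ i\<bar>)" by (rule norm_le_l1_cart)
  also have "\<dots> \<le> (\<Sum>i\<in>(UNIV :: 'd set). r)"
  proof (rule sum_mono)
    fix i
    show "\<bar>(x - y) $ i\<bar> \<le> r"
      using assms(2,3) unfolding j mesh_cube_def by (auto simp: abs_le_iff algebra_simps) (smt (verit))+
  qed
  finally show ?thesis by simp
qed

lemma emeasure_mesh_cube:
  assumes r: "r > 0" and Q: "Q \<in> mesh_cubes r"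
  shows "ennreal (r ^ CARD('d)) \<le> emeasure lborel (Q :: (real^'d) set)"
proof -
  obtain j where j: "Q = mesh_cube r j" using Q by (auto simp: mesh_cubes_eq)
  let ?l = "(\<chi> i. of_int (j $ i) * r) :: real^'d" and ?u = "(\<chi> i. (of_int (j $ i) + 1) * r) :: real^'d"
  have "box ?l ?u \<subseteq> Q" unfolding j mesh_cube_def by (auto simp: mem_box_cart less_imp_le)
  then have "emeasure lborel (box ?l ?u) \<le> emeasure lborel Q"
    using mesh_cubes_borel[OF Q] by (intro emeasure_mono) auto
  moreover have "emeasure lborel (box ?l ?u) = ennreal (r ^ CARD('d))"
  proof -
    have "emeasure lborel (box ?l ?u) = ennreal (\<Prod>b\<in>Basis. (?u - ?l) \<bullet> b)"
      using r by (intro emeasure_lborel_box) (auto simp: Basis_vec_def inner_axis algebra_simps)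
    also have "(\<Prod>b\<in>Basis. (?u - ?l) \<bullet> b) = (\<Prod>b\<in>(Basis :: (real^'d) set). r)"
      by (intro prod.cong refl) (auto simp: Basis_vec_def inner_axis algebra_simps)
    finally show ?thesis by simp
  qed
  ultimately show ?thesis by simp
qed

text \<open>Cubes that meet \<open>A\<close> are disjoint, have volume \<open>r ^ CARD('d)\<close>,
  and lie in the neighbourhood \<open>B\<close> of \<open>A\<close>, whose radius is the bound for
  the diameter of a cube.\<close>

lemma card_mesh_cubes_le:
  assumes r: "r > 0" and F: "finite F" "F \<subseteq> mesh_cubes r"
    and meet: "\<And>Q. Q \<in> F \<Longrightarrow> Q \<inter> A \<noteq> {}"
    and B: "B \<in> sets borel" "\<And>x z. x \<in> A \<Longrightarrow> norm z \<le> real CARD('d) * r \<Longrightarrow> (x + z :: real^'d) \<in> B"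
    and V: "emeasure lborel B \<le> ennreal V" "0 \<le> V"
  shows "real (card F) * r ^ CARD('d) \<le> V"
proof -
  have "disjoint_family_on (\<lambda>Q. Q) F"
    using F(2) disjoint_mesh_cubes[OF r] unfolding disjoint_family_on_def by blast
  then have "(\<Sum>Q\<in>F. emeasure lborel Q) = emeasure lborel (\<Union>Q\<in>F. Q)"
    using F mesh_cubes_borel by (intro sum_emeasure) auto
  also have "\<dots> \<le> emeasure lborel B"
  proof (intro emeasure_mono B)
    show "(\<Union>Q\<in>F. Q) \<subseteq> B"
    proof
      fix y assume "y \<in> (\<Union>Q\<in>F. Q)"
      then obtain Q where Q: "Q \<in> F" "y \<in> Q" by auto
      then obtain x where x: "x \<in> Q" "x \<in> A" using meet by blast
      have "norm (y - x) \<le> real CARD('d) * r" using Q x F by (intro norm_diff_mesh_cube) auto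
      from B(2)[OF x(2) this] show "y \<in> B" by simp
    qed
  qed (use B in simp)
  also have "\<dots> \<le> ennreal V" by (rule V)
  finally have "(\<Sum>Q\<in>F. emeasure lborel Q) \<le> ennreal V" .
  moreover have "(\<Sum>Q\<in>F. ennreal (r ^ CARD('d))) \<le> (\<Sum>Q\<in>F. emeasure lborel Q)"
    using F r by (intro sum_mono emeasure_mesh_cube) auto
  ultimately have "(\<Sum>Q\<in>F. ennreal (r ^ CARD('d))) \<le> ennreal V" by (rule order_trans[rotated])
  then have "ennreal (real (card F) * r ^ CARD('d)) \<le> ennreal V"
    using r by (simp add: ennreal_mult ennreal_of_nat_eq_real_of_nat)
  then show ?thesis using V(2) by (simp add: ennreal_le_iff)
qed

section \<open>The projection, its image measure and correlations\<close>

locale affine_measure = affine_system n T a b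
  for n :: "nat \<Rightarrow> nat" and T :: "nat \<Rightarrow> nat \<Rightarrow> real^'d^'d" and a b :: real +
  fixes J :: "(real^'d) set" and RJ :: real and \<mu> :: "(nat \<Rightarrow> nat) measure" and q :: real
  assumes J: "compact J" "J \<noteq> {}" "\<And>x. x \<in> J \<Longrightarrow> norm x \<le> RJ"
    and fin_\<mu>: "finite_measure \<mu>" and sets_\<mu>: "sets \<mu> = sets (restrict_space borel (inf_words n))"
    and \<mu>_pos: "measure \<mu> (space \<mu>) > 0" and q: "q > 1"
begin

sublocale mu: finite_measure \<mu> by (rule fin_\<mu>)

lemma space_\<mu>: "space \<mu> = inf_words n"
  using sets_eq_imp_space_eq[OF sets_\<mu>] by (simp add: space_restrict_space)

lemma RJ_nonneg: "0 \<le> RJ"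
  using J(2,3) norm_ge_zero order_trans by blast

abbreviation cyl_mass :: "nat list \<Rightarrow> real" where
  "cyl_mass u \<equiv> measure \<mu> (cylinder n u)"

lemma cylinder_in_sets[measurable]: "cylinder n u \<in> sets \<mu>"
  by (rule sets_cylinder[OF sets_\<mu>])

lemma cyl_mass_sum:
  assumes u: "u \<in> words n k" and kl: "k \<le> l"
  shows "cyl_mass u = (\<Sum>w\<in>{w \<in> words n l. take k w = u}. cyl_mass w)"
  unfolding cylinder_eq_UN[OF u kl]
  by (rule mu.finite_measure_finite_Union)
    (use finite_words disjoint_cylinders[of n l] in \<open>auto simp: disjoint_family_on_def\<close>)

lemma space_eq_UN: "space \<mu> = (\<Union>w\<in>words n l. cylinder n w)"
  using cylinder_eq_UN[of "[]" n 0 l] by (simp add: space_\<mu> words_0 cylinder_Nil)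

lemma compact_basic_set: "compact (basic_set T J \<omega> u)"
proof -
  have "continuous_on J (\<lambda>x. base_point T u \<omega> + word_matrix T u *v x)"
    by (intro continuous_intros linear_continuous_on matrix_vector_mul_bounded_linear)
  then show ?thesis unfolding basic_set_eq using J(1) by (rule compact_continuous_image)
qed

text \<open>The basic sets along \<open>w\<close> are nested, nonempty and compact with diameters
  tending to 0; hence exactly one common point exists and the definite description in
  \<open>projection\<close> denotes it.\<close>

lemma projection_mem:
  assumes \<omega>: "nonautonomous_structure n T J \<omega>" and w: "w \<in> inf_words n"
  shows "projection T J \<omega> w \<in> basic_set T J \<omega> (prefix_word k w)"
proof -
  let ?B = "\<lambda>k. basic_set T J \<omega> (prefix_word k w)"
  have step: "?B (Suc k) \<subseteq> ?B k" for k
  proof -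
    have "\<forall>k\<ge>1. w (k - 1) \<in> {1..n k}" using w by (simp add: inf_words_def)
    from this[rule_format, of "Suc k"] have wk: "w k \<in> {1..n (Suc k)}" by simp
    have "\<forall>k\<ge>1. \<forall>u\<in>words n (k - 1). \<forall>i\<in>{1..n k}. basic_set T J \<omega> (u @ [i]) \<subseteq> basic_set T J \<omega> u"
      using \<omega> by (simp add: nonautonomous_structure_def)
    from this[rule_format, of "Suc k" "prefix_word k w" "w k"] show ?thesis
      using wk prefix_word_words[OF w, of k] by (simp add: prefix_word_Suc)
  qed
  have dec: "?B l \<subseteq> ?B k" if "k \<le> l" for k l using lift_Suc_antimono_le[of ?B] step that by blast
  have "(\<Inter>k. ?B k) \<noteq> {}"
    using J(2) by (intro compact_nest compact_basic_set dec) (auto simp: basic_set_eq)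
  then obtain x where x: "\<And>k. x \<in> ?B k" by blast
  have lim: "(\<lambda>k. Max ((\<lambda>u. diameter (basic_set T J \<omega> u)) ` words n k)) \<longlonglongrightarrow> 0"
    using \<omega> by (simp add: nonautonomous_structure_def)
  have uniq: "y = x" if y: "y \<in> (\<Inter>k\<in>{1..}. ?B k)" for y
  proof -
    have le: "dist y x \<le> Max ((\<lambda>u. diameter (basic_set T J \<omega> u)) ` words n k)" if k: "k \<ge> 1" for k
    proof -
      have "dist y x \<le> diameter (?B k)"
        using y k x by (intro diameter_bounded_bound compact_imp_bounded compact_basic_set) auto
      also have "\<dots> \<le> Max ((\<lambda>u. diameter (basic_set T J \<omega> u)) ` words n k)"
        using prefix_word_words[OF w, of k] finite_words by (intro Max_ge) auto
      finally show ?thesis .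
    qed
    have "dist y x \<le> 0"
      by (rule tendsto_lowerbound[OF lim]) (use le in \<open>auto intro!: eventually_sequentiallyI[of 1]\<close>)
    then show ?thesis by simp
  qed
  have "projection T J \<omega> w = x" unfolding projection_def
  proof (rule the_equality)
    show "x \<in> (\<Inter>k\<in>{1..}. ?B k)" using x by blast
  qed (rule uniq)
  then show ?thesis using x by simp
qed

lemma norm_projection_diff:
  assumes \<omega>: "nonautonomous_structure n T J \<omega>" and w: "w \<in> inf_words n"
  shows "norm (projection T J \<omega> w - base_point T (prefix_word k w) \<omega>) \<le> a ^ k * RJ"
proof -
  obtain x where x: "x \<in> J" "projection T J \<omega> w
      = base_point T (prefix_word k w) \<omega> + word_matrix T (prefix_word k w) *v x"
    using projection_mem[OF \<omega> w, of k] unfolding basic_set_eq by blast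
  have "norm (word_matrix T (prefix_word k w) *v x) \<le> a ^ k * norm x"
    by (rule word_matrix_bounds(1)[OF prefix_word_words[OF w]])
  also have "\<dots> \<le> a ^ k * RJ" using J(3)[OF x(1)] a by (intro mult_left_mono) auto
  finally show ?thesis using x(2) by simp
qed

text \<open>The projection is a pointwise limit of functions that are constant on the cylinders of a
  level, namely the base points of the prefixes.\<close>

lemma measurable_projection:
  assumes \<omega>: "nonautonomous_structure n T J \<omega>"
  shows "projection T J \<omega> \<in> borel_measurable \<mu>"
proof (rule borel_measurable_LIMSEQ_metric)
  fix k
  have m1: "(\<lambda>w. \<Sum>u\<in>words n k. indicator (cylinder n u) w *\<^sub>R base_point T u \<omega>) \<in> borel_measurable \<mu>"
    by (intro borel_measurable_sum borel_measurable_scaleR borel_measurable_indicator) auto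
  have m2: "(\<Sum>u\<in>words n k. indicator (cylinder n u) w *\<^sub>R base_point T u \<omega>)
    = base_point T (prefix_word k w) \<omega>" if "w \<in> space \<mu>" for w
  proof -
    have w: "w \<in> inf_words n" using that by (simp add: space_\<mu>)
    have "(\<Sum>u\<in>words n k. indicator (cylinder n u) w *\<^sub>R base_point T u \<omega>)
      = (\<Sum>u\<in>words n k. if u = prefix_word k w then base_point T u \<omega> else 0)"
      using w by (intro sum.cong) (auto simp: indicator_def cylinder_iff)
    also have "\<dots> = base_point T (prefix_word k w) \<omega>"
      using prefix_word_words[OF w, of k] finite_words[of n k] by (simp add: sum.delta)
    finally show ?thesis .
  qed
  show "(\<lambda>w. base_point T (prefix_word k w) \<omega>) \<in> borel_measurable \<mu>"
    by (rule iffD1[OF measurable_cong[OF m2] m1])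
next
  fix w assume "w \<in> space \<mu>"
  then have w: "w \<in> inf_words n" by (simp add: space_\<mu>)
  have lim: "(\<lambda>k. a ^ k * RJ) \<longlonglongrightarrow> 0"
    using tendsto_mult_right[OF LIMSEQ_realpow_zero[of a], of RJ] a by (simp add: mult.commute)
  have "(\<lambda>k. base_point T (prefix_word k w) \<omega> - projection T J \<omega> w) \<longlonglongrightarrow> 0"
  proof (rule Lim_null_comparison[OF always_eventually lim], rule allI)
    fix k show "norm (base_point T (prefix_word k w) \<omega> - projection T J \<omega> w) \<le> a ^ k * RJ"
      using norm_projection_diff[OF \<omega> w, of k] by (simp add: norm_minus_commute)
  qed
  then show "(\<lambda>k. base_point T (prefix_word k w) \<omega>) \<longlonglongrightarrow> projection T J \<omega> w"
    by (rule LIM_zero_cancel)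
qed

lemma measure_image_measure:
  assumes \<omega>: "nonautonomous_structure n T J \<omega>" and Q: "Q \<in> sets borel"
  shows "measure (image_measure T J \<mu> \<omega>) Q = measure \<mu> (projection T J \<omega> -` Q \<inter> space \<mu>)"
  unfolding image_measure_def by (rule measure_distr[OF measurable_projection[OF \<omega>] Q])

definition mesh_sum :: "(nat list \<Rightarrow> real^'d) \<Rightarrow> real \<Rightarrow> real" where
  "mesh_sum \<omega> r = (\<Sum>\<^sub>\<infinity>Q\<in>mesh_cubes r. measure (image_measure T J \<mu> \<omega>) Q powr q)"

text \<open>A level-\<open>l\<close> version of the correlation integral of
  \<open>\<mu>(B(x, \<rho>)) powr (q - 1)\<close>, with projected points replaced by base points. It
  involves finitely many translations and is measurable in \<omega>.\<close>

definition correlation :: "nat \<Rightarrow> real \<Rightarrow> (nat list \<Rightarrow> real^'d) \<Rightarrow> real" where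
  "correlation l \<rho> \<omega> = (\<Sum>u\<in>words n l. cyl_mass u *
     (\<Sum>w\<in>words n l. cyl_mass w * indicator (cball (base_point T u \<omega>) \<rho>) (base_point T w \<omega>)) powr (q - 1))"

text \<open>If the cylinder of \<open>u\<close> meets the preimage of a cube, every word with a
  point in this cube has its base point within \<rho> of that of \<open>u\<close>: the diameter of
  the cube and two approximation errors \<open>a ^ l * RJ\<close> add up. The factor
  \<open>\<mu>(Q) powr (q - 1)\<close> is thus at most \<open>G u powr (q - 1)\<close>, and the
  remaining factor \<mu>(Q) is distributed over cylinders.\<close>

lemma finite_mesh_sum_le_correlation:
  assumes \<omega>: "nonautonomous_structure n T J \<omega>" and r: "r > 0"
    and \<rho>: "real CARD('d) * r + 2 * (a ^ l * RJ) \<le> \<rho>"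
    and F: "finite F" "F \<subseteq> mesh_cubes r"
  shows "(\<Sum>Q\<in>F. measure (image_measure T J \<mu> \<omega>) Q powr q) \<le> correlation l \<rho> \<omega>"
proof -
  let ?\<pi> = "projection T J \<omega>"
  define S where "S Q = ?\<pi> -` Q \<inter> space \<mu>" for Q
  define G where "G u = (\<Sum>w\<in>words n l. cyl_mass w * indicator (cball (base_point T u \<omega>) \<rho>) (base_point T w \<omega>))" for u
  have G0: "G u \<ge> 0" for u unfolding G_def by (intro sum_nonneg) auto
  have Sm[measurable]: "S Q \<in> sets \<mu>" if "Q \<in> mesh_cubes r" for Q
    unfolding S_def using mesh_cubes_borel[OF that] by (intro measurable_sets[OF measurable_projection[OF \<omega>]])
  have SG: "measure \<mu> (S Q) \<le> G u" if Q: "Q \<in> mesh_cubes r" and v: "v \<in> S Q" "v \<in> cylinder n u" "u \<in> words n l" for Q u v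
  proof -
    define V where "V = {w \<in> words n l. base_point T w \<omega> \<in> cball (base_point T u \<omega>) \<rho>}"
    have "S Q \<subseteq> (\<Union>w\<in>V. cylinder n w)"
    proof
      fix x assume x: "x \<in> S Q"
      then have xi: "x \<in> inf_words n" "?\<pi> x \<in> Q" by (auto simp: S_def space_\<mu>)
      have vi: "v \<in> inf_words n" "prefix_word l v = u" "?\<pi> v \<in> Q"
        using v by (auto simp: S_def cylinder_iff)
      let ?w = "prefix_word l x"
      have "norm (base_point T u \<omega> - base_point T ?w \<omega>)
        \<le> norm (base_point T u \<omega> - ?\<pi> v) + norm (?\<pi> v - ?\<pi> x) + norm (?\<pi> x - base_point T ?w \<omega>)"
        by norm
      also have "\<dots> \<le> a ^ l * RJ + real CARD('d) * r + a ^ l * RJ"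
        using norm_projection_diff[OF \<omega> vi(1), of l] norm_projection_diff[OF \<omega> xi(1), of l]
          norm_diff_mesh_cube[OF Q vi(3) xi(2)] vi(2)
        by (intro add_mono) (auto simp: norm_minus_commute)
      finally have "norm (base_point T u \<omega> - base_point T ?w \<omega>) \<le> \<rho>" using \<rho> by linarith
      then have "?w \<in> V"
        using prefix_word_words[OF xi(1)] by (simp add: V_def dist_norm)
      moreover have "x \<in> cylinder n ?w"
        using xi cylinder_iff[OF prefix_word_words[OF xi(1), of l]] by simp
      ultimately show "x \<in> (\<Union>w\<in>V. cylinder n w)" by blast
    qed
    then have "measure \<mu> (S Q) \<le> measure \<mu> (\<Union>w\<in>V. cylinder n w)"
      by (intro mu.finite_measure_mono) (auto simp: V_def intro!: sets.finite_UN finite_words finite_subset[OF _ finite_words])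
    also have "\<dots> \<le> (\<Sum>w\<in>V. cyl_mass w)"
      unfolding V_def using finite_words by (intro measure_UNION_le) auto
    also have "\<dots> = G u"
      unfolding G_def V_def using finite_words[of n l]
      by (auto simp: sum.inter_filter[symmetric] indicator_def intro!: sum.cong)
    finally show ?thesis .
  qed
  have eq1: "measure \<mu> (S Q) = (\<Sum>u\<in>words n l. measure \<mu> (S Q \<inter> cylinder n u))" if Q: "Q \<in> mesh_cubes r" for Q
  proof -
    have "S Q = (\<Union>u\<in>words n l. S Q \<inter> cylinder n u)"
      using space_eq_UN[of l] by (auto simp: S_def)
    then have "measure \<mu> (S Q) = measure \<mu> (\<Union>u\<in>words n l. S Q \<inter> cylinder n u)" by simp
    also have "\<dots> = (\<Sum>u\<in>words n l. measure \<mu> (S Q \<inter> cylinder n u))"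
    proof (rule mu.finite_measure_finite_Union[OF finite_words])
      show "disjoint_family_on (\<lambda>u. S Q \<inter> cylinder n u) (words n l)"
        using disjoint_cylinders[of n l] unfolding disjoint_family_on_def by blast
    qed (use Sm[OF Q] in auto)
    finally show ?thesis .
  qed
  have "(\<Sum>Q\<in>F. measure (image_measure T J \<mu> \<omega>) Q powr q) = (\<Sum>Q\<in>F. measure \<mu> (S Q) powr q)"
  proof (rule sum.cong[OF refl])
    fix Q assume "Q \<in> F"
    then have "Q \<in> sets borel" using F by (intro mesh_cubes_borel) auto
    then show "measure (image_measure T J \<mu> \<omega>) Q powr q = measure \<mu> (S Q) powr q"
      by (simp add: measure_image_measure[OF \<omega>] S_def)
  qed
  also have "\<dots> \<le> (\<Sum>Q\<in>F. \<Sum>u\<in>words n l. measure \<mu> (S Q \<inter> cylinder n u) * G u powr (q - 1))"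
  proof (rule sum_mono)
    fix Q assume "Q \<in> F"
    then have Q: "Q \<in> mesh_cubes r" using F by auto
    have "measure \<mu> (S Q) powr q = measure \<mu> (S Q) * measure \<mu> (S Q) powr (q - 1)"
      using powr_add[of "measure \<mu> (S Q)" 1 "q - 1"] by (cases "measure \<mu> (S Q) = 0") auto
    also have "\<dots> = (\<Sum>u\<in>words n l. measure \<mu> (S Q \<inter> cylinder n u) * measure \<mu> (S Q) powr (q - 1))"
      by (subst (1) eq1[OF Q]) (simp add: sum_distrib_right)
    also have "\<dots> \<le> (\<Sum>u\<in>words n l. measure \<mu> (S Q \<inter> cylinder n u) * G u powr (q - 1))"
    proof (rule sum_mono)
      fix u assume u: "u \<in> words n l"
      show "measure \<mu> (S Q \<inter> cylinder n u) * measure \<mu> (S Q) powr (q - 1)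
        \<le> measure \<mu> (S Q \<inter> cylinder n u) * G u powr (q - 1)"
      proof (cases "S Q \<inter> cylinder n u = {}")
        case False
        then show ?thesis using SG[OF Q _ _ u] q
          by (intro mult_left_mono powr_mono2) auto
      qed simp
    qed
    finally show "measure \<mu> (S Q) powr q \<le> (\<Sum>u\<in>words n l. measure \<mu> (S Q \<inter> cylinder n u) * G u powr (q - 1))" .
  qed
  also have "\<dots> = (\<Sum>u\<in>words n l. (\<Sum>Q\<in>F. measure \<mu> (S Q \<inter> cylinder n u)) * G u powr (q - 1))"
    by (subst sum.swap) (simp add: sum_distrib_right)
  also have "\<dots> \<le> (\<Sum>u\<in>words n l. cyl_mass u * G u powr (q - 1))"
  proof (intro sum_mono mult_right_mono)
    fix u
    have "(\<Sum>Q\<in>F. measure \<mu> (S Q \<inter> cylinder n u)) = measure \<mu> (\<Union>Q\<in>F. S Q \<inter> cylinder n u)"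
    proof (rule mu.finite_measure_finite_Union[symmetric])
      show "disjoint_family_on (\<lambda>Q. S Q \<inter> cylinder n u) F"
        using disjoint_mesh_cubes[OF r] F(2) unfolding disjoint_family_on_def S_def by blast
    qed (use F Sm in auto)
    also have "\<dots> \<le> cyl_mass u" by (intro mu.finite_measure_mono) auto
    finally show "(\<Sum>Q\<in>F. measure \<mu> (S Q \<inter> cylinder n u)) \<le> cyl_mass u" .
  qed simp
  also have "\<dots> = correlation l \<rho> \<omega>" by (simp add: correlation_def G_def)
  finally show ?thesis .
qed

end

section \<open>The lower bound\<close>

lemma summable_polynomial_geometric:
  fixes x e :: real
  assumes "0 < x" "x < 1"
  shows "summable (\<lambda>k. (2 * real k + 1) powr e * x ^ k)"
proof -
  define c where "c = - ln x / 2"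
  have c: "c > 0" using assms by (simp add: c_def)
  have xk: "x ^ k = exp (- (2 * c * real k))" for k
  proof -
    have "x ^ k = exp (ln x) ^ k" using assms by simp
    also have "\<dots> = exp (real k * ln x)" by (rule exp_of_nat_mult[symmetric])
    finally show ?thesis by (simp add: c_def mult.commute)
  qed
  have "summable (\<lambda>k. exp (- c) ^ k)" using c by (intro summable_geometric) simp
  then have "summable (\<lambda>k. norm (exp (- (c * real k))))"
    by (simp add: exp_of_nat_mult[symmetric] mult.commute)
  moreover have "(\<lambda>k. (2 * real k + 1) powr e * exp (- (2 * c * real k))) \<in> O(\<lambda>k. exp (- (c * real k)))"
    using c by real_asymp
  ultimately show ?thesis unfolding xk by (rule summable_comparison_test_bigo)
qed

text \<open>For given \<open>r\<close> take \<open>k\<close> with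
  \<open>a ^ (k + 1) < r \<le> a ^ k\<close>. Passing from \<open>a ^ k\<close> to \<open>r\<close>
  changes the logarithm by a bounded amount, which disappears after division by \<open>ln r\<close>;
  so the scales \<open>a ^ k\<close> suffice.\<close>

lemma Liminf_log_ratio_ge:
  fixes f :: "real \<Rightarrow> real"
  assumes a: "0 < a" "a < 1" and \<theta>: "\<theta> > 0" and s: "s \<ge> 0"
    and pos: "\<And>r. 0 < r \<Longrightarrow> r < 1 \<Longrightarrow> 0 < f r"
    and le: "\<And>r k. 0 < r \<Longrightarrow> r < 1 \<Longrightarrow> r \<le> a ^ k \<Longrightarrow> f r \<le> B * (a ^ k) powr (s * \<theta>)"
  shows "ereal s \<le> Liminf (at_right 0) (\<lambda>r. ereal (ln (f r) / (\<theta> * ln r)))"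
proof -
  have B: "B > 0"
  proof -
    have "0 < f (1/2)" "f (1/2) \<le> B" using pos[of "1/2"] le[of "1/2" 0] by simp_all
    then show ?thesis by linarith
  qed
  define g where "g r = s + (ln B - s * \<theta> * ln a) / (\<theta> * ln r)" for r
  have ev: "\<forall>\<^sub>F r in at_right (0::real). 0 < r \<and> r < 1"
    by (rule eventually_at_rightI[of 0 1]) auto
  have "\<forall>\<^sub>F r in at_right 0. ereal (g r) \<le> ereal (ln (f r) / (\<theta> * ln r))"
    using ev
  proof eventually_elim
    case (elim r)
    have lna: "ln a < 0" and lnr: "ln r < 0" using a elim by auto
    define k where "k = nat \<lfloor>ln r / ln a\<rfloor>"
    have "0 \<le> ln r / ln a" using lna lnr by (intro divide_nonpos_nonpos) auto
    then have k: "real k \<le> ln r / ln a" "ln r / ln a < real k + 1"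
      unfolding k_def by linarith+
    have "ln r \<le> real k * ln a" using k(1) lna by (simp add: field_simps)
    then have "ln r \<le> ln (a ^ k)" using a by (simp add: ln_realpow)
    then have rk: "r \<le> a ^ k" using a elim by simp
    have kr: "real k * ln a \<le> ln r - ln a" using k(2) lna by (simp add: field_simps)
    have "ln (f r) \<le> ln (B * (a ^ k) powr (s * \<theta>))"
      using pos[of r] le[of r k] elim rk B a by (subst ln_le_cancel_iff) auto
    also have "\<dots> = ln B + s * \<theta> * (real k * ln a)"
      using B a by (simp add: ln_mult ln_powr ln_realpow)
    also have "\<dots> \<le> ln B + s * \<theta> * (ln r - ln a)"
      using kr s \<theta> by (intro add_left_mono mult_left_mono) auto
    finally have "(ln B + s * \<theta> * (ln r - ln a)) / (\<theta> * ln r) \<le> ln (f r) / (\<theta> * ln r)"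
      using lnr \<theta> by (intro divide_right_mono_neg) (auto simp: mult_le_0_iff)
    moreover have "(ln B + s * \<theta> * (ln r - ln a)) / (\<theta> * ln r) = g r"
      using lnr \<theta> by (simp add: g_def field_simps)
    ultimately show ?case by simp
  qed
  then have "Liminf (at_right 0) (\<lambda>r. ereal (g r)) \<le> Liminf (at_right 0) (\<lambda>r. ereal (ln (f r) / (\<theta> * ln r)))"
    by (rule Liminf_mono)
  moreover have "(g \<longlongrightarrow> s) (at_right 0)"
    unfolding g_def using \<theta> by real_asymp
  then have "Liminf (at_right 0) (\<lambda>r. ereal (g r)) = ereal s"
    by (intro lim_imp_Liminf) (auto simp: trivial_limit_at_right_real)
  ultimately show ?thesis by simp
qed

section \<open>Level energies and positivity of mesh sums\<close>

context affine_measure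
begin

definition level_energy :: "real \<Rightarrow> nat \<Rightarrow> real" where
  "level_energy s k = (\<Sum>u\<in>words n k. sing_value_fun s (word_matrix T u) powr (1 - q) * cyl_mass u powr q)"

lemma level_energy_nonneg: "0 \<le> level_energy s k"
  unfolding level_energy_def by (intro sum_nonneg) auto

lemma word_matrix_fun_pos:
  assumes "u \<in> words n k" "s > 0"
  shows "0 < sing_value_fun s (word_matrix T u)"
  by (rule sing_value_fun_pos[OF word_matrix_sing_values(1)[OF assms(1)] assms(2)])

text \<open>\<psi> decreases in \<open>s\<close> and the exponent \<open>1 - q\<close> is
  negative.\<close>

lemma level_energy_mono:
  assumes st: "0 < s" "s \<le> t"
  shows "level_energy s k \<le> level_energy t k"
  unfolding level_energy_def
proof (intro sum_mono mult_right_mono powr_mono2')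
  fix u assume u: "u \<in> words n k"
  note sv = word_matrix_sing_values[OF u]
  have "sing_value (word_matrix T u) 1 \<le> 1" using sv(2) a power_le_one[of a k] by linarith
  then show "sing_value_fun t (word_matrix T u) \<le> sing_value_fun s (word_matrix T u)"
    by (rule sing_value_fun_antimono[OF sv(1) _ st])
  show "0 < sing_value_fun t (word_matrix T u)" using u st by (intro word_matrix_fun_pos) auto
qed (use q in auto)

lemma d_minus_eq:
  "d_minus n T \<mu> q = (let S = {s. s > 0 \<and> summable (\<lambda>k. level_energy s (Suc k))}
    in if S = {} then 0 else (SUP s\<in>S. ereal s))"
  by (simp add: d_minus_def level_energy_def)

lemma summable_below_d_minus:
  assumes s: "0 < s" "ereal s < d_minus n T \<mu> q"
  shows "summable (\<lambda>k. level_energy s (Suc k))"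
proof -
  let ?S = "{s. s > 0 \<and> summable (\<lambda>k. level_energy s (Suc k))}"
  have ne: "?S \<noteq> {}"
  proof
    assume "?S = {}"
    then have "d_minus n T \<mu> q = 0" unfolding d_minus_eq Let_def by (rule if_P)
    then show False using s by simp
  qed
  have "d_minus n T \<mu> q = (SUP s\<in>?S. ereal s)" unfolding d_minus_eq Let_def using ne by (rule if_not_P)
  then have "ereal s < (SUP s\<in>?S. ereal s)" using s(2) by (simp only:)
  then obtain t where t: "t \<in> ?S" "s < t" by (auto simp: less_SUP_iff)
  show ?thesis
    by (rule summable_comparison_test'[of "\<lambda>k. level_energy t (Suc k)" 0])
      (use t s in \<open>auto simp: level_energy_nonneg intro!: level_energy_mono\<close>)
qed

lemma in_d_minus:
  assumes "0 < s" "summable (\<lambda>k. level_energy s (Suc k))"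
  shows "ereal s \<le> d_minus n T \<mu> q"
proof -
  have "s \<in> {s. s > 0 \<and> summable (\<lambda>k. level_energy s (Suc k))}" using assms by simp
  then show ?thesis unfolding d_minus_eq Let_def by (auto intro!: SUP_upper2[of s])
qed

lemma d_minus_nonneg: "0 \<le> d_minus n T \<mu> q"
proof -
  let ?S = "{s. s > 0 \<and> summable (\<lambda>k. level_energy s (Suc k))}"
  show ?thesis
  proof (cases "?S = {}")
    case True then show ?thesis unfolding d_minus_eq Let_def by simp
  next
    case False
    then obtain s where "s \<in> ?S" by blast
    then have "ereal s \<le> d_minus n T \<mu> q" "0 \<le> ereal s" by (auto intro: in_d_minus)
    then show ?thesis by (rule order_trans[rotated])
  qed
qed

lemma mesh_sum_le:
  assumes \<omega>: "nonautonomous_structure n T J \<omega>" and r: "r > 0"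
    and \<rho>: "real CARD('d) * r + 2 * (a ^ l * RJ) \<le> \<rho>"
  shows "mesh_sum \<omega> r \<le> correlation l \<rho> \<omega>"
    and "(\<lambda>Q. measure (image_measure T J \<mu> \<omega>) Q powr q) summable_on mesh_cubes r"
proof -
  note fs = finite_mesh_sum_le_correlation[OF \<omega> r \<rho>]
  show summ: "(\<lambda>Q. measure (image_measure T J \<mu> \<omega>) Q powr q) summable_on mesh_cubes r"
    by (rule nonneg_bdd_above_summable_on) (auto intro!: bdd_aboveI2[of _ _ "correlation l \<rho> \<omega>"] fs)
  show "mesh_sum \<omega> r \<le> correlation l \<rho> \<omega>"
    unfolding mesh_sum_def by (rule infsum_le_finite_sums[OF summ]) (rule fs)
qed

lemma mesh_sum_ge:
  assumes \<omega>: "nonautonomous_structure n T J \<omega>" and r: "r > 0"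
    and F: "finite F" "F \<subseteq> mesh_cubes r"
  shows "(\<Sum>Q\<in>F. measure (image_measure T J \<mu> \<omega>) Q powr q) \<le> mesh_sum \<omega> r"
  unfolding mesh_sum_def
  using mesh_sum_le(2)[OF \<omega> r, of 0] F by (intro finite_sum_le_infsum) auto

text \<open>Needed to compare logarithms. Otherwise countably many null preimages of cubes would
  cover a space of positive mass.\<close>

lemma mesh_sum_pos:
  assumes \<omega>: "nonautonomous_structure n T J \<omega>" and r: "r > 0"
  shows "0 < mesh_sum \<omega> r"
proof -
  let ?\<nu> = "image_measure T J \<mu> \<omega>"
  have "\<exists>Q\<in>mesh_cubes r. measure ?\<nu> Q \<noteq> 0"
  proof (rule ccontr)
    assume "\<not> ?thesis"
    then have zero: "measure ?\<nu> Q = 0" if "Q \<in> mesh_cubes r" for Q using that by auto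
    let ?S = "\<lambda>Q. projection T J \<omega> -` Q \<inter> space \<mu>"
    have "?S Q \<in> null_sets \<mu>" if Q: "Q \<in> mesh_cubes r" for Q
      using zero[OF Q] measure_image_measure[OF \<omega> mesh_cubes_borel[OF Q]]
        measurable_sets[OF measurable_projection[OF \<omega>] mesh_cubes_borel[OF Q]]
      by (auto simp: null_sets_def mu.emeasure_eq_measure)
    then have "(\<Union>Q\<in>mesh_cubes r. ?S Q) \<in> null_sets \<mu>"
      by (intro null_sets_UN' countable_mesh_cubes)
    moreover have "(\<Union>Q\<in>mesh_cubes r. ?S Q) = space \<mu>"
      using Union_mesh_cubes[OF r, where 'a='d] by auto
    ultimately show False using \<mu>_pos by (auto simp: null_sets_def measure_def)
  qed
  then obtain Q where Q: "Q \<in> mesh_cubes r" "measure ?\<nu> Q \<noteq> 0" by blast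
  then have "0 < measure ?\<nu> Q powr q" by simp
  also have "\<dots> \<le> mesh_sum \<omega> r" using mesh_sum_ge[OF \<omega> r, of "{Q}"] Q by simp
  finally show ?thesis .
qed

lemma lower_gen_dim_eq:
  "lower_gen_dim q (image_measure T J \<mu> \<omega>)
    = Liminf (at_right 0) (\<lambda>r. ereal (ln (mesh_sum \<omega> r) / ((q - 1) * ln r)))"
  by (simp add: lower_gen_dim_def mesh_sum_def)

text \<open>For \<open>r \<le> a ^ k\<close> and words of length \<open>2 * k\<close>, the radius
  required by the comparison with \<open>correlation\<close> is at most this multiple of
  \<open>a ^ k\<close>.\<close>

definition radius_factor :: real where
  "radius_factor = real CARD('d) + 2 * RJ"

lemma radius_factor_ge_1: "1 \<le> radius_factor"
proof -
  have "1 \<le> real CARD('d)" by (simp add: Suc_le_eq)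
  then show ?thesis unfolding radius_factor_def using RJ_nonneg by linarith
qed

lemma lower_gen_dim_ge:
  assumes \<omega>: "nonautonomous_structure n T J \<omega>" and s: "0 \<le> s"
    and B: "\<And>k. correlation (2 * k) (radius_factor * a ^ k) \<omega> \<le> B * (a ^ k) powr (s * (q - 1))"
  shows "ereal s \<le> lower_gen_dim q (image_measure T J \<mu> \<omega>)"
  unfolding lower_gen_dim_eq
proof (rule Liminf_log_ratio_ge[OF a])
  fix r :: real and k :: nat assume r: "0 < r" "r < 1" "r \<le> a ^ k"
  have "a ^ (2 * k) \<le> a ^ k" using a by (intro power_decreasing) auto
  then have "real CARD('d) * r + 2 * (a ^ (2 * k) * RJ) \<le> real CARD('d) * a ^ k + 2 * (a ^ k * RJ)"
    using r RJ_nonneg by (intro add_mono mult_left_mono mult_right_mono) auto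
  also have "\<dots> = radius_factor * a ^ k" by (simp add: radius_factor_def algebra_simps)
  finally have "mesh_sum \<omega> r \<le> correlation (2 * k) (radius_factor * a ^ k) \<omega>"
    by (rule mesh_sum_le(1)[OF \<omega> r(1)])
  then show "mesh_sum \<omega> r \<le> B * (a ^ k) powr (s * (q - 1))" using B[of k] by linarith
qed (use q s \<omega> in \<open>auto intro: mesh_sum_pos\<close>)

lemma correlation_le_total:
  "correlation l \<rho> \<omega> \<le> measure \<mu> (space \<mu>) * measure \<mu> (space \<mu>) powr (q - 1)"
proof -
  let ?m = "measure \<mu> (space \<mu>)"
  have total: "(\<Sum>w\<in>words n l. cyl_mass w) = ?m"
    using cyl_mass_sum[of "[]" 0 l] by (simp add: words_0 cylinder_Nil space_\<mu>)
  have "correlation l \<rho> \<omega> \<le> (\<Sum>u\<in>words n l. cyl_mass u * ?m powr (q - 1))"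
    unfolding correlation_def
  proof (intro sum_mono mult_left_mono powr_mono2)
    fix u
    have "(\<Sum>w\<in>words n l. cyl_mass w * indicator (cball (base_point T u \<omega>) \<rho>) (base_point T w \<omega>))
      \<le> (\<Sum>w\<in>words n l. cyl_mass w)"
      by (intro sum_mono) (auto simp: indicator_def)
    then show "(\<Sum>w\<in>words n l. cyl_mass w * indicator (cball (base_point T u \<omega>) \<rho>) (base_point T w \<omega>)) \<le> ?m"
      by (simp add: total)
  qed (use q in \<open>auto intro!: sum_nonneg\<close>)
  also have "\<dots> = ?m * ?m powr (q - 1)" by (simp add: sum_distrib_right[symmetric] total)
  finally show ?thesis .
qed

text \<open>It lets the almost sure lower bound consider nonnegative exponents only, and it covers
  the case that \<open>d_minus\<close> is 0.\<close>

lemma lower_gen_dim_nonneg: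
  assumes \<omega>: "nonautonomous_structure n T J \<omega>"
  shows "0 \<le> lower_gen_dim q (image_measure T J \<mu> \<omega>)"
proof -
  have "ereal 0 \<le> lower_gen_dim q (image_measure T J \<mu> \<omega>)"
    using correlation_le_total a
    by (intro lower_gen_dim_ge[OF \<omega>, of 0 "measure \<mu> (space \<mu>) * measure \<mu> (space \<mu>) powr (q - 1)"]) auto
  then show ?thesis by (simp add: zero_ereal_def)
qed

end

section \<open>Expected correlations and the almost sure lower bound\<close>

locale random_affine_measure = affine_measure n T a b J RJ \<mu> q + random_affine_system n T a b P R
  for n :: "nat \<Rightarrow> nat" and T :: "nat \<Rightarrow> nat \<Rightarrow> real^'d^'d" and a b J RJ \<mu> q P R
begin

lemma measurable_correlation: "correlation l \<rho> \<in> borel_measurable M"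
proof -
  have "(\<lambda>\<omega>. indicator (cball (base_point T u \<omega>) \<rho>) (base_point T w \<omega>) :: real) \<in> borel_measurable M"
    if "u \<in> words n l" "w \<in> words n l" for u w
  proof -
    have [measurable]: "base_point T u \<in> borel_measurable M" "base_point T w \<in> borel_measurable M"
      using that by (auto intro: measurable_base_point)
    have "(\<lambda>\<omega>. indicator (cball (base_point T u \<omega>) \<rho>) (base_point T w \<omega>) :: real)
      = (\<lambda>\<omega>. if dist (base_point T u \<omega>) (base_point T w \<omega>) \<le> \<rho> then 1 else 0)"
      by (auto simp: fun_eq_iff)
    then show ?thesis by simp
  qed
  then show ?thesis unfolding correlation_def[abs_def]
    by (intro borel_measurable_sum borel_measurable_times powr_real_measurable) auto
qed

text \<open>The tree estimate with leaves of length \<open>2 * k\<close>, cylinder masses as weights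
  and the hit bound as \<gamma>. The constants \<open>B\<close> and \<open>e\<close> depend neither
  on \<open>k\<close> nor on \<rho>, since the energy series converges and \<open>loss\<close> is
  polynomial in the depth.\<close>

lemma expected_correlation_le:
  assumes s: "0 < s" "s \<le> real CARD('d)" and summ: "summable (\<lambda>k. level_energy s (Suc k))"
  obtains B e where "0 \<le> B"
    "\<And>k \<rho>. a ^ k \<le> \<rho> \<Longrightarrow> (\<integral>\<^sup>+\<omega>. ennreal (correlation (2 * k) \<rho> \<omega>) \<partial>M)
      \<le> ennreal (B * (2 * real k + 1) powr e * \<rho> powr (s * (q - 1)))"
proof -
  define \<theta> where "\<theta> = q - 1"
  have \<theta>: "\<theta> > 0" using q by (simp add: \<theta>_def)
  \<comment> \<open>Rounding up and subtracting 1 puts \<kappa> into the half-open interval with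
    \<open>0 < \<kappa> \<le> 1\<close>; for integer \<theta> it gives
    \<open>\<kappa> = 1\<close>.\<close>
  define j where "j = nat (\<lceil>\<theta>\<rceil> - 1)"
  define \<kappa> where "\<kappa> = \<theta> - real j"
  have \<kappa>: "0 < \<kappa>" "\<kappa> \<le> 1" "\<theta> = \<kappa> + real j"
    using \<theta> unfolding \<kappa>_def j_def by linarith+
  obtain C where C: "C \<ge> 1" and hit:
    "\<And>w K k F \<eta> c \<rho>. w \<in> words n (2 * K) \<Longrightarrow> k \<le> 2 * K \<Longrightarrow> a ^ K \<le> \<rho> \<Longrightarrow> \<eta> \<in> space M \<Longrightarrow>
      (\<And>j. j \<le> k \<Longrightarrow> take j w \<in> F) \<Longrightarrow> (\<And>j. k < j \<Longrightarrow> j \<le> 2 * K \<Longrightarrow> take j w \<notin> F) \<Longrightarrow>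
      (\<integral>\<^sup>+\<omega>. indicator (cball c \<rho>) (base_point T w (mix F \<eta> \<omega>)) \<partial>M)
        \<le> ennreal (C * (\<rho> powr s / sing_value_fun s (word_matrix T (take k w))))"
    by (rule hit_probability_le[OF s]) blast
  obtain c e where ce: "0 \<le> c" "0 \<le> e" "\<And>L. loss L \<kappa> \<theta> j \<le> c * (real L + 1) powr e"
    using loss_polynomially_bounded[OF \<kappa>(1) less_imp_le[OF \<theta>], of j] by blast
  \<comment> \<open>The tree sums over all levels from the root, whereas the series in
    \<open>d_minus\<close> starts at level 1; hence the extra term.\<close>
  define E where "E = level_energy s 0 + (\<Sum>k. level_energy s (Suc k))"
  have E: "(\<Sum>k\<le>L. level_energy s k) \<le> E" for L
  proof -
    have "(\<Sum>k\<le>L. level_energy s k) = level_energy s 0 + (\<Sum>k<L. level_energy s (Suc k))"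
      by (simp add: sum.atMost_shift)
    also have "(\<Sum>k<L. level_energy s (Suc k)) \<le> (\<Sum>k. level_energy s (Suc k))"
      by (intro sum_le_suminf summ) (auto simp: level_energy_nonneg)
    finally show ?thesis by (simp add: E_def)
  qed
  have E0: "0 \<le> E" using E[of 0] level_energy_nonneg[of s 0] by simp
  show ?thesis
  proof (rule that[of "c * (C powr \<theta> * E)" "\<theta> + e"])
    show "0 \<le> c * (C powr \<theta> * E)" using ce E0 by simp
    fix K \<rho> assume \<rho>: "a ^ K \<le> \<rho>"
    then have \<rho>0: "\<rho> > 0" using a by (meson less_le_trans zero_less_power)
    \<comment> \<open>The locale asks for positive \<gamma> on all lists, so lists that are not
      words get the dummy value 1.\<close>
    define \<gamma> where "\<gamma> p = (if p \<in> fin_words n then C * (\<rho> powr s / sing_value_fun s (word_matrix T p)) else 1)" for p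
    let ?W = "words n (2 * K)"
    interpret Pp: prob_space P by (rule P(1))
    interpret tree: random_leaf_tree ?W "2 * K" "\<lambda>u. cyl_mass u" \<gamma> "fin_words n" P "base_point T" \<rho>
    proof
      show "0 < \<gamma> p" for p
        unfolding \<gamma>_def using C \<rho>0 s by (auto simp: fin_words_def intro!: mult_pos_pos divide_pos_pos word_matrix_fun_pos)
      show "base_point T w \<omega> = base_point T w \<omega>'" if "w \<in> ?W" "\<And>j. j \<le> 2 * K \<Longrightarrow> \<omega> (take j w) = \<omega>' (take j w)" for w \<omega> \<omega>'
        using that wordsD(1)[OF that(1)] by (intro base_point_cong) auto
      fix F w k \<eta> c
      assume w: "w \<in> ?W" and k: "k \<le> 2 * K" and rest: "\<eta> \<in> space M" "\<And>j. j \<le> k \<Longrightarrow> take j w \<in> F"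
        "\<And>j. k < j \<Longrightarrow> j \<le> 2 * K \<Longrightarrow> take j w \<notin> F"
      have "\<gamma> (take k w) = C * (\<rho> powr s / sing_value_fun s (word_matrix T (take k w)))"
        using take_fin_words[OF w] by (simp add: \<gamma>_def)
      then show "(\<integral>\<^sup>+\<omega>. indicator (cball c \<rho>) (base_point T w (mix F \<eta> \<omega>)) \<partial>M) \<le> ennreal (\<gamma> (take k w))"
        using hit[OF w k \<rho> rest] by simp
    next
      show "finite ?W" by (rule finite_words)
      show "length w = 2 * K" if "w \<in> ?W" for w by (rule wordsD(1)[OF that])
      show "0 \<le> cyl_mass w" for w by simp
      show "base_point T w \<in> borel_measurable M" if "w \<in> ?W" for w by (rule measurable_base_point[OF that])
    qed
    have mass: "tree.mass p = cyl_mass p" if "p \<in> words n k" "k \<le> 2 * K" for p k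
      using cyl_mass_sum[OF that] wordsD(1)[OF that(1)] by (simp add: tree.mass_def tree.leaves_def)
    \<comment> \<open>Grouping leaves by prefix turns leaf weights into cylinder masses. One power
      of the mass comes from the sum over leaves and \<theta> powers from the summand, which
      together give exponent \<open>q\<close>.\<close>
    have "tree.level_sum \<theta> = (\<Sum>k\<le>2 * K. \<Sum>p\<in>take k ` ?W. tree.mass p * (\<gamma> p * tree.mass p) powr \<theta>)"
      unfolding tree.level_sum_def
    proof (rule sum.cong[OF refl])
      fix k assume "k \<in> {..2 * K}"
      then have k: "k \<le> 2 * K" by simp
      show "(\<Sum>w\<in>?W. cyl_mass w * (\<gamma> (take k w) * tree.mass (take k w)) powr \<theta>)
        = (\<Sum>p\<in>take k ` ?W. tree.mass p * (\<gamma> p * tree.mass p) powr \<theta>)"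
        by (subst tree.sum_over_leaves[OF k, of "\<lambda>w p. cyl_mass w * (\<gamma> p * tree.mass p) powr \<theta>"])
          (simp add: tree.mass_def sum_distrib_right)
    qed
    also have "\<dots> \<le> (\<Sum>k\<le>2 * K. \<Sum>p\<in>words n k. tree.mass p * (\<gamma> p * tree.mass p) powr \<theta>)"
      using finite_words take_words[of _ n "2 * K"]
      by (intro sum_mono sum_mono2) (auto intro!: mult_nonneg_nonneg tree.mass_nonneg)
    also have "\<dots> = (\<Sum>k\<le>2 * K. C powr \<theta> * \<rho> powr (s * \<theta>) * level_energy s k)"
    proof (rule sum.cong[OF refl])
      fix k assume "k \<in> {..2 * K}"
      then have k: "k \<le> 2 * K" by simp
      have "tree.mass p * (\<gamma> p * tree.mass p) powr \<theta>
        = C powr \<theta> * \<rho> powr (s * \<theta>) * (sing_value_fun s (word_matrix T p) powr (1 - q) * cyl_mass p powr q)"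
        if p: "p \<in> words n k" for p
      proof -
        let ?\<psi> = "sing_value_fun s (word_matrix T p)" and ?x = "cyl_mass p"
        have \<psi>: "?\<psi> > 0" by (rule word_matrix_fun_pos[OF p s(1)])
        have x: "?x * ?x powr \<theta> = ?x powr q"
          using powr_add[of ?x 1 \<theta>] by (cases "?x = 0") (auto simp: \<theta>_def)
        have "(\<gamma> p * ?x) powr \<theta> = C powr \<theta> * (\<rho> powr s) powr \<theta> * inverse (?\<psi> powr \<theta>) * ?x powr \<theta>"
          using words_fin_words[OF p] C \<rho>0 \<psi> by (simp add: \<gamma>_def powr_mult powr_divide field_simps)
        also have "(\<rho> powr s) powr \<theta> = \<rho> powr (s * \<theta>)" by (simp add: powr_powr)
        also have "inverse (?\<psi> powr \<theta>) = ?\<psi> powr (1 - q)"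
          by (simp add: powr_minus[symmetric] \<theta>_def)
        finally show ?thesis unfolding mass[OF p k] x[symmetric] by (simp add: mult_ac)
      qed
      then show "(\<Sum>p\<in>words n k. tree.mass p * (\<gamma> p * tree.mass p) powr \<theta>)
        = C powr \<theta> * \<rho> powr (s * \<theta>) * level_energy s k"
        by (simp add: level_energy_def sum_distrib_left)
    qed
    also have "\<dots> = C powr \<theta> * \<rho> powr (s * \<theta>) * (\<Sum>k\<le>2 * K. level_energy s k)"
      by (simp add: sum_distrib_left)
    also have "\<dots> \<le> C powr \<theta> * \<rho> powr (s * \<theta>) * E"
      by (intro mult_left_mono E) auto
    finally have ls: "tree.level_sum \<theta> \<le> C powr \<theta> * \<rho> powr (s * \<theta>) * E" .
    have ls0: "0 \<le> tree.level_sum \<theta>"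
      unfolding tree.level_sum_def by (intro sum_nonneg) auto
    define N where "N = real (2 * K) + 1"
    have "(\<integral>\<^sup>+\<omega>. ennreal (correlation (2 * K) \<rho> \<omega>) \<partial>M) \<le> ennreal (N powr \<theta> * loss (2 * K) \<kappa> \<theta> j * tree.level_sum \<theta>)"
      using tree.nn_integral_correlation_le[OF \<kappa>] by (simp add: correlation_def \<theta>_def N_def)
    also have "\<dots> \<le> ennreal (N powr \<theta> * (c * N powr e) * (C powr \<theta> * \<rho> powr (s * \<theta>) * E))"
    proof (rule ennreal_leI)
      have "loss (2 * K) \<kappa> \<theta> j \<le> c * N powr e" unfolding N_def by (rule ce(3))
      then have "N powr \<theta> * loss (2 * K) \<kappa> \<theta> j * tree.level_sum \<theta>
        \<le> N powr \<theta> * (c * N powr e) * tree.level_sum \<theta>"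
        using ls0 by (intro mult_right_mono mult_left_mono) auto
      also have "\<dots> \<le> N powr \<theta> * (c * N powr e) * (C powr \<theta> * \<rho> powr (s * \<theta>) * E)"
        using ce(1) by (intro mult_left_mono ls) auto
      finally show "N powr \<theta> * loss (2 * K) \<kappa> \<theta> j * tree.level_sum \<theta>
        \<le> N powr \<theta> * (c * N powr e) * (C powr \<theta> * \<rho> powr (s * \<theta>) * E)" .
    qed
    also have "N powr \<theta> * (c * N powr e) * (C powr \<theta> * \<rho> powr (s * \<theta>) * E)
      = c * (C powr \<theta> * E) * (2 * real K + 1) powr (\<theta> + e) * \<rho> powr (s * (q - 1))"
      by (simp add: N_def powr_add \<theta>_def mult_ac)
    finally show "(\<integral>\<^sup>+\<omega>. ennreal (correlation (2 * K) \<rho> \<omega>) \<partial>M)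
      \<le> ennreal (c * (C powr \<theta> * E) * (2 * real K + 1) powr (\<theta> + e) * \<rho> powr (s * (q - 1)))" .
  qed
qed

text \<open>After division by \<open>(a ^ k) powr (t * (q - 1))\<close> the expectations are
  polynomial in \<open>k\<close> times the geometric factor \<open>x ^ k\<close>, hence summable.
  The random series is then almost surely finite, and its sum serves as \<open>B\<close> for all
  \<open>k\<close> at once.\<close>

lemma AE_correlation_le:
  assumes s: "0 < s" "s \<le> real CARD('d)" and summ: "summable (\<lambda>k. level_energy s (Suc k))"
    and t: "0 \<le> t" "t < s"
  shows "AE \<omega> in M. \<exists>B. \<forall>k. correlation (2 * k) (radius_factor * a ^ k) \<omega> \<le> B * (a ^ k) powr (t * (q - 1))"
proof -
  define c where "c = radius_factor"
  have c: "c \<ge> 1" unfolding c_def by (rule radius_factor_ge_1)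
  define \<theta> where "\<theta> = q - 1"
  have \<theta>: "\<theta> > 0" using q by (simp add: \<theta>_def)
  obtain B e where B: "0 \<le> B" and EB: "\<And>k \<rho>. a ^ k \<le> \<rho> \<Longrightarrow> (\<integral>\<^sup>+\<omega>. ennreal (correlation (2 * k) \<rho> \<omega>) \<partial>M)
      \<le> ennreal (B * (2 * real k + 1) powr e * \<rho> powr (s * (q - 1)))"
    using expected_correlation_le[OF s summ] by blast
  \<comment> \<open>The geometric ratio gained by lowering the exponent from \<open>s\<close> to
    \<open>t\<close>.\<close>
  define x where "x = a powr ((s - t) * \<theta>)"
  have x: "0 < x" "x < 1" using a t \<theta> by (auto simp: x_def powr_def mult_pos_neg)
  define f where "f k \<omega> = ennreal (1 / (a ^ k) powr (t * \<theta>)) * ennreal (correlation (2 * k) (c * a ^ k) \<omega>)" for k \<omega>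
  have fm[measurable]: "f k \<in> borel_measurable M" for k
    unfolding f_def using measurable_correlation by measurable
  have corr0: "0 \<le> correlation l \<rho> \<omega>" for l \<rho> \<omega>
    unfolding correlation_def by (intro sum_nonneg) auto
  have fint: "(\<integral>\<^sup>+\<omega>. f k \<omega> \<partial>M) \<le> ennreal (B * c powr (s * \<theta>) * ((2 * real k + 1) powr e * x ^ k))" for k
  proof -
    have ak: "a ^ k > 0" using a by simp
    have "a ^ k \<le> c * a ^ k" using c ak by simp
    have "(\<integral>\<^sup>+\<omega>. f k \<omega> \<partial>M) = ennreal (1 / (a ^ k) powr (t * \<theta>)) * (\<integral>\<^sup>+\<omega>. ennreal (correlation (2 * k) (c * a ^ k) \<omega>) \<partial>M)"
      unfolding f_def using measurable_correlation by (intro nn_integral_cmult) measurable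
    also have "\<dots> \<le> ennreal (1 / (a ^ k) powr (t * \<theta>)) * ennreal (B * (2 * real k + 1) powr e * (c * a ^ k) powr (s * \<theta>))"
      unfolding \<theta>_def by (intro mult_left_mono EB) (use \<open>a ^ k \<le> c * a ^ k\<close> in auto)
    also have "\<dots> = ennreal (1 / (a ^ k) powr (t * \<theta>) * (B * (2 * real k + 1) powr e * (c * a ^ k) powr (s * \<theta>)))"
      using B by (subst ennreal_mult) auto
    also have "1 / (a ^ k) powr (t * \<theta>) * (B * (2 * real k + 1) powr e * (c * a ^ k) powr (s * \<theta>))
      = B * c powr (s * \<theta>) * ((2 * real k + 1) powr e * ((a ^ k) powr (s * \<theta>) / (a ^ k) powr (t * \<theta>)))"
      using c ak by (simp add: powr_mult)
    also have "(a ^ k) powr (s * \<theta>) / (a ^ k) powr (t * \<theta>) = x ^ k"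
      using a by (simp add: x_def powr_diff[symmetric] powr_power powr_realpow[symmetric] powr_powr algebra_simps)
    finally show ?thesis .
  qed
  have "(\<integral>\<^sup>+\<omega>. (\<Sum>k. f k \<omega>) \<partial>M) = (\<Sum>k. \<integral>\<^sup>+\<omega>. f k \<omega> \<partial>M)"
    by (rule nn_integral_suminf) measurable
  also have "\<dots> \<le> (\<Sum>k. ennreal (B * c powr (s * \<theta>) * ((2 * real k + 1) powr e * x ^ k)))"
    by (intro suminf_le fint) auto
  also have "\<dots> = ennreal (\<Sum>k. B * c powr (s * \<theta>) * ((2 * real k + 1) powr e * x ^ k))"
    using B x by (intro suminf_ennreal2 summable_mult summable_polynomial_geometric) auto
  also have "\<dots> < \<infinity>" by simp
  finally have "AE \<omega> in M. (\<Sum>k. f k \<omega>) \<noteq> \<infinity>"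
    by (intro nn_integral_PInf_AE) auto
  then show ?thesis
  proof eventually_elim
    case (elim \<omega>)
    define S where "S = enn2real (\<Sum>k. f k \<omega>)"
    have S: "(\<Sum>k. f k \<omega>) = ennreal S" using elim by (simp add: S_def less_top)
    have "correlation (2 * k) (c * a ^ k) \<omega> \<le> S * (a ^ k) powr (t * (q - 1))" for k
    proof -
      have ak: "(a ^ k) powr (t * \<theta>) > 0" using a by simp
      have "f k \<omega> \<le> (\<Sum>k. f k \<omega>)" using sum_le_suminf[of "\<lambda>k. f k \<omega>" "{k}"] by auto
      then have "f k \<omega> \<le> ennreal S" unfolding S .
      then have "ennreal (1 / (a ^ k) powr (t * \<theta>) * correlation (2 * k) (c * a ^ k) \<omega>) \<le> ennreal S"
        unfolding f_def by (subst ennreal_mult) (auto simp: corr0)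
      then have "1 / (a ^ k) powr (t * \<theta>) * correlation (2 * k) (c * a ^ k) \<omega> \<le> S"
        by (simp add: S_def ennreal_le_iff)
      then show ?thesis using ak by (simp add: field_simps \<theta>_def)
    qed
    then show ?case unfolding c_def by blast
  qed
qed

lemma AE_lower_bound:
  assumes str: "AE \<omega> in M. nonautonomous_structure n T J \<omega>"
  shows "AE \<omega> in M. min (d_minus n T \<mu> q) (ereal (real CARD('d))) \<le> lower_gen_dim q (image_measure T J \<mu> \<omega>)"
proof -
  let ?m = "min (d_minus n T \<mu> q) (ereal (real CARD('d)))"
  have one: "AE \<omega> in M. 0 \<le> t \<longrightarrow> ereal t < ?m \<longrightarrow> ereal t \<le> lower_gen_dim q (image_measure T J \<mu> \<omega>)" for t
  proof (cases "0 \<le> t \<and> ereal t < ?m")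
    case True
    \<comment> \<open>The energy series converges at this intermediate \<open>s\<close>, and
      \<open>t < s\<close> leaves the room that absorbs the polynomial loss.\<close>
    then obtain s where s: "ereal t < ereal s" "ereal s < ?m" using ereal_dense2 by blast
    have s': "0 < s" "s \<le> real CARD('d)" "ereal s < d_minus n T \<mu> q" using s True by auto
    have summ: "summable (\<lambda>k. level_energy s (Suc k))" by (rule summable_below_d_minus[OF s'(1,3)])
    have "AE \<omega> in M. \<exists>B. \<forall>k. correlation (2 * k) (radius_factor * a ^ k) \<omega> \<le> B * (a ^ k) powr (t * (q - 1))"
      using True s by (intro AE_correlation_le[OF s'(1,2) summ]) auto
    with str show ?thesis
    proof eventually_elim
      case (elim \<omega>)
      then show ?case using True by (auto intro: lower_gen_dim_ge)
    qed
  qed auto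
  \<comment> \<open>Countably many exponents suffice: a failure of the inequality would leave a
    rational exponent strictly between the two sides.\<close>
  have "AE \<omega> in M. \<forall>t::rat. 0 \<le> real_of_rat t \<longrightarrow> ereal (of_rat t) < ?m \<longrightarrow>
      ereal (of_rat t) \<le> lower_gen_dim q (image_measure T J \<mu> \<omega>)"
    unfolding AE_all_countable by (rule allI, rule one)
  with str show ?thesis
  proof eventually_elim
    case (elim \<omega>)
    let ?l = "lower_gen_dim q (image_measure T J \<mu> \<omega>)"
    show ?case
    proof (rule ccontr)
      assume "\<not> ?m \<le> ?l"
      then have "?l < ?m" by (simp only: not_le)
      then obtain t :: rat where t: "?l < ereal (of_rat t)" "ereal (of_rat t) < ?m"
        using ereal_dense3 by blast
      have "0 < ereal (of_rat t)" using lower_gen_dim_nonneg[OF elim(1)] t(1) by (rule le_less_trans)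
      then have "ereal (of_rat t) \<le> ?l" using elim(2) t(2) by auto
      then show False using t(1) by simp
    qed
  qed
qed

end

section \<open>The upper bound\<close>

lemma sum_powr_le_card_powr:
  fixes x :: "'a \<Rightarrow> real"
  assumes F: "finite F" and x: "\<And>i. i \<in> F \<Longrightarrow> 0 \<le> x i" and q: "1 \<le> q"
  shows "(\<Sum>i\<in>F. x i) powr q \<le> real (card F) powr (q - 1) * (\<Sum>i\<in>F. x i powr q)"
proof (cases "F = {}")
  case False
  let ?c = "real (card F)"
  have c: "?c > 0" using F False by (simp add: card_gt_0_iff)
  have X: "0 \<le> (\<Sum>i\<in>F. x i)" by (intro sum_nonneg x)
  have "?c * ((\<Sum>i\<in>F. x i) / ?c) powr q \<le> (\<Sum>i\<in>F. x i powr q)"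
    using weighted_mean_powr_le[OF F, of "\<lambda>_. 1" x q] x q by simp
  then have "?c powr (q - 1) * (?c * ((\<Sum>i\<in>F. x i) / ?c) powr q) \<le> ?c powr (q - 1) * (\<Sum>i\<in>F. x i powr q)"
    by (intro mult_left_mono) auto
  moreover have "?c powr (q - 1) * (?c * ((\<Sum>i\<in>F. x i) / ?c) powr q) = (\<Sum>i\<in>F. x i) powr q"
    using c X by (simp add: powr_divide powr_diff)
  ultimately show ?thesis by simp
qed simp

lemma sum_powr_le_powr_sum:
  fixes x :: "'a \<Rightarrow> real"
  assumes F: "finite F" and x: "\<And>i. i \<in> F \<Longrightarrow> 0 \<le> x i" and q: "1 \<le> q"
  shows "(\<Sum>i\<in>F. x i powr q) \<le> (\<Sum>i\<in>F. x i) powr q"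
proof -
  let ?s = "\<Sum>i\<in>F. x i"
  have s: "0 \<le> ?s" by (intro sum_nonneg x)
  have p: "y powr q = y * y powr (q - 1)" if "0 \<le> y" for y :: real
    using that powr_add[of y 1 "q - 1"] by (cases "y = 0") auto
  have "(\<Sum>i\<in>F. x i powr q) \<le> (\<Sum>i\<in>F. x i * ?s powr (q - 1))"
  proof (rule sum_mono)
    fix i assume i: "i \<in> F"
    have "x i \<le> ?s" using F i x by (intro member_le_sum) auto
    then have "x i * x i powr (q - 1) \<le> x i * ?s powr (q - 1)"
      using x[OF i] q by (intro mult_left_mono powr_mono2) auto
    then show "x i powr q \<le> x i * ?s powr (q - 1)" using p[OF x[OF i]] by simp
  qed
  also have "\<dots> = ?s powr q" using p[OF s] by (simp add: sum_distrib_right)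
  finally show ?thesis .
qed

section \<open>Estimates of the energy by mesh sums for every admissible \<omega>\<close>

context affine_measure
begin

lemma mesh_sum_less_powr:
  assumes \<omega>: "nonautonomous_structure n T J \<omega>"
    and t: "ereal t < lower_gen_dim q (image_measure T J \<mu> \<omega>)"
  obtains r0 where "0 < r0" "r0 \<le> 1" "\<And>r. 0 < r \<Longrightarrow> r < r0 \<Longrightarrow> mesh_sum \<omega> r \<le> r powr (t * (q - 1))"
proof -
  have "\<forall>\<^sub>F r in at_right 0. ereal t < ereal (ln (mesh_sum \<omega> r) / ((q - 1) * ln r))"
    using t unfolding lower_gen_dim_eq by (rule less_LiminfD)
  then obtain b where b: "b > 0" "\<And>r. 0 < r \<Longrightarrow> r < b \<Longrightarrow> t < ln (mesh_sum \<omega> r) / ((q - 1) * ln r)"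
    unfolding eventually_at_right_field by auto
  show ?thesis
  proof (rule that[of "min b 1"])
    fix r assume r: "0 < r" "r < min b 1"
    \<comment> \<open>The denominator is negative for \<open>r < 1\<close>, so a lower bound for the
      quotient becomes an upper bound for the mesh sum.\<close>
    have "(q - 1) * ln r < 0" using r q by (simp add: mult_pos_neg)
    moreover have "t < ln (mesh_sum \<omega> r) / ((q - 1) * ln r)" using r by (intro b) auto
    ultimately have "ln (mesh_sum \<omega> r) \<le> t * ((q - 1) * ln r)"
      by (simp add: neg_less_divide_eq)
    also have "\<dots> = ln (r powr (t * (q - 1)))" using r by (simp add: ln_powr)
    finally show "mesh_sum \<omega> r \<le> r powr (t * (q - 1))"
      using mesh_sum_pos[OF \<omega> r(1)] r by (subst (asm) ln_le_cancel_iff) auto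
  qed (use b in auto)
qed

lemma powr_mass_le_card:
  assumes \<omega>: "nonautonomous_structure n T J \<omega>" and S: "S \<in> sets \<mu>" and r: "r > 0"
    and F: "finite F" "F \<subseteq> mesh_cubes r" "projection T J \<omega> ` S \<subseteq> \<Union>F"
  shows "measure \<mu> S powr q \<le> real (card F) powr (q - 1) *
    (\<Sum>Q\<in>F. measure \<mu> (S \<inter> projection T J \<omega> -` Q) powr q)"
proof -
  let ?S = "\<lambda>Q. S \<inter> projection T J \<omega> -` Q"
  have Sm: "?S Q \<in> sets \<mu>" if "Q \<in> F" for Q
  proof -
    have "projection T J \<omega> -` Q \<inter> space \<mu> \<in> sets \<mu>"
      using that F(2) by (intro measurable_sets[OF measurable_projection[OF \<omega>]] mesh_cubes_borel[of Q r]) auto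
    then have "S \<inter> (projection T J \<omega> -` Q \<inter> space \<mu>) \<in> sets \<mu>" using S by blast
    moreover have "S \<inter> (projection T J \<omega> -` Q \<inter> space \<mu>) = ?S Q"
      using sets.sets_into_space[OF S] by blast
    ultimately show ?thesis by simp
  qed
  have "measure \<mu> S = measure \<mu> (\<Union>Q\<in>F. ?S Q)"
    using F(3) by (intro arg_cong[where f = "measure \<mu>"]) auto
  also have "\<dots> = (\<Sum>Q\<in>F. measure \<mu> (?S Q))"
  proof (rule mu.finite_measure_finite_Union[OF F(1)])
    show "disjoint_family_on ?S F"
      using disjoint_mesh_cubes[OF r] F(2) unfolding disjoint_family_on_def by blast
  qed (use Sm in auto)
  finally show ?thesis using sum_powr_le_card_powr[OF F(1), of "\<lambda>Q. measure \<mu> (?S Q)" q] q by simp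
qed

text \<open>Cylinders of one level are disjoint, so the pieces inside one cube can be merged by
  superadditivity of the power \<open>q\<close>. All words that use the same mesh size are thus
  charged to a single mesh sum, without multiplicity.\<close>

lemma sum_disjoint_powr_le_mesh_sum:
  assumes \<omega>: "nonautonomous_structure n T J \<omega>" and r: "r > 0"
    and U: "U \<subseteq> words n k" and F: "\<And>u. u \<in> U \<Longrightarrow> finite (F u) \<and> F u \<subseteq> mesh_cubes r"
  shows "(\<Sum>u\<in>U. \<Sum>Q\<in>F u. measure \<mu> (cylinder n u \<inter> projection T J \<omega> -` Q) powr q) \<le> mesh_sum \<omega> r"
proof -
  let ?S = "\<lambda>u Q. cylinder n u \<inter> projection T J \<omega> -` Q"
  define G where "G = (\<Union>u\<in>U. F u)"
  have finU: "finite U" using U finite_words by (rule finite_subset)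
  have G: "finite G" "G \<subseteq> mesh_cubes r" unfolding G_def using finU F by auto
  have pm: "projection T J \<omega> -` Q \<inter> space \<mu> \<in> sets \<mu>" if "Q \<in> mesh_cubes r" for Q
    using that mesh_cubes_borel by (intro measurable_sets[OF measurable_projection[OF \<omega>]]) auto
  have Seq: "?S u Q = cylinder n u \<inter> (projection T J \<omega> -` Q \<inter> space \<mu>)" for u Q
    by (auto simp: cylinder_def space_\<mu>)
  have Sm: "?S u Q \<in> sets \<mu>" if "Q \<in> mesh_cubes r" for u Q
    unfolding Seq using pm[OF that] by auto
  have "(\<Sum>u\<in>U. \<Sum>Q\<in>F u. measure \<mu> (?S u Q) powr q) \<le> (\<Sum>u\<in>U. \<Sum>Q\<in>G. measure \<mu> (?S u Q) powr q)"
    using G(1) by (intro sum_mono sum_mono2) (auto simp: G_def)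
  also have "\<dots> = (\<Sum>Q\<in>G. \<Sum>u\<in>U. measure \<mu> (?S u Q) powr q)" by (rule sum.swap)
  also have "\<dots> \<le> (\<Sum>Q\<in>G. (\<Sum>u\<in>U. measure \<mu> (?S u Q)) powr q)"
    using finU q by (intro sum_mono sum_powr_le_powr_sum) auto
  also have "\<dots> \<le> (\<Sum>Q\<in>G. measure (image_measure T J \<mu> \<omega>) Q powr q)"
  proof (intro sum_mono powr_mono2)
    fix Q assume "Q \<in> G"
    then have Q: "Q \<in> mesh_cubes r" using G by auto
    have "(\<Sum>u\<in>U. measure \<mu> (?S u Q)) = measure \<mu> (\<Union>u\<in>U. ?S u Q)"
    proof (rule mu.finite_measure_finite_Union[symmetric, OF finU])
      show "disjoint_family_on (\<lambda>u. ?S u Q) U"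
        using disjoint_cylinders[of n k] U unfolding disjoint_family_on_def by blast
    qed (use Sm[OF Q] in auto)
    also have "\<dots> \<le> measure \<mu> (projection T J \<omega> -` Q \<inter> space \<mu>)"
      using pm[OF Q] by (intro mu.finite_measure_mono) (auto simp: Seq)
    also have "\<dots> = measure (image_measure T J \<mu> \<omega>) Q"
      using measure_image_measure[OF \<omega> mesh_cubes_borel[OF Q]] by simp
    finally show "(\<Sum>u\<in>U. measure \<mu> (?S u Q)) \<le> measure (image_measure T J \<mu> \<omega>) Q" .
  qed (use q in \<open>auto intro!: sum_nonneg\<close>)
  also have "\<dots> \<le> mesh_sum \<omega> r" by (rule mesh_sum_ge[OF \<omega> r G])
  finally show ?thesis .
qed

lemma card_mesh_cubes_basic_set_le:
  fixes \<omega> :: "nat list \<Rightarrow> real^'d"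
  assumes u: "u \<in> words n k" and s: "0 < s" "s \<le> real CARD('d)" and r: "r > 0"
    and m: "r \<le> sing_value (word_matrix T u) (nat \<lceil>s\<rceil>)" "sing_value (word_matrix T u) (nat \<lceil>s\<rceil>) \<le> 2 * r"
  defines "F \<equiv> {Q \<in> mesh_cubes r. Q \<inter> basic_set T J \<omega> u \<noteq> {}}"
  shows "finite F" "real (card F) \<le> (4 * (RJ + real CARD('d))) ^ CARD('d) * (sing_value_fun s (word_matrix T u) / r powr s)"
proof -
  let ?A = "word_matrix T u" and ?C = "(4 * (RJ + real CARD('d))) ^ CARD('d)"
  let ?\<psi> = "sing_value_fun s ?A"
  note sv = word_matrix_sing_values[OF u]
  have \<psi>: "?\<psi> > 0" by (rule word_matrix_fun_pos[OF u s(1)])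
  obtain B where B: "B \<in> sets borel"
    "{?A *v y + base_point T u \<omega> + z |y z. norm y \<le> RJ \<and> norm z \<le> real CARD('d) * r} \<subseteq> B"
    "emeasure lborel B \<le> ennreal (?C * r ^ CARD('d) * (?\<psi> / r powr s))"
    using emeasure_lborel_image_nbhd_le[OF sv(1) s r RJ_nonneg _ refl m, of "real CARD('d)" "base_point T u \<omega>"]
    by auto
  have bound: "real (card G) \<le> ?C * (?\<psi> / r powr s)" if G: "finite G" "G \<subseteq> F" for G
  proof -
    have "real (card G) * r ^ CARD('d) \<le> ?C * r ^ CARD('d) * (?\<psi> / r powr s)"
    proof (rule card_mesh_cubes_le[OF r G(1)])
      show "G \<subseteq> mesh_cubes r" "\<And>Q. Q \<in> G \<Longrightarrow> Q \<inter> basic_set T J \<omega> u \<noteq> {}" using G(2) by (auto simp: F_def)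
      fix x z :: "real^'d" assume x: "x \<in> basic_set T J \<omega> u" and z: "norm z \<le> real CARD('d) * r"
      from x obtain y where y: "y \<in> J" "x = base_point T u \<omega> + ?A *v y" by (auto simp: basic_set_eq)
      have "x + z = ?A *v y + base_point T u \<omega> + z" using y by simp
      then have "x + z \<in> {?A *v y + base_point T u \<omega> + z |y z. norm y \<le> RJ \<and> norm z \<le> real CARD('d) * r}"
        using J(3)[OF y(1)] z by blast
      then show "x + z \<in> B" using B(2) by blast
    qed (use B \<psi> r RJ_nonneg in auto)
    then have "real (card G) * r ^ CARD('d) \<le> (?C * (?\<psi> / r powr s)) * r ^ CARD('d)" by (simp add: mult_ac)
    then show ?thesis using r by (subst (asm) mult_le_cancel_right_pos) auto
  qed
  \<comment> \<open>Finiteness of \<open>F\<close> itself follows from the bound for all its finite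
    subfamilies.\<close>
  have "finite F \<and> card F \<le> nat \<lfloor>?C * (?\<psi> / r powr s)\<rfloor>"
  proof (rule finite_if_finite_subsets_card_bdd)
    fix G assume "G \<subseteq> F" "finite G"
    then show "card G \<le> nat \<lfloor>?C * (?\<psi> / r powr s)\<rfloor>" using bound[of G] by (simp add: le_nat_floor)
  qed
  then show "finite F" ..
  then show "real (card F) \<le> ?C * (?\<psi> / r powr s)" using bound by blast
qed

lemma level_energy_le:
  assumes \<omega>: "nonautonomous_structure n T J \<omega>" and s: "0 < s" "s \<le> real CARD('d)" and st: "s < t"
    and r0: "r0 \<le> 1" "\<And>r. 0 < r \<Longrightarrow> r < r0 \<Longrightarrow> mesh_sum \<omega> r \<le> r powr (t * (q - 1))"
    and k: "a ^ k < r0"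
  defines "\<eta> \<equiv> (t - s) * (q - 1) / 2"
  shows "level_energy s k \<le> ((4 * (RJ + real CARD('d))) ^ CARD('d)) powr (q - 1) *
    (1 / (1 - 2 powr (- \<eta>))) * (a powr \<eta>) ^ k"
proof -
  let ?C = "(4 * (RJ + real CARD('d))) ^ CARD('d)"
  define \<theta> where "\<theta> = q - 1"
  have \<theta>: "\<theta> > 0" using q by (simp add: \<theta>_def)
  have \<eta>: "\<eta> > 0" using st q by (simp add: \<eta>_def)
  have C0: "?C \<ge> 0" using RJ_nonneg by simp
  define m where "m = nat \<lceil>s\<rceil>"
  have m: "m \<in> {1..CARD('d)}"
  proof -
    have "1 \<le> m" "real m < s + 1" using s unfolding m_def by linarith+
    then show ?thesis using s by simp
  qed
  \<comment> \<open>Dyadic rounding: \<open>2 powr (- j u)\<close> is within a factor 2 below the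
    critical singular value of \<open>u\<close>. Finitely many mesh sizes thus occur per level, and
    they can be summed geometrically.\<close>
  define j where "j u = nat \<lceil>- log 2 (sing_value (word_matrix T u) m)\<rceil>" for u
  define \<rho> where "\<rho> i = 2 powr (- real i)" for i
  have \<rho>0: "\<rho> i > 0" for i by (simp add: \<rho>_def)
  have j: "\<rho> (j u) \<le> sing_value (word_matrix T u) m" "sing_value (word_matrix T u) m \<le> 2 * \<rho> (j u)" "\<rho> (j u) \<le> a ^ k"
    if u: "u \<in> words n k" for u
  proof -
    let ?\<alpha> = "sing_value (word_matrix T u) m"
    have \<alpha>: "0 < ?\<alpha>" "?\<alpha> \<le> a ^ k" using word_matrix_sing_values(3,4)[OF u m] by auto
    have "a ^ k \<le> 1" using a by (simp add: power_le_one)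
    then have "log 2 ?\<alpha> \<le> 0" using \<alpha> by simp
    then have jj: "- log 2 ?\<alpha> \<le> real (j u)" "real (j u) < - log 2 ?\<alpha> + 1" unfolding j_def by linarith+
    have "- real (j u) \<le> log 2 ?\<alpha>" using jj by linarith
    then show 1: "\<rho> (j u) \<le> ?\<alpha>" unfolding \<rho>_def using \<alpha> by (simp add: le_log_iff)
    have "log 2 ?\<alpha> \<le> 1 + - real (j u)" using jj by linarith
    then have "?\<alpha> \<le> 2 powr (1 + - real (j u))" using \<alpha> by (simp add: log_le_iff)
    also have "\<dots> = 2 * \<rho> (j u)" unfolding \<rho>_def powr_add by simp
    finally show "?\<alpha> \<le> 2 * \<rho> (j u)" .
    show "\<rho> (j u) \<le> a ^ k" using 1 \<alpha> by linarith
  qed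
  define F where "F u = {Q \<in> mesh_cubes (\<rho> (j u)). Q \<inter> basic_set T J \<omega> u \<noteq> {}}" for u
  let ?S = "\<lambda>u Q. cylinder n u \<inter> projection T J \<omega> -` Q"
  define X where "X u = (\<Sum>Q\<in>F u. measure \<mu> (?S u Q) powr q)" for u
  have X0: "X u \<ge> 0" for u unfolding X_def by (intro sum_nonneg) auto
  have Ffin: "finite (F u)" if "u \<in> words n k" for u
    unfolding F_def using card_mesh_cubes_basic_set_le(1)[OF that s \<rho>0] j[OF that] by (simp add: m_def)
  have one: "sing_value_fun s (word_matrix T u) powr (1 - q) * cyl_mass u powr q
    \<le> ?C powr \<theta> * \<rho> (j u) powr (- s * \<theta>) * X u" if u: "u \<in> words n k" for u
  proof -
    let ?\<psi> = "sing_value_fun s (word_matrix T u)"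
    have \<psi>: "?\<psi> > 0" by (rule word_matrix_fun_pos[OF u s(1)])
    have card: "real (card (F u)) \<le> ?C * (?\<psi> / \<rho> (j u) powr s)"
      unfolding F_def using card_mesh_cubes_basic_set_le(2)[OF u s \<rho>0] j[OF u] by (simp add: m_def)
    have "projection T J \<omega> ` cylinder n u \<subseteq> \<Union>(F u)"
    proof
      fix x assume "x \<in> projection T J \<omega> ` cylinder n u"
      then obtain w where w: "w \<in> inf_words n" "prefix_word k w = u" "x = projection T J \<omega> w"
        using u by (auto simp: cylinder_iff)
      have "x \<in> basic_set T J \<omega> u" using projection_mem[OF \<omega> w(1), of k] w by simp
      moreover obtain Q where "Q \<in> mesh_cubes (\<rho> (j u))" "x \<in> Q"
        using Union_mesh_cubes[OF \<rho>0[of "j u"], where 'a='d] by blast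
      ultimately show "x \<in> \<Union>(F u)" by (auto simp: F_def)
    qed
    then have "cyl_mass u powr q \<le> real (card (F u)) powr (q - 1) * X u"
      unfolding X_def using Ffin[OF u] by (intro powr_mass_le_card[OF \<omega> _ \<rho>0[of "j u"]]) (auto simp: F_def)
    also have "\<dots> \<le> (?C * (?\<psi> / \<rho> (j u) powr s)) powr \<theta> * X u"
      unfolding \<theta>_def[symmetric] using card \<theta> X0 by (intro mult_right_mono powr_mono2) auto
    also have "(?C * (?\<psi> / \<rho> (j u) powr s)) powr \<theta> = ?C powr \<theta> * ?\<psi> powr \<theta> * \<rho> (j u) powr (- s * \<theta>)"
      using C0 \<psi> \<rho>0[of "j u"] by (simp add: powr_mult powr_divide powr_powr powr_minus field_simps)
    finally have "?\<psi> powr (1 - q) * cyl_mass u powr q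
      \<le> ?\<psi> powr (1 - q) * (?C powr \<theta> * ?\<psi> powr \<theta> * \<rho> (j u) powr (- s * \<theta>) * X u)"
      by (intro mult_left_mono) auto
    also have "\<dots> = (?\<psi> powr (1 - q) * ?\<psi> powr \<theta>) * (?C powr \<theta> * \<rho> (j u) powr (- s * \<theta>) * X u)"
      by (simp add: mult_ac)
    also have "?\<psi> powr (1 - q) * ?\<psi> powr \<theta> = 1"
      using \<psi> by (simp add: powr_add[symmetric] \<theta>_def)
    finally show ?thesis by simp
  qed
  have "level_energy s k \<le> (\<Sum>u\<in>words n k. ?C powr \<theta> * \<rho> (j u) powr (- s * \<theta>) * X u)"
    unfolding level_energy_def by (intro sum_mono one)
  \<comment> \<open>Words of one level may need different mesh sizes, and one mesh sum controls only
    words of equal size; hence the grouping by \<open>j u\<close>.\<close>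
  also have "\<dots> = (\<Sum>i\<in>j ` words n k. \<Sum>u\<in>{u \<in> words n k. j u = i}. ?C powr \<theta> * \<rho> (j u) powr (- s * \<theta>) * X u)"
    by (rule sum.image_gen[OF finite_words])
  also have "\<dots> \<le> (\<Sum>i\<in>j ` words n k. ?C powr \<theta> * ((a powr \<eta>) ^ k * (2 powr (- \<eta>)) ^ i))"
  proof (rule sum_mono)
    fix i assume i: "i \<in> j ` words n k"
    then have ik: "\<rho> i \<le> a ^ k" using j(3) by auto
    have "(\<Sum>u\<in>{u \<in> words n k. j u = i}. X u) \<le> mesh_sum \<omega> (\<rho> i)"
      unfolding X_def using Ffin
      by (intro sum_disjoint_powr_le_mesh_sum[OF \<omega> \<rho>0, of _ k]) (auto simp: F_def)
    also have "\<dots> \<le> \<rho> i powr (t * \<theta>)"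
      unfolding \<theta>_def using ik k by (intro r0 \<rho>0) auto
    finally have XX: "(\<Sum>u\<in>{u \<in> words n k. j u = i}. X u) \<le> \<rho> i powr (t * \<theta>)" .
    have "(\<Sum>u\<in>{u \<in> words n k. j u = i}. ?C powr \<theta> * \<rho> (j u) powr (- s * \<theta>) * X u)
      = ?C powr \<theta> * (\<rho> i powr (- s * \<theta>) * (\<Sum>u\<in>{u \<in> words n k. j u = i}. X u))"
      by (simp add: sum_distrib_left mult.assoc)
    also have "\<dots> \<le> ?C powr \<theta> * (\<rho> i powr (- s * \<theta>) * \<rho> i powr (t * \<theta>))"
      by (intro mult_left_mono XX) auto
    \<comment> \<open>The gain \<open>(t - s) * (q - 1)\<close> is \<open>2 * \<eta>\<close>. One
      half becomes decay in \<open>k\<close> through \<open>\<rho> i \<le> a ^ k\<close>, the other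
      half makes the sum over dyadic sizes converge.\<close>
    also have "\<rho> i powr (- s * \<theta>) * \<rho> i powr (t * \<theta>) = \<rho> i powr \<eta> * \<rho> i powr \<eta>"
      by (simp add: powr_add[symmetric] \<eta>_def \<theta>_def[symmetric] algebra_simps)
    also have "?C powr \<theta> * (\<rho> i powr \<eta> * \<rho> i powr \<eta>) \<le> ?C powr \<theta> * ((a ^ k) powr \<eta> * \<rho> i powr \<eta>)"
      using ik \<eta> \<rho>0[of i] by (intro mult_left_mono mult_right_mono powr_mono2) auto
    also have "(a ^ k) powr \<eta> = (a powr \<eta>) ^ k"
      using a by (simp add: powr_realpow[symmetric] powr_powr mult.commute)
    also have "\<rho> i powr \<eta> = (2 powr (- \<eta>)) ^ i"
      by (simp add: \<rho>_def powr_powr powr_realpow[symmetric] mult.commute)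
    finally show "(\<Sum>u\<in>{u \<in> words n k. j u = i}. ?C powr \<theta> * \<rho> (j u) powr (- s * \<theta>) * X u)
      \<le> ?C powr \<theta> * ((a powr \<eta>) ^ k * (2 powr (- \<eta>)) ^ i)" .
  qed
  also have "\<dots> = ?C powr \<theta> * (a powr \<eta>) ^ k * (\<Sum>i\<in>j ` words n k. (2 powr (- \<eta>)) ^ i)"
    by (simp add: sum_distrib_left mult.assoc)
  also have "\<dots> \<le> ?C powr \<theta> * (a powr \<eta>) ^ k * (1 / (1 - 2 powr (- \<eta>)))"
  proof (intro mult_left_mono)
    have z: "norm (2 powr (- \<eta>)) < 1" using \<eta> by (simp add: powr_less_one)
    have "(\<Sum>i\<in>j ` words n k. (2 powr (- \<eta>)) ^ i) \<le> (\<Sum>i. (2 powr (- \<eta>)) ^ i)"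
      using finite_words by (intro sum_le_suminf summable_geometric z) auto
    then show "(\<Sum>i\<in>j ` words n k. (2 powr (- \<eta>)) ^ i) \<le> 1 / (1 - 2 powr (- \<eta>))"
      using suminf_geometric[OF z] by simp
  qed auto
  finally show ?thesis by (simp add: \<theta>_def mult_ac)
qed

lemma summable_level_energy:
  assumes \<omega>: "nonautonomous_structure n T J \<omega>" and s: "0 < s" "s \<le> real CARD('d)"
    and st: "ereal s < lower_gen_dim q (image_measure T J \<mu> \<omega>)"
  shows "summable (\<lambda>k. level_energy s (Suc k))"
proof -
  obtain t where t: "s < t" "ereal t < lower_gen_dim q (image_measure T J \<mu> \<omega>)"
    using ereal_dense2[OF st] by auto
  obtain r0 where r0: "0 < r0" "r0 \<le> 1" "\<And>r. 0 < r \<Longrightarrow> r < r0 \<Longrightarrow> mesh_sum \<omega> r \<le> r powr (t * (q - 1))"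
    using mesh_sum_less_powr[OF \<omega> t(2)] by blast
  define \<eta> where "\<eta> = (t - s) * (q - 1) / 2"
  have \<eta>: "\<eta> > 0" using t q by (simp add: \<eta>_def)
  obtain N where N: "a ^ N < r0" using real_arch_pow_inv[OF r0(1) a(2)] by blast
  have le: "level_energy s k \<le> ((4 * (RJ + real CARD('d))) ^ CARD('d)) powr (q - 1) *
    (1 / (1 - 2 powr (- \<eta>))) * (a powr \<eta>) ^ k" if "N \<le> k" for k
    unfolding \<eta>_def
  proof (rule level_energy_le[OF \<omega> s t(1) r0(2,3)])
    have "a ^ k \<le> a ^ N" using that a by (intro power_decreasing) auto
    then show "a ^ k < r0" using N by linarith
  qed auto
  have "norm (a powr \<eta>) < 1" using a \<eta> by (simp add: powr_def mult_pos_neg)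
  then have "summable (\<lambda>k. ((4 * (RJ + real CARD('d))) ^ CARD('d)) powr (q - 1) *
    (1 / (1 - 2 powr (- \<eta>))) * (a powr \<eta>) ^ k)"
    by (intro summable_mult summable_geometric)
  then have "summable (level_energy s)"
    by (rule summable_comparison_test'[of _ N]) (use le level_energy_nonneg in auto)
  then show ?thesis by (simp add: summable_Suc_iff)
qed

text \<open>At most \<open>V / r ^ CARD('d)\<close> cubes meet \<open>J\<close>, so the power mean
  inequality bounds the mesh sum from below by a multiple of \<open>r powr (d * (q - 1))\<close>. A
  dimension above some \<open>t > d\<close> would force the total mass to be 0 as \<open>r\<close>
  tends to 0.\<close>

lemma lower_gen_dim_le_dimension:
  assumes \<omega>: "nonautonomous_structure n T J \<omega>"
  shows "lower_gen_dim q (image_measure T J \<mu> \<omega>) \<le> ereal (real CARD('d))"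
proof (rule ccontr)
  assume "\<not> ?thesis"
  then have "ereal (real CARD('d)) < lower_gen_dim q (image_measure T J \<mu> \<omega>)" by (simp only: not_le)
  then obtain t where t: "real CARD('d) < t" "ereal t < lower_gen_dim q (image_measure T J \<mu> \<omega>)"
    using ereal_dense2 by fastforce
  obtain r0 where r0: "0 < r0" "r0 \<le> 1" "\<And>r. 0 < r \<Longrightarrow> r < r0 \<Longrightarrow> mesh_sum \<omega> r \<le> r powr (t * (q - 1))"
    using mesh_sum_less_powr[OF \<omega> t(2)] by blast
  define \<theta> where "\<theta> = q - 1"
  have \<theta>: "\<theta> > 0" using q by (simp add: \<theta>_def)
  let ?mass = "measure \<mu> (space \<mu>)"
  let ?B = "cball 0 (RJ + real CARD('d)) :: (real^'d) set"
  define V where "V = measure lborel ?B"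
  have V: "emeasure lborel ?B \<le> ennreal V" "0 \<le> V"
    unfolding V_def using emeasure_bounded_finite[of ?B]
    by (auto simp: emeasure_eq_ennreal_measure less_top[symmetric])
  have key: "?mass powr q \<le> V powr \<theta> * r powr ((t - real CARD('d)) * \<theta>)" if r: "0 < r" "r < r0" for r
  proof -
    define F where "F = {Q \<in> mesh_cubes r. Q \<inter> J \<noteq> {}}"
    have bound: "real (card G) \<le> V / r ^ CARD('d)" if G: "finite G" "G \<subseteq> F" for G
    proof -
      have "real (card G) * r ^ CARD('d) \<le> V"
      proof (rule card_mesh_cubes_le[OF r(1) G(1) _ _ _ _ V])
        show "G \<subseteq> mesh_cubes r" "\<And>Q. Q \<in> G \<Longrightarrow> Q \<inter> J \<noteq> {}" using G(2) by (auto simp: F_def)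
        fix x z :: "real^'d" assume x: "x \<in> J" and z: "norm z \<le> real CARD('d) * r"
        have "norm (x + z) \<le> RJ + real CARD('d) * r" using J(3)[OF x] z norm_triangle_ineq[of x z] by linarith
        also have "\<dots> \<le> RJ + real CARD('d) * 1" using r r0 by (intro add_left_mono mult_left_mono) auto
        finally show "x + z \<in> ?B" by simp
      qed simp
      then show ?thesis using r by (simp add: field_simps)
    qed
    have "finite F \<and> card F \<le> nat \<lfloor>V / r ^ CARD('d)\<rfloor>"
    proof (rule finite_if_finite_subsets_card_bdd)
      fix G assume "G \<subseteq> F" "finite G"
      then show "card G \<le> nat \<lfloor>V / r ^ CARD('d)\<rfloor>" using bound[of G] by (simp add: le_nat_floor)
    qed
    then have F: "finite F" ..
    have sub: "projection T J \<omega> ` space \<mu> \<subseteq> \<Union>F"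
    proof
      fix x assume "x \<in> projection T J \<omega> ` space \<mu>"
      then obtain w where w: "w \<in> inf_words n" "x = projection T J \<omega> w" by (auto simp: space_\<mu>)
      have "x \<in> basic_set T J \<omega> []" using projection_mem[OF \<omega> w(1), of 0] w by (simp add: prefix_word_def)
      then have "x \<in> J" by (simp add: basic_set_def)
      moreover obtain Q where "Q \<in> mesh_cubes r" "x \<in> Q"
        using Union_mesh_cubes[OF r(1), where 'a='d] by blast
      ultimately show "x \<in> \<Union>F" by (auto simp: F_def)
    qed
    have "?mass powr q \<le> real (card F) powr (q - 1) *
      (\<Sum>Q\<in>F. measure \<mu> (space \<mu> \<inter> projection T J \<omega> -` Q) powr q)"
      by (rule powr_mass_le_card[OF \<omega> _ r(1) F _ sub]) (auto simp: F_def)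
    also have "\<dots> \<le> (V / r ^ CARD('d)) powr (q - 1) * r powr (t * (q - 1))"
    proof (intro mult_mono powr_mono2)
      have "(\<Sum>Q\<in>F. measure \<mu> (space \<mu> \<inter> projection T J \<omega> -` Q) powr q)
        = (\<Sum>Q\<in>F. measure (image_measure T J \<mu> \<omega>) Q powr q)"
      proof (rule sum.cong[OF refl])
        fix Q assume "Q \<in> F"
        then have "Q \<in> sets borel" by (intro mesh_cubes_borel) (auto simp: F_def)
        then show "measure \<mu> (space \<mu> \<inter> projection T J \<omega> -` Q) powr q = measure (image_measure T J \<mu> \<omega>) Q powr q"
          by (simp add: measure_image_measure[OF \<omega>] Int_commute)
      qed
      also have "\<dots> \<le> mesh_sum \<omega> r" by (rule mesh_sum_ge[OF \<omega> r(1) F]) (auto simp: F_def)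
      also have "\<dots> \<le> r powr (t * (q - 1))" by (rule r0(3)[OF r])
      finally show "(\<Sum>Q\<in>F. measure \<mu> (space \<mu> \<inter> projection T J \<omega> -` Q) powr q) \<le> r powr (t * (q - 1))" .
      show "real (card F) \<le> V / r ^ CARD('d)" using F by (rule bound) simp
    qed (use q in \<open>auto intro!: sum_nonneg\<close>)
    also have "\<dots> = V powr \<theta> * r powr ((t - real CARD('d)) * \<theta>)"
    proof -
      have "(V / r ^ CARD('d)) powr (q - 1) = V powr \<theta> / r powr (real CARD('d) * \<theta>)"
        using V r by (simp add: \<theta>_def powr_divide powr_realpow[symmetric] powr_powr)
      then show ?thesis by (simp add: \<theta>_def powr_diff left_diff_distrib)
    qed
    finally show ?thesis .
  qed
  define e where "e = (t - real CARD('d)) * \<theta>"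
  have e: "e > 0" using t \<theta> by (simp add: e_def)
  have "((\<lambda>r. V powr \<theta> * r powr e) \<longlongrightarrow> 0) (at_right 0)"
    using e by real_asymp
  moreover have "\<forall>\<^sub>F r in at_right 0. ?mass powr q \<le> V powr \<theta> * r powr e"
    unfolding e_def using key r0(1) by (intro eventually_at_rightI[of 0 r0]) auto
  ultimately have "?mass powr q \<le> 0"
    by (rule tendsto_lowerbound) simp
  moreover have "0 < ?mass powr q" using \<mu>_pos by simp
  ultimately show False by linarith
qed

text \<open>An \<open>s\<close> strictly between \<open>d_minus\<close> and the dimension would
  satisfy \<open>s \<le> d\<close> by the previous bound, so its energy series would converge and
  place \<open>s\<close> below \<open>d_minus\<close>.\<close>

lemma lower_gen_dim_le:
  assumes \<omega>: "nonautonomous_structure n T J \<omega>"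
  shows "lower_gen_dim q (image_measure T J \<mu> \<omega>) \<le> min (d_minus n T \<mu> q) (ereal (real CARD('d)))"
proof -
  let ?l = "lower_gen_dim q (image_measure T J \<mu> \<omega>)"
  have d: "?l \<le> ereal (real CARD('d))" by (rule lower_gen_dim_le_dimension[OF \<omega>])
  have "?l \<le> d_minus n T \<mu> q"
  proof (rule ccontr)
    assume "\<not> ?l \<le> d_minus n T \<mu> q"
    then have "d_minus n T \<mu> q < ?l" by (simp only: not_le)
    then obtain s where s: "d_minus n T \<mu> q < ereal s" "ereal s < ?l" using ereal_dense2 by blast
    have "0 < ereal s" using d_minus_nonneg s(1) by (rule le_less_trans)
    moreover have "ereal s < ereal (real CARD('d))" using s(2) d by (rule less_le_trans)
    ultimately have s': "0 < s" "s \<le> real CARD('d)" by auto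
    have "ereal s \<le> d_minus n T \<mu> q"
      by (rule in_d_minus[OF s'(1) summable_level_energy[OF \<omega> s' s(2)]])
    then show False using s(1) by simp
  qed
  with d show ?thesis by simp
qed

end

theorem theorem2p9:
  fixes n :: "nat \<Rightarrow> nat"
    and T :: "nat \<Rightarrow> nat \<Rightarrow> real^'d^'d"
    and J D :: "(real^'d) set"
    and P :: "(real^'d) measure"
    and \<mu> :: "(nat \<Rightarrow> nat) measure"
    and q :: real
  assumes alphabet: "\<And>k. k \<ge> 1 \<Longrightarrow> n k \<ge> 2"
    and J: "compact J" "interior J \<noteq> {}"
    and contracting: "\<And>k i. k \<ge> 1 \<Longrightarrow> i \<in> {1..n k} \<Longrightarrow> onorm ((*v) (T k i)) < 1"
    and nonsingular: "\<And>k i. k \<ge> 1 \<Longrightarrow> i \<in> {1..n k} \<Longrightarrow> invertible (T k i)"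
    and alpha_minus: "0 < (INF (k, i)\<in>Sigma {1..} (\<lambda>k. {1..n k}). sing_value (T k i) CARD('d))"
    and alpha_minus_le_plus:
      "(INF (k, i)\<in>Sigma {1..} (\<lambda>k. {1..n k}). sing_value (T k i) CARD('d))
        \<le> (SUP (k, i)\<in>Sigma {1..} (\<lambda>k. {1..n k}). sing_value (T k i) 1)"
    and alpha_plus: "(SUP (k, i)\<in>Sigma {1..} (\<lambda>k. {1..n k}). sing_value (T k i) 1) < 1"
    and D: "bounded D"
    and P: "prob_space P" "sets P = sets borel" "absolutely_continuous lborel P"
    and P_D: "AE x in P. x \<in> D"
    and nested:
      "AE \<omega> in PiM (fin_words n) (\<lambda>_. P). nonautonomous_structure n T J \<omega>"
    and \<mu>: "finite_measure \<mu>" "sets \<mu> = sets (restrict_space borel (inf_words n))"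
      "measure \<mu> (space \<mu>) > 0"
    and q: "q > 1"
  shows "AE \<omega> in PiM (fin_words n) (\<lambda>_. P).
    lower_gen_dim q (image_measure T J \<mu> \<omega>) = min (d_minus n T \<mu> q) (ereal (real CARD('d)))"
proof -
  define \<Omega> where "\<Omega> = Sigma {1::nat..} (\<lambda>k. {1..n k})"
  define a where "a = (SUP (k, i)\<in>\<Omega>. sing_value (T k i) 1)"
  define b where "b = (INF (k, i)\<in>\<Omega>. sing_value (T k i) CARD('d))"
  have b0: "0 < b" and ba: "b \<le> a" and a1: "a < 1"
    using alpha_minus alpha_minus_le_plus alpha_plus by (simp_all add: a_def b_def \<Omega>_def)
  have d: "1 \<in> {1..CARD('d)}" "CARD('d) \<in> {1..CARD('d)}" by (auto simp: Suc_le_eq)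
  \<comment> \<open>Suprema and infima of reals can be compared with members only for bounded
    families: contraction bounds the largest singular values by 1, and nonnegativity bounds the
    smallest ones from below.\<close>
  have "sing_value (T k i) 1 \<le> 1" if "(k, i) \<in> \<Omega>" for k i
  proof -
    have "norm (T k i *v x) \<le> 1 * norm x" for x
    proof -
      have "norm (T k i *v x) \<le> onorm ((*v) (T k i)) * norm x"
        by (rule onorm) (rule matrix_vector_mul_bounded_linear)
      also have "\<dots> \<le> 1 * norm x"
        using contracting[of k i] that by (intro mult_right_mono) (auto simp: \<Omega>_def)
      finally show ?thesis .
    qed
    then show ?thesis by (rule sing_value_le[OF d(1)])
  qed
  then have upper: "sing_value (T k i) 1 \<le> a" if "(k, i) \<in> \<Omega>" for k i
    unfolding a_def using that by (intro cSUP_upper2[where x = "(k, i)"] bdd_aboveI2[where M = 1]) auto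
  have lower: "b \<le> sing_value (T k i) CARD('d)" if "(k, i) \<in> \<Omega>" for k i
    unfolding b_def using that d(2)
    by (intro cINF_lower2[where x = "(k, i)"] bdd_belowI2[where m = 0]) (auto intro: sing_value_nonneg)
  obtain R where R: "0 \<le> R" "\<And>x. x \<in> D \<Longrightarrow> norm x \<le> R"
    using bounded_pos[of D] D by (auto intro: less_imp_le)
  obtain RJ where RJ: "\<And>x. x \<in> J \<Longrightarrow> norm x \<le> RJ"
    using compact_imp_bounded[OF J(1)] by (auto simp: bounded_iff)
  have T_upper: "norm (T k i *v x) \<le> a * norm x" and T_lower: "b * norm x \<le> norm (T k i *v x)"
    if "1 \<le> k" "i \<in> {1..n k}" for k i x
  proof -
    have ki: "(k, i) \<in> \<Omega>" using that by (simp add: \<Omega>_def)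
    have "norm (T k i *v x) \<le> sing_value (T k i) 1 * norm x" by (rule norm_mult_vec_le_sing_value)
    also have "\<dots> \<le> a * norm x" by (intro mult_right_mono upper[OF ki]) simp
    finally show "norm (T k i *v x) \<le> a * norm x" .
    have "b * norm x \<le> sing_value (T k i) CARD('d) * norm x" by (intro mult_right_mono lower[OF ki]) simp
    also have "\<dots> \<le> norm (T k i *v x)" by (rule sing_value_le_norm_mult_vec)
    finally show "b * norm x \<le> norm (T k i *v x)" .
  qed
  have "J \<noteq> {}" using J(2) by auto
  moreover have "AE x in P. norm x \<le> R" using P_D by eventually_elim (rule R(2))
  ultimately interpret random_affine_measure n T a b J RJ \<mu> q P R
    using b0 ba a1 J(1) RJ \<mu> q P R(1) T_upper T_lower
    unfolding random_affine_measure_def affine_measure_def random_affine_system_def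
      affine_measure_axioms_def random_affine_system_axioms_def affine_system_def
    by auto
  from AE_lower_bound[OF nested] nested show ?thesis
  proof eventually_elim
    case (elim \<omega>)
    then show ?case using lower_gen_dim_le[of \<omega>] by (intro antisym) auto
  qed
qed

end
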